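(* Let $\alpha>1$, $\Sigma>0$, $x_0>0$, and let $B_1,b(0)$ be non-negative constants and $B_2>0$ such that $2(\alpha-1)\le1+2\frac{B_2}{\Sigma^2}$; set $b(x)=b(0)+B_1x-B_2x^{2\alpha-1}$ and $\sigma(x)=\Sigma x^{\alpha}$ for $x\ge0$. Let $\Delta t\le\frac1{B_1}$. Then the exponential Euler scheme $\overline X$ with time-step $\Delta t$ and initial value $x_0$, solution on $[0,+\infty)$ to $$d\overline X_t=\big(\overline X_t-b(0)\delta(t)\big)\Big[\big(B_1-B_2\overline X_{\eta(t)}^{2(\alpha-1)}\big)dt+\Sigma\,\overline X_{\eta(t)}^{\alpha-1}dW_t\Big]+b(0)\,dt,\qquad \overline X_0=x_0,$$ satisfies $$\liminf_{t\to+\infty}\overline X_t\le\xi_{\Delta t}\qquad\text{and}\qquad\limsup_{t\to+\infty}\overline X_t\ge\xi^{\Delta t},\qquad\mathbb P\text{-a.s.},$$ where $\xi^{\Delta t}$ is the unique positive solution of $\varphi^{\Delta t}(x)=0$ with $$\varphi^{\Delta t}(x):=\frac{b(x)}x-\frac12\Big(\frac{\sigma(x)}x\Big)^2-\frac{b(0)}xB_1\Delta t,$$ and $\xi_{\Delta t}$ is the unique positive solution of $\varphi_{\Delta t}(x)=0$ with $$\varphi_{\Delta t}(x):=\frac{b(x)}x-\frac12\Big(\frac{\sigma(x)}x\Big)^2+b(0)(\Sigma^2+B_2)x^{2\alpha-3}\Delta t.$$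
   Context: $W$ is a standard one-dimensional Brownian motion, $\Delta t>0$, $\eta(t)=\Delta t\lfloor t/\Delta t\rfloor$ and $\delta(t)=t-\eta(t)$. When $B_1=0$, the condition $\Delta t\le 1/B_1$ is void.
   Formalization: The formal theorem assumes that b(0) and B_1 are not both zero; if b(0)=B_1=0, both functions equal -(B_2+Σ²/2)x^{2(α-1)}<0 on (0,∞), so they have no positive zero and ξ is undefined. *)

theory Defs
  imports "HOL-Probability.Probability"
begin

section \<open>Brownian motion and the Ito integral\<close>

text \<open>
  Processes are indexed by \<^typ>\<open>real\<close>; only the times \<open>t \<ge> 0\<close> matter. The filtration may be any
  one for which \<open>W\<close> is a Brownian motion; neither completeness nor right-continuity is required.
\<close>

definition brownian_motion ::
    "'a measure \<Rightarrow> (real \<Rightarrow> 'a measure) \<Rightarrow> (real \<Rightarrow> 'a \<Rightarrow> real) \<Rightarrow> bool" where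
  "brownian_motion M F W \<longleftrightarrow>
     prob_space M \<and>
     filtration (space M) F \<and> (\<forall>t. subalgebra M (F t)) \<and>
     (\<forall>t\<ge>0. W t \<in> borel_measurable (F t)) \<and>
     (AE \<omega> in M. W 0 \<omega> = 0) \<and>
     (AE \<omega> in M. continuous_on {0..} (\<lambda>t. W t \<omega>)) \<and>
     (\<forall>s t. 0 \<le> s \<and> s < t \<longrightarrow>
        distributed M lborel (\<lambda>\<omega>. W t \<omega> - W s \<omega>) (\<lambda>x. ennreal (normal_density 0 (sqrt (t - s)) x)) \<and>
        prob_space.indep_set M
          (sets (F s)) (sets (vimage_algebra (space M) (\<lambda>\<omega>. W t \<omega> - W s \<omega>) borel)))"

definition progressively_measurable ::
    "(real \<Rightarrow> 'a measure) \<Rightarrow> (real \<Rightarrow> 'a \<Rightarrow> real) \<Rightarrow> bool" where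
  "progressively_measurable F H \<longleftrightarrow>
     (\<forall>t\<ge>0. (\<lambda>(s, \<omega>). H s \<omega>) \<in> borel_measurable (restrict_space borel {0..t} \<Otimes>\<^sub>M F t))"

definition null_in_probability :: "'a measure \<Rightarrow> (nat \<Rightarrow> 'a \<Rightarrow> ennreal) \<Rightarrow> bool" where
  "null_in_probability M Z \<longleftrightarrow>
     (\<forall>n. Z n \<in> borel_measurable M) \<and>
     (\<forall>\<epsilon>>0. (\<lambda>n. measure M {\<omega> \<in> space M. ennreal \<epsilon> < Z n \<omega>}) \<longlonglongrightarrow> 0)"

text \<open>
  The data \<open>(k, p, c)\<close> stands for the simple process
  \<open>c\<^sub>0 1\<^bsub>(p\<^sub>0, p\<^sub>1]\<^esub> + \<dots> + c\<^bsub>k-1\<^esub> 1\<^bsub>(p\<^bsub>k-1\<^esub>, p\<^sub>k]\<^esub>\<close>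
  with deterministic times \<open>p\<^sub>i\<close> and bounded \<open>F\<^bsub>p i\<^esub>\<close>-measurable coefficients \<open>c\<^sub>i\<close>.
\<close>

definition simple_data ::
    "(real \<Rightarrow> 'a measure) \<Rightarrow> nat \<Rightarrow> (nat \<Rightarrow> real) \<Rightarrow> (nat \<Rightarrow> 'a \<Rightarrow> real) \<Rightarrow> bool" where
  "simple_data F k p c \<longleftrightarrow>
     0 \<le> p 0 \<and> (\<forall>i<k. p i \<le> p (Suc i)) \<and>
     (\<forall>i<k. c i \<in> borel_measurable (F (p i)) \<and> (\<exists>K. \<forall>\<omega>\<in>space (F (p i)). \<bar>c i \<omega>\<bar> \<le> K))"

definition simple_process ::
    "nat \<Rightarrow> (nat \<Rightarrow> real) \<Rightarrow> (nat \<Rightarrow> 'a \<Rightarrow> real) \<Rightarrow> real \<Rightarrow> 'a \<Rightarrow> real" where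
  "simple_process k p c s \<omega> = (\<Sum>i<k. c i \<omega> * indicator {p i <.. p (Suc i)} s)"

definition simple_integral ::
    "(real \<Rightarrow> 'a \<Rightarrow> real) \<Rightarrow> nat \<Rightarrow> (nat \<Rightarrow> real) \<Rightarrow> (nat \<Rightarrow> 'a \<Rightarrow> real) \<Rightarrow> real \<Rightarrow> 'a \<Rightarrow> real" where
  "simple_integral W k p c t \<omega> =
     (\<Sum>i<k. c i \<omega> * (W (min (p (Suc i)) t) \<omega> - W (min (p i) t) \<omega>))"

text \<open>
  \<open>I\<close> is a continuous version of the Ito integral \<open>t \<mapsto> \<integral>\<^sub>0\<^sup>t H\<^sub>s dW\<^sub>s\<close> of a progressively measurable
  \<open>H\<close> with a.s. locally square integrable paths: \<open>I\<^sub>t\<close> is the limit in probability of the integrals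
  of simple processes \<open>H\<^sup>n\<close> such that \<open>\<integral>\<^sub>0\<^sup>t (H\<^sup>n\<^sub>s - H\<^sub>s)\<^sup>2 ds \<rightarrow> 0\<close> in probability. This determines
  \<open>I\<close> up to indistinguishability.
\<close>

definition is_ito_integral ::
    "'a measure \<Rightarrow> (real \<Rightarrow> 'a measure) \<Rightarrow> (real \<Rightarrow> 'a \<Rightarrow> real) \<Rightarrow>
     (real \<Rightarrow> 'a \<Rightarrow> real) \<Rightarrow> (real \<Rightarrow> 'a \<Rightarrow> real) \<Rightarrow> bool" where
  "is_ito_integral M F W H I \<longleftrightarrow>
     progressively_measurable F H \<and>
     (AE \<omega> in M. \<forall>t\<ge>0. (\<integral>\<^sup>+s\<in>{0..t}. ennreal ((H s \<omega>)\<^sup>2) \<partial>lborel) < \<infinity>) \<and>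
     (AE \<omega> in M. continuous_on {0..} (\<lambda>t. I t \<omega>)) \<and>
     (\<exists>k p c. (\<forall>n. simple_data F (k n) (p n) (c n)) \<and>
        (\<forall>t\<ge>0.
           null_in_probability M (\<lambda>n \<omega>.
             \<integral>\<^sup>+s\<in>{0..t}. ennreal ((simple_process (k n) (p n) (c n) s \<omega> - H s \<omega>)\<^sup>2) \<partial>lborel) \<and>
           null_in_probability M (\<lambda>n \<omega>.
             ennreal \<bar>simple_integral W (k n) (p n) (c n) t \<omega> - I t \<omega>\<bar>)))"

text \<open>\<open>dX\<^sub>t = A\<^sub>t dt + H\<^sub>t dW\<^sub>t\<close> on \<open>[0, \<infinity>)\<close>, \<open>X\<^sub>0 = x0\<close>, for a continuous adapted process \<open>X\<close>.\<close>

definition has_ito_differential ::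
    "'a measure \<Rightarrow> (real \<Rightarrow> 'a measure) \<Rightarrow> (real \<Rightarrow> 'a \<Rightarrow> real) \<Rightarrow> real \<Rightarrow> (real \<Rightarrow> 'a \<Rightarrow> real) \<Rightarrow>
     (real \<Rightarrow> 'a \<Rightarrow> real) \<Rightarrow> (real \<Rightarrow> 'a \<Rightarrow> real) \<Rightarrow> bool" where
  "has_ito_differential M F W x0 X A H \<longleftrightarrow>
     (\<forall>t\<ge>0. X t \<in> borel_measurable (F t)) \<and>
     (AE \<omega> in M. continuous_on {0..} (\<lambda>t. X t \<omega>)) \<and>
     progressively_measurable F A \<and>
     (AE \<omega> in M. \<forall>t\<ge>0. set_integrable lborel {0..t} (\<lambda>s. A s \<omega>)) \<and>
     (\<exists>I. is_ito_integral M F W H I \<and>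
        (AE \<omega> in M. \<forall>t\<ge>0. X t \<omega> = x0 + (LBINT s:{0..t}. A s \<omega>) + I t \<omega>))"


section \<open>The exponential Euler scheme\<close>

definition eta :: "real \<Rightarrow> real \<Rightarrow> real" where
  "eta dt t = dt * of_int \<lfloor>t / dt\<rfloor>"

definition delta :: "real \<Rightarrow> real \<Rightarrow> real" where
  "delta dt t = t - eta dt t"

text \<open>
  The constant \<open>b0\<close> stands for \<open>b(0)\<close>. Solutions started at \<open>x0 > 0\<close> stay positive, so the value
  of \<open>powr\<close> at non-positive bases is irrelevant.
\<close>

definition exponential_euler_scheme ::
    "'a measure \<Rightarrow> (real \<Rightarrow> 'a measure) \<Rightarrow> (real \<Rightarrow> 'a \<Rightarrow> real) \<Rightarrow>
     real \<Rightarrow> real \<Rightarrow> real \<Rightarrow> real \<Rightarrow> real \<Rightarrow> real \<Rightarrow> real \<Rightarrow> (real \<Rightarrow> 'a \<Rightarrow> real) \<Rightarrow> bool" where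
  "exponential_euler_scheme M F W \<alpha> \<Sigma> b0 B1 B2 dt x0 X \<longleftrightarrow>
     has_ito_differential M F W x0 X
       (\<lambda>t \<omega>. (X t \<omega> - b0 * delta dt t) * (B1 - B2 * X (eta dt t) \<omega> powr (2 * (\<alpha> - 1))) + b0)
       (\<lambda>t \<omega>. (X t \<omega> - b0 * delta dt t) * (\<Sigma> * X (eta dt t) \<omega> powr (\<alpha> - 1)))"

definition b_coeff :: "real \<Rightarrow> real \<Rightarrow> real \<Rightarrow> real \<Rightarrow> real \<Rightarrow> real" where
  "b_coeff \<alpha> b0 B1 B2 x = b0 + B1 * x - B2 * x powr (2 * \<alpha> - 1)"

definition sigma_coeff :: "real \<Rightarrow> real \<Rightarrow> real \<Rightarrow> real" where
  "sigma_coeff \<alpha> \<Sigma> x = \<Sigma> * x powr \<alpha>"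

text \<open>\<open>phi_upper\<close> is \<open>\<phi>\<^sup>\<Delta>\<^sup>t\<close> (superscript) and \<open>phi_lower\<close> is \<open>\<phi>\<^sub>\<Delta>\<^sub>t\<close> (subscript).\<close>

definition phi_upper :: "real \<Rightarrow> real \<Rightarrow> real \<Rightarrow> real \<Rightarrow> real \<Rightarrow> real \<Rightarrow> real \<Rightarrow> real" where
  "phi_upper \<alpha> \<Sigma> b0 B1 B2 dt x =
     b_coeff \<alpha> b0 B1 B2 x / x - 1/2 * (sigma_coeff \<alpha> \<Sigma> x / x)\<^sup>2 - b0 / x * B1 * dt"

definition phi_lower :: "real \<Rightarrow> real \<Rightarrow> real \<Rightarrow> real \<Rightarrow> real \<Rightarrow> real \<Rightarrow> real \<Rightarrow> real" where
  "phi_lower \<alpha> \<Sigma> b0 B1 B2 dt x =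
     b_coeff \<alpha> b0 B1 B2 x / x - 1/2 * (sigma_coeff \<alpha> \<Sigma> x / x)\<^sup>2
       + b0 * (\<Sigma>\<^sup>2 + B2) * x powr (2 * \<alpha> - 3) * dt"

text \<open>Only meaningful when the positive zero exists and is unique.\<close>

definition positive_zero :: "(real \<Rightarrow> real) \<Rightarrow> real" where
  "positive_zero f = (THE x. 0 < x \<and> f x = 0)"

end

theory Submission
  imports Defs
begin

text \<open>
  Between two grid times the process \<open>Y = X - b0 \<delta>\<close> solves a linear equation
  \<open>dY = Y (\<mu> dt + \<nu> dW)\<close> whose coefficients are frozen at the left end point. Hence \<open>X\<close>, observed
  at the grid times, is an explicit random recursion \<open>x' = x exp G + b0 dt\<close> with
  \<open>G = (B1 - c u) dt + \<Sigma> x powr (\<alpha> - 1) \<Delta>W\<close>, where \<open>u = x powr (2 (\<alpha> - 1))\<close> and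
  \<open>c = B2 + \<Sigma>\<^sup>2 / 2\<close>. Both claims are about this recursion: a bound on \<open>X\<close> at infinitely many grid
  times bounds the lower, respectively upper, limit over all times.

  For the lower limit let \<open>a\<close> exceed the zero of \<^const>\<open>phi_lower\<close>. If \<open>x\<close> and \<open>x'\<close> both stay above
  \<open>a\<close>, then \<open>x exp G = x' - b0 dt \<ge> x' (1 - b0 dt / a)\<close>, so that \<open>ln x'\<close> is at most
  \<open>ln x + G - ln (1 - b0 dt / a)\<close>. The inequality \<open>phi_lower a < 0\<close> makes the mean of this increment
  strictly negative, uniformly in \<open>x \<ge> a\<close>. For the upper limit let \<open>a\<close> lie below the zero of
  \<^const>\<open>phi_upper\<close>. The function \<open>G \<mapsto> ln (exp G + b0 dt / x)\<close> is convex, so it lies above its tangent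
  at the mean of \<open>G\<close>, and \<open>phi_upper a > 0\<close> makes the mean of that tangent strictly positive,
  uniformly in \<open>0 < x \<le> a\<close>. In both cases the increment of the logarithm is bounded on the relevant side by a drift
  of constant sign plus a Gaussian term whose variance is controlled by the drift, so a small power
  of \<open>x\<close> (positive in the first case, negative in the second) contracts in mean by a
  factor \<open>exp (-\<kappa>)\<close> per step as long as the region is not left. Therefore the
  region is left with probability one, and this can be repeated from every grid time
  (\<open>ae_exit_infinitely_often\<close>).

  The remaining work is the explicit solution of the linear equation (\<open>linear_sde_explicit\<close>), starting
  from the Ito integral as a limit in probability of integrals of simple processes. The solution is
  compared with the Euler products \<open>\<Prod> (1 + \<mu> h + \<nu> \<Delta>W)\<close> on finer and finer
  uniform grids. These products converge to the stochastic exponential because the quadratic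
  variation of the Brownian path converges. The one-step residual of the solution is a short
  stochastic integral of \<open>\<nu> Y - \<nu> Y(left end)\<close>, and both the sum of its squares and its sum against
  the inverse products tend to zero in probability. Both facts rest on one estimate for discrete
  stochastic integrals (\<open>truncated_martingale_transform\<close>): the transform is small in probability
  as soon as its quadratic variation is.
\<close>

section \<open>The zeros of the two rate functions\<close>

text \<open>
  Every power has a negative exponent, so the function decreases strictly from \<open>\<infinity>\<close> at \<open>0\<close> to
  \<open>- c\<close> at \<open>\<infinity>\<close>.
\<close>

lemma decreasing_power_sum_zero:
  fixes A B C c p q :: real
  assumes A: "0 \<le> A" and B: "0 \<le> B" and C: "0 \<le> C" and AB: "0 < A \<or> 0 < B" and c: "0 < c" and p: "0 < p" and q: "0 < q"
  defines "g \<equiv> \<lambda>x. A * x powr - p + B * x powr - q + C * x powr - 1 - c"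
  shows "\<exists>\<xi>>0. \<forall>x>0. (g x = 0 \<longleftrightarrow> x = \<xi>) \<and> (0 < g x \<longleftrightarrow> x < \<xi>)"
proof -
  have anti: "y powr - r \<le> x powr - r" "r > 0 \<Longrightarrow> y powr - r < x powr - r" if "0 < x" "x < y" "0 \<le> r" for x y r :: real
    using that powr_less_mono2_neg[of "-r" x y] by (cases "r = 0"; force)+
  have dec: "g y < g x" if xy: "0 < x" "x < y" for x y
  proof -
    have "A * y powr - p \<le> A * x powr - p" "B * y powr - q \<le> B * x powr - q" "C * y powr - 1 \<le> C * x powr - 1"
      using mult_left_mono[OF anti(1)[OF xy, of p] A] mult_left_mono[OF anti(1)[OF xy, of q] B]
        mult_left_mono[OF anti(1)[OF xy, of 1] C] p q by linarith+
    moreover have "A * y powr - p < A * x powr - p \<or> B * y powr - q < B * x powr - q"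
      using AB anti(2)[OF xy] p q by auto
    ultimately show ?thesis unfolding g_def by linarith
  qed
  have nn: "0 \<le> A * x powr - p" "0 \<le> B * x powr - q" "0 \<le> C * x powr - 1" for x using A B C by auto
  obtain x1 where x1: "0 < x1" "0 < g x1"
  proof -
    have ex: "\<exists>x>0. E * x powr - r = c + 1" if "0 < E" "0 < r" for E r
      using that c by (intro exI[of _ "((c + 1) / E) powr (- 1 / r)"]) (auto simp: powr_powr)
    have "\<exists>x>0. 0 < g x"
      using AB
    proof
      assume "0 < A"
      then obtain x where x: "0 < x" "A * x powr - p = c + 1" using ex p by blast
      then show ?thesis using nn(2,3)[of x] unfolding g_def by (intro exI[of _ x]) linarith
    next
      assume "0 < B"
      then obtain x where x: "0 < x" "B * x powr - q = c + 1" using ex q by blast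
      then show ?thesis using nn(1,3)[of x] unfolding g_def by (intro exI[of _ x]) linarith
    qed
    then show ?thesis using that by blast
  qed
  have "((\<lambda>x. A * x powr - p + B * x powr - q + C * x powr - 1 - c) \<longlongrightarrow> A * 0 + B * 0 + C * 0 - c) at_top"
    using p q by (intro tendsto_intros tendsto_neg_powr filterlim_ident) auto
  then have "\<forall>\<^sub>F x in at_top. g x < 0"
    unfolding g_def using c by (intro order_tendstoD(2)) auto
  then have "\<forall>\<^sub>F x in at_top. g x < 0 \<and> x1 < x"
    by (rule eventually_conj[OF _ eventually_gt_at_top])
  then obtain x2 where x2: "g x2 < 0" "x1 < x2"
    using eventually_happens'[OF trivial_limit_at_top_linorder] by blast
  have "continuous_on {x1..x2} g"
    unfolding g_def using x1 by (intro continuous_intros) auto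
  then obtain \<xi> where \<xi>: "x1 \<le> \<xi>" "\<xi> \<le> x2" "g \<xi> = 0"
    using IVT2'[of g x2 0 x1] x1 x2 by auto
  have "0 < \<xi>" using \<xi> x1 by simp
  moreover have "(g x = 0 \<longleftrightarrow> x = \<xi>) \<and> (0 < g x \<longleftrightarrow> x < \<xi>)" if "0 < x" for x
    using dec[of x \<xi>] dec[of \<xi> x] \<xi>(3) that \<open>0 < \<xi>\<close> by (cases x \<xi> rule: linorder_cases) auto
  ultimately show ?thesis by blast
qed

text \<open>
  The part that both rate functions share: after cancelling powers it combines \<open>1 / x\<close>, a constant
  and the power \<open>2 (\<alpha> - 1)\<close> of \<open>x\<close>.
\<close>

lemma drift_quotient:
  assumes "0 < x"
  shows "b_coeff \<alpha> b0 B1 B2 x / x - 1/2 * (sigma_coeff \<alpha> \<Sigma> x / x)\<^sup>2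
    = b0 / x + B1 - (B2 + \<Sigma>\<^sup>2 / 2) * x powr (2 * (\<alpha> - 1))"
proof -
  have 1: "x powr (2 * \<alpha> - 1) / x = x powr (2 * (\<alpha> - 1))"
    using assms powr_diff[of x "2 * \<alpha> - 1" 1] by (simp add: algebra_simps)
  have 2: "x powr \<alpha> / x = x powr (\<alpha> - 1)"
    using assms powr_diff[of x \<alpha> 1] by simp
  have 3: "(x powr (\<alpha> - 1))\<^sup>2 = x powr (2 * (\<alpha> - 1))"
    using assms by (simp add: power2_eq_square powr_add[symmetric] algebra_simps)
  have "b_coeff \<alpha> b0 B1 B2 x / x = b0 / x + B1 - B2 * (x powr (2 * \<alpha> - 1) / x)"
    using assms by (simp add: b_coeff_def add_divide_distrib diff_divide_distrib)
  moreover have "(sigma_coeff \<alpha> \<Sigma> x / x)\<^sup>2 = \<Sigma>\<^sup>2 * (x powr \<alpha> / x)\<^sup>2"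
    by (simp add: sigma_coeff_def power_mult_distrib power_divide)
  ultimately show ?thesis unfolding 1 2 3 by (simp add: algebra_simps)
qed

lemma phi_upper_eq:
  assumes "0 < x"
  shows "phi_upper \<alpha> \<Sigma> b0 B1 B2 dt x = b0 * (1 - B1 * dt) / x + B1 - (B2 + \<Sigma>\<^sup>2 / 2) * x powr (2 * (\<alpha> - 1))"
  unfolding phi_upper_def drift_quotient[OF assms] using assms by (simp add: field_simps)

lemma phi_lower_eq:
  assumes "0 < x"
  shows "phi_lower \<alpha> \<Sigma> b0 B1 B2 dt x = b0 / x + B1 - x powr (2 * (\<alpha> - 1)) * ((B2 + \<Sigma>\<^sup>2 / 2) - (\<Sigma>\<^sup>2 + B2) * (b0 * dt / x))"
proof -
  have "x powr (2 * \<alpha> - 3) = x powr (2 * (\<alpha> - 1)) / x"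
    using assms powr_diff[of x "2 * (\<alpha> - 1)" 1] by (simp add: algebra_simps)
  then show ?thesis
    unfolding phi_lower_def drift_quotient[OF assms] by (simp add: algebra_simps add_divide_distrib)
qed

text \<open>
  After division by the power \<open>2 (\<alpha> - 1)\<close> of \<open>x\<close> both functions are decreasing sums of powers.
  The condition on \<open>dt\<close> makes the coefficient \<open>b0 (1 - B1 dt)\<close> in \<^const>\<open>phi_upper\<close> non-negative. The
  sign on either side of the zero is what the one-step inequalities start from.
\<close>

lemma phi_zeros:
  assumes alpha: "1 < \<alpha>" and b0: "0 \<le> b0" and B1: "0 \<le> B1" and B2: "0 < B2"
    and nd: "0 < b0 \<or> 0 < B1" and dt: "0 < dt" and dt_le: "0 < B1 \<longrightarrow> dt \<le> 1 / B1"
  shows "\<exists>\<xi>>0. \<forall>x>0. (phi_lower \<alpha> \<Sigma> b0 B1 B2 dt x = 0 \<longleftrightarrow> x = \<xi>) \<and> (0 < phi_lower \<alpha> \<Sigma> b0 B1 B2 dt x \<longleftrightarrow> x < \<xi>)"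
    and "\<exists>\<xi>>0. \<forall>x>0. (phi_upper \<alpha> \<Sigma> b0 B1 B2 dt x = 0 \<longleftrightarrow> x = \<xi>) \<and> (0 < phi_upper \<alpha> \<Sigma> b0 B1 B2 dt x \<longleftrightarrow> x < \<xi>)"
proof -
  let ?c = "B2 + \<Sigma>\<^sup>2 / 2"
  let ?g = "\<lambda>A C x. A * x powr - (2 * \<alpha> - 1) + B1 * x powr - (2 * (\<alpha> - 1)) + C * x powr - 1 - ?c"
  have c: "0 < ?c" using B2 by (intro add_pos_nonneg) auto
  have factor: "x powr (2 * (\<alpha> - 1)) * ?g A C x = A / x + B1 + C * x powr (2 * (\<alpha> - 1)) / x - ?c * x powr (2 * (\<alpha> - 1))"
    if "0 < x" for x A C
  proof -
    have 1: "x powr (2 * (\<alpha> - 1)) * x powr - (2 * \<alpha> - 1) = 1 / x"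
      using that powr_minus_divide[of x 1] by (simp add: powr_add[symmetric] algebra_simps)
    have 2: "x powr (2 * (\<alpha> - 1)) * x powr - (2 * (\<alpha> - 1)) = 1"
      using that by (simp add: powr_add[symmetric])
    have 3: "x powr - 1 = 1 / x" using that powr_minus_divide[of x 1] by simp
    have "x powr (2 * (\<alpha> - 1)) * ?g A C x = A * (x powr (2 * (\<alpha> - 1)) * x powr - (2 * \<alpha> - 1))
        + B1 * (x powr (2 * (\<alpha> - 1)) * x powr - (2 * (\<alpha> - 1))) + C * x powr (2 * (\<alpha> - 1)) * x powr - 1 - ?c * x powr (2 * (\<alpha> - 1))"
      by (simp add: algebra_simps)
    also have "\<dots> = A * (1 / x) + B1 * 1 + C * x powr (2 * (\<alpha> - 1)) * (1 / x) - ?c * x powr (2 * (\<alpha> - 1))"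
      unfolding 1 2 3 ..
    finally show ?thesis by simp
  qed
  have sign: "(x powr (2 * (\<alpha> - 1)) * y = 0 \<longleftrightarrow> y = 0) \<and> (0 < x powr (2 * (\<alpha> - 1)) * y \<longleftrightarrow> 0 < y)" if "0 < x" for x y
    using that by (auto simp: zero_less_mult_iff)
  have lower: "phi_lower \<alpha> \<Sigma> b0 B1 B2 dt x = x powr (2 * (\<alpha> - 1)) * ?g b0 (b0 * (\<Sigma>\<^sup>2 + B2) * dt) x" if "0 < x" for x
    unfolding phi_lower_eq[OF that] factor[OF that] using that by (simp add: field_simps)
  have upper: "phi_upper \<alpha> \<Sigma> b0 B1 B2 dt x = x powr (2 * (\<alpha> - 1)) * ?g (b0 * (1 - B1 * dt)) 0 x" if "0 < x" for x
    unfolding phi_upper_eq[OF that] factor[OF that] by simp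
  have "\<exists>\<xi>>0. \<forall>x>0. (?g b0 (b0 * (\<Sigma>\<^sup>2 + B2) * dt) x = 0 \<longleftrightarrow> x = \<xi>) \<and> (0 < ?g b0 (b0 * (\<Sigma>\<^sup>2 + B2) * dt) x \<longleftrightarrow> x < \<xi>)"
    by (rule decreasing_power_sum_zero) (use alpha b0 B1 B2 nd dt c in auto)
  then show "\<exists>\<xi>>0. \<forall>x>0. (phi_lower \<alpha> \<Sigma> b0 B1 B2 dt x = 0 \<longleftrightarrow> x = \<xi>) \<and> (0 < phi_lower \<alpha> \<Sigma> b0 B1 B2 dt x \<longleftrightarrow> x < \<xi>)"
    by (simp only: lower sign cong: conj_cong imp_cong)
  have dt1: "B1 * dt \<le> 1" using dt_le B1 by (cases "B1 = 0") (auto simp: field_simps)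
  have "\<exists>\<xi>>0. \<forall>x>0. (?g (b0 * (1 - B1 * dt)) 0 x = 0 \<longleftrightarrow> x = \<xi>) \<and> (0 < ?g (b0 * (1 - B1 * dt)) 0 x \<longleftrightarrow> x < \<xi>)"
    by (rule decreasing_power_sum_zero) (use alpha b0 B1 nd dt1 c in auto)
  then show "\<exists>\<xi>>0. \<forall>x>0. (phi_upper \<alpha> \<Sigma> b0 B1 B2 dt x = 0 \<longleftrightarrow> x = \<xi>) \<and> (0 < phi_upper \<alpha> \<Sigma> b0 B1 B2 dt x \<longleftrightarrow> x < \<xi>)"
    by (simp only: upper sign cong: conj_cong imp_cong)
qed

section \<open>One-step inequalities for powers\<close>

text \<open>
  The function \<open>G \<mapsto> ln (exp G + q)\<close> is convex and has slope \<open>l\<close> at \<open>m\<close>; this is its tangent bound,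
  obtained as the weighted arithmetic-geometric mean inequality with weights \<open>l\<close> and \<open>1 - l\<close>.
\<close>

lemma exp_plus_const_ge:
  fixes G m q :: real
  assumes "0 \<le> q"
  defines "l \<equiv> exp m / (exp m + q)"
  shows "(exp m + q) * exp (l * (G - m)) \<le> exp G + q"
proof -
  have pos: "0 < exp m + q" using assms by (intro add_pos_nonneg) auto
  have l: "0 \<le> l" "l \<le> 1" using pos assms by (auto simp: l_def)
  have "exp ((1 - l) *\<^sub>R 0 + l *\<^sub>R (G - m)) \<le> (1 - l) * exp 0 + l * exp (G - m)"
    using exp_convex l by (intro convex_onD[of UNIV]) auto
  then have "exp (l * (G - m)) \<le> (1 - l) + l * exp (G - m)" by simp
  then have "(exp m + q) * exp (l * (G - m)) \<le> (exp m + q) * ((1 - l) + l * exp (G - m))"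
    using pos by (intro mult_left_mono) auto
  also have "\<dots> = exp G + q"
  proof -
    have "(exp m + q) * l = exp m" using pos by (simp add: l_def)
    then have "(exp m + q) * ((1 - l) + l * exp (G - m)) = exp m + q - exp m + exp m * exp (G - m)"
      by (simp only: ring_distribs mult.assoc[symmetric] mult_1_right)
    then show ?thesis by (simp add: exp_diff)
  qed
  finally show ?thesis .
qed

text \<open>
  The tangent bound gives \<open>ln x' \<ge> ln x + ln (exp m + q) + l (G - m)\<close> with \<open>q = b0 dt / x\<close>, and
  \<open>exp m + q \<ge> 1 + m + q \<ge> 1 + dt phi_upper a\<close>, uniformly for \<open>x \<le> a\<close>. The exponent on the right is
  arranged so that \<open>exp (S D - S\<^sup>2 dt / 2)\<close> appears, which has mean one for a centred Gaussian \<open>D\<close> of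
  variance \<open>dt\<close>: what remains is a contraction by \<open>exp (-\<kappa>)\<close>.
\<close>

lemma negative_power_decay_below_upper_zero:
  fixes \<alpha> \<Sigma> b0 B1 B2 dt a :: real
  defines "u \<equiv> \<lambda>x. x powr (2 * (\<alpha> - 1))"
  defines "m \<equiv> \<lambda>x. (B1 - (B2 + \<Sigma>\<^sup>2 / 2) * u x) * dt"
  defines "l \<equiv> \<lambda>x. exp (m x) / (exp (m x) + b0 * dt / x)"
  assumes alpha: "1 < \<alpha>" and Sigma: "0 < \<Sigma>" and b0: "0 \<le> b0" and B1: "0 \<le> B1" and B2: "0 < B2"
    and dt: "0 < dt" and dt_le: "0 < B1 \<longrightarrow> dt \<le> 1 / B1" and a: "0 < a" "0 < phi_upper \<alpha> \<Sigma> b0 B1 B2 dt a"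
  shows "\<exists>p>0. \<exists>\<kappa>>0. \<forall>x D. 0 < x \<longrightarrow> x \<le> a \<longrightarrow>
    (x * exp (m x + \<Sigma> * x powr (\<alpha> - 1) * D) + b0 * dt) powr - p
      \<le> x powr - p * exp (- \<kappa> + (- p * l x * \<Sigma> * x powr (\<alpha> - 1)) * D - (- p * l x * \<Sigma> * x powr (\<alpha> - 1))\<^sup>2 * dt / 2)"
proof -
  define L where "L = ln (1 + dt * phi_upper \<alpha> \<Sigma> b0 B1 B2 dt a)"
  have L: "0 < L" unfolding L_def using mult_pos_pos[OF dt a(2)] by simp
  have ua: "0 < u a" using a by (simp add: u_def)
  define w where "w = \<Sigma>\<^sup>2 * u a * dt"
  have w: "0 < w" using Sigma ua dt by (simp add: w_def)
  \<comment> \<open>The exponent balances the drift \<open>p L\<close> against the Gaussian correction \<open>p\<^sup>2 w / 2\<close>, of which it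
    leaves half of the drift.\<close>
  define p where "p = L / w"
  have p: "0 < p" "p * w = L" using L w by (auto simp: p_def)
  have dt1: "0 \<le> 1 - B1 * dt" using dt_le B1 by (cases "B1 = 0") (auto simp: field_simps)
  show ?thesis
  proof (rule exI[of _ p], rule conjI[OF p(1)], rule exI[of _ "p * L / 2"], intro conjI allI impI)
    show "0 < p * L / 2" using p L by auto
    fix x D :: real assume x: "0 < x" "x \<le> a"
    define q where "q = b0 * dt / x"
    define s where "s = \<Sigma> * x powr (\<alpha> - 1)"
    have q: "0 \<le> q" using b0 dt x by (simp add: q_def)
    have pos: "0 < exp (m x) + q" using q by (intro add_pos_nonneg) auto
    have lx: "l x = exp (m x) / (exp (m x) + q)" by (simp add: l_def q_def)
    have l01: "0 \<le> l x" "l x \<le> 1" using q pos by (auto simp: lx)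
    have s2: "s\<^sup>2 = \<Sigma>\<^sup>2 * u x"
      using x by (simp add: s_def u_def power_mult_distrib power2_eq_square powr_add[symmetric] algebra_simps)
    have ux: "u x \<le> u a" unfolding u_def using x alpha by (intro powr_mono2) auto
    have "1 + dt * phi_upper \<alpha> \<Sigma> b0 B1 B2 dt a \<le> 1 + m x + q"
    proof -
      have "b0 * (1 - B1 * dt) / a \<le> b0 * (1 - B1 * dt) / x"
        using x a b0 dt1 by (intro divide_left_mono) auto
      also have "\<dots> \<le> b0 / x" using b0 B1 dt x by (intro divide_right_mono) (auto simp: algebra_simps)
      finally have "phi_upper \<alpha> \<Sigma> b0 B1 B2 dt a \<le> b0 / x + B1 - (B2 + \<Sigma>\<^sup>2 / 2) * u x"
        using mult_left_mono[OF ux, of "B2 + \<Sigma>\<^sup>2 / 2"] B2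
        unfolding phi_upper_eq[OF a(1)] u_def by simp
      from mult_left_mono[OF this, of dt] show ?thesis using dt by (simp add: m_def q_def algebra_simps)
    qed
    also have "\<dots> \<le> exp (m x) + q" using exp_ge_add_one_self[of "m x"] by simp
    finally have Lle: "L \<le> ln (exp (m x) + q)"
      unfolding L_def using a dt by (intro ln_mono) (auto intro: add_pos_nonneg)
    have S2: "(- p * l x * s)\<^sup>2 * dt / 2 \<le> p * L / 2"
    proof -
      have "(- p * l x * s)\<^sup>2 * dt = p\<^sup>2 * ((l x)\<^sup>2 * (s\<^sup>2 * dt))" by (simp add: power_mult_distrib)
      also have "\<dots> \<le> p\<^sup>2 * (1 * (\<Sigma>\<^sup>2 * u a * dt))"
        unfolding s2 using l01 ux dt by (intro mult_left_mono mult_mono mult_right_mono) (auto intro: power_le_one simp: u_def)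
      also have "\<dots> = p * (p * w)" by (simp add: w_def power2_eq_square)
      finally show ?thesis by (simp add: p)
    qed
    have eq: "x * exp (m x + s * D) + b0 * dt = x * (exp (m x + s * D) + q)"
      using x by (simp add: q_def algebra_simps)
    have "(exp (m x) + q) * exp (l x * (s * D)) \<le> exp (m x + s * D) + q"
      using exp_plus_const_ge[OF q, of "m x" "m x + s * D"] by (simp add: lx)
    then have "x * ((exp (m x) + q) * exp (l x * (s * D))) \<le> x * exp (m x + s * D) + b0 * dt"
      unfolding eq using x by (intro mult_left_mono) auto
    then have "(x * exp (m x + s * D) + b0 * dt) powr - p \<le> (x * ((exp (m x) + q) * exp (l x * (s * D)))) powr - p"
      using x pos p by (intro powr_mono2') auto
    also have "\<dots> = x powr - p * exp (- p * ln (exp (m x) + q) + (- p * l x * s) * D)"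
    proof -
      have "(x * (E * exp r)) powr - p = x powr - p * exp (- p * ln E + - p * r)" if "0 < E" for E r
        using x that by (simp add: powr_mult powr_def[of E] powr_def[of "exp r"] mult_exp_exp)
      from this[OF pos, of "l x * (s * D)"] show ?thesis by (simp only: mult_ac mult_minus_left mult_minus_right)
    qed
    also have "\<dots> \<le> x powr - p * exp (- (p * L / 2) + (- p * l x * s) * D - (- p * l x * s)\<^sup>2 * dt / 2)"
    proof -
      have "p * L \<le> p * ln (exp (m x) + q)" using Lle p by (intro mult_left_mono) auto
      then have "- p * ln (exp (m x) + q) + (- p * l x * s) * D \<le> - (p * L / 2) + (- p * l x * s) * D - (- p * l x * s)\<^sup>2 * dt / 2"
        using S2 by linarith
      then show ?thesis by (intro mult_left_mono) auto
    qed
    finally show "(x * exp (m x + \<Sigma> * x powr (\<alpha> - 1) * D) + b0 * dt) powr - p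
      \<le> x powr - p * exp (- (p * L / 2) + (- p * l x * \<Sigma> * x powr (\<alpha> - 1)) * D - (- p * l x * \<Sigma> * x powr (\<alpha> - 1))\<^sup>2 * dt / 2)"
      unfolding s_def by (simp only: mult.assoc)
  qed
qed

text \<open>
  If the new value is also above \<open>a\<close>, the additive term \<open>b0 dt\<close> costs at most the factor
  \<open>1 / (1 - r)\<close> with \<open>r = b0 dt / a\<close>. Because \<open>c = B2 + \<Sigma>\<^sup>2 / 2\<close> is at most \<open>\<Sigma>\<^sup>2 + B2\<close>, the inequality \<open>phi_lower a < 0\<close> implies
  \<open>b0 / a + B1 < c u(a) (1 - r)\<close>, hence \<open>(c u(a) - B1) dt > r / (1 - r) \<ge> - ln (1 - r)\<close>: the drift more
  than compensates the factor. The correction term of order \<open>dt\<close> in \<^const>\<open>phi_lower\<close> serves exactly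
  this purpose.
\<close>

lemma power_decay_above_lower_zero:
  fixes \<alpha> \<Sigma> b0 B1 B2 dt a :: real
  defines "u \<equiv> \<lambda>x. x powr (2 * (\<alpha> - 1))"
  defines "m \<equiv> \<lambda>x. (B1 - (B2 + \<Sigma>\<^sup>2 / 2) * u x) * dt"
  assumes alpha: "1 < \<alpha>" and Sigma: "0 < \<Sigma>" and b0: "0 \<le> b0" and B1: "0 \<le> B1" and B2: "0 < B2"
    and dt: "0 < dt" and a: "0 < a" "phi_lower \<alpha> \<Sigma> b0 B1 B2 dt a < 0"
  shows "\<exists>p>0. \<exists>\<kappa>>0. \<forall>x D. a \<le> x \<longrightarrow> a \<le> x * exp (m x + \<Sigma> * x powr (\<alpha> - 1) * D) + b0 * dt \<longrightarrow>
    (x * exp (m x + \<Sigma> * x powr (\<alpha> - 1) * D) + b0 * dt) powr p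
      \<le> x powr p * exp (- \<kappa> + (p * \<Sigma> * x powr (\<alpha> - 1)) * D - (p * \<Sigma> * x powr (\<alpha> - 1))\<^sup>2 * dt / 2)"
proof -
  define c where "c = B2 + \<Sigma>\<^sup>2 / 2"
  define r where "r = b0 * dt / a"
  have c: "0 < c" "c \<le> \<Sigma>\<^sup>2 + B2" using B2 by (auto simp: c_def intro: add_pos_nonneg)
  have r0: "0 \<le> r" using b0 dt a by (simp add: r_def)
  have ua: "0 < u a" using a by (simp add: u_def)
  have phi: "b0 / a + B1 < u a * (c - (\<Sigma>\<^sup>2 + B2) * r)"
    using a(2) unfolding phi_lower_eq[OF a(1)] u_def c_def r_def by simp
  also have "\<dots> \<le> u a * (c - c * r)" using ua mult_right_mono[OF c(2) r0] by (intro mult_left_mono) auto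
  finally have phi': "b0 / a + B1 < c * u a * (1 - r)" by (simp add: algebra_simps)
  have "0 \<le> b0 / a + B1" using b0 B1 a by simp
  then have "0 < (c * u a) * (1 - r)" using phi' by linarith
  moreover have "0 < c * u a" using c ua by simp
  ultimately have r1: "r < 1" by (simp add: zero_less_mult_iff)
  define \<gamma> where "\<gamma> = (c * u a - B1) * dt + ln (1 - r)"
  have \<gamma>: "0 < \<gamma>"
  proof -
    have "- ln (1 - r) = ln (1 / (1 - r))" using r1 by (simp add: ln_div)
    also have "\<dots> \<le> 1 / (1 - r) - 1" using r1 by (intro ln_le_minus_one) auto
    also have "\<dots> = r / (1 - r)" using r1 by (simp add: field_simps)
    finally have 1: "- ln (1 - r) \<le> r / (1 - r)" .
    have "B1 * (1 - r) \<le> B1" using B1 r0 by (simp add: algebra_simps)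
    then have "b0 / a < (c * u a - B1) * (1 - r)" using phi' by (simp add: algebra_simps)
    then have "b0 / a * dt < (c * u a - B1) * (1 - r) * dt" using dt by (rule mult_strict_right_mono)
    moreover have "b0 / a * dt = r" by (simp add: r_def)
    ultimately have "r < (c * u a - B1) * dt * (1 - r)" by (simp only: mult_ac)
    then have "r / (1 - r) < (c * u a - B1) * dt" using r1 by (simp add: pos_divide_less_eq)
    with 1 show ?thesis unfolding \<gamma>_def by linarith
  qed
  define w where "w = \<Sigma>\<^sup>2 * u a * dt"
  have w: "0 < w" using Sigma ua dt by (simp add: w_def)
  \<comment> \<open>Exponents up to one keep \<open>c - p \<Sigma>\<^sup>2 / 2\<close> non-negative, so that the bound is worst at \<open>x = a\<close>; there
    \<open>p w \<le> \<gamma>\<close> leaves half of the drift \<open>\<gamma>\<close>.\<close>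
  define p where "p = min 1 (\<gamma> / w)"
  have p: "0 < p" "p \<le> 1" using \<gamma> w by (auto simp: p_def)
  have pw: "p * w \<le> \<gamma>"
  proof -
    have "p \<le> \<gamma> / w" by (simp add: p_def)
    then show ?thesis using w by (simp add: pos_le_divide_eq)
  qed
  show ?thesis
  proof (rule exI[of _ p], rule conjI[OF p(1)], rule exI[of _ "p * \<gamma> / 2"], intro conjI allI impI)
    show "0 < p * \<gamma> / 2" using p \<gamma> by auto
    fix x D :: real
    define s where "s = \<Sigma> * x powr (\<alpha> - 1)"
    define y where "y = x * exp (m x + s * D) + b0 * dt"
    assume x: "a \<le> x" and "a \<le> x * exp (m x + \<Sigma> * x powr (\<alpha> - 1) * D) + b0 * dt"
    then have y: "a \<le> y" by (simp add: y_def s_def)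
    have x0: "0 < x" using x a by simp
    have s2: "s\<^sup>2 = \<Sigma>\<^sup>2 * u x"
      using x0 by (simp add: s_def u_def power_mult_distrib power2_eq_square powr_add[symmetric] algebra_simps)
    have ux: "u a \<le> u x" unfolding u_def using x a alpha by (intro powr_mono2) auto
    have "y * (1 - r) \<le> x * exp (m x + s * D)"
    proof -
      have "b0 * dt = r * a" using a by (simp add: r_def)
      also have "\<dots> \<le> r * y" using y r0 by (rule mult_left_mono)
      finally show ?thesis by (simp add: y_def algebra_simps)
    qed
    then have "y \<le> x * exp (m x + s * D) / (1 - r)" using r1 by (simp add: pos_le_divide_eq)
    then have "y powr p \<le> (x * exp (m x + s * D) / (1 - r)) powr p"
      using y a p by (intro powr_mono2) auto
    also have "\<dots> = x powr p * exp (p * (m x + s * D) - p * ln (1 - r))"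
      using x0 r1 by (simp add: powr_mult powr_divide powr_def[of "1 - r"] powr_def[of "exp (m x + s * D)"] exp_diff)
    also have "\<dots> \<le> x powr p * exp (- (p * \<gamma> / 2) + (p * s) * D - (p * s)\<^sup>2 * dt / 2)"
    proof -
      have "m x - ln (1 - r) + p * s\<^sup>2 * dt / 2 \<le> - (\<gamma> / 2)"
      proof -
        have "0 \<le> c - p * \<Sigma>\<^sup>2 / 2"
          using mult_right_mono[OF p(2), of "\<Sigma>\<^sup>2"] B2 by (simp add: c_def)
        then have "(c - p * \<Sigma>\<^sup>2 / 2) * dt * u a \<le> (c - p * \<Sigma>\<^sup>2 / 2) * dt * u x"
          using ux dt by (intro mult_left_mono) auto
        moreover have "m x - ln (1 - r) + p * s\<^sup>2 * dt / 2 = B1 * dt - ln (1 - r) - (c - p * \<Sigma>\<^sup>2 / 2) * dt * u x"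
          unfolding s2 m_def c_def[symmetric] by (simp add: algebra_simps)
        moreover have "B1 * dt - ln (1 - r) - (c - p * \<Sigma>\<^sup>2 / 2) * dt * u a = p * w / 2 - \<gamma>"
          unfolding w_def \<gamma>_def by (simp add: algebra_simps)
        ultimately show ?thesis using pw by linarith
      qed
      from mult_left_mono[OF this, of p]
      have "p * (m x - ln (1 - r) + p * s\<^sup>2 * dt / 2) \<le> p * - (\<gamma> / 2)" using p by simp
      then have "p * (m x + s * D) - p * ln (1 - r) \<le> - (p * \<gamma> / 2) + (p * s) * D - (p * s)\<^sup>2 * dt / 2"
        by (simp add: algebra_simps power_mult_distrib power2_eq_square)
      then show ?thesis by (intro mult_left_mono) auto
    qed
    finally show "(x * exp (m x + \<Sigma> * x powr (\<alpha> - 1) * D) + b0 * dt) powr p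
      \<le> x powr p * exp (- (p * \<gamma> / 2) + (p * \<Sigma> * x powr (\<alpha> - 1)) * D - (p * \<Sigma> * x powr (\<alpha> - 1))\<^sup>2 * dt / 2)"
      unfolding s_def y_def by (simp only: mult.assoc)
  qed
qed

section \<open>Euler products and the linear equation along a path\<close>

lemma ln_one_plus_second_order:
  fixes x :: real
  assumes "\<bar>x\<bar> \<le> 1/2"
  shows "\<bar>ln (1 + x) - x + x\<^sup>2 / 2\<bar> \<le> \<bar>x\<bar> ^ 3"
proof -
  let ?f = "\<lambda>x::real. ln (1 + x) - x + x\<^sup>2 / 2"
  let ?g = "\<lambda>x::real. x ^ 3 - ?f x"
  have df: "(?f has_real_derivative z\<^sup>2 / (1 + z)) (at z)" if "\<bar>z\<bar> \<le> 1/2" for z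
    using that by (auto intro!: derivative_eq_intros simp: field_simps power2_eq_square)
  have dg: "(?g has_real_derivative 3 * z\<^sup>2 - z\<^sup>2 / (1 + z)) (at z)" if "\<bar>z\<bar> \<le> 1/2" for z
    using DERIV_diff[OF DERIV_pow[of 3 z] df[OF that]] by simp
  have f': "0 \<le> z\<^sup>2 / (1 + z)" if "\<bar>z\<bar> \<le> 1/2" for z :: real
    using that by simp
  have g': "0 \<le> 3 * z\<^sup>2 - z\<^sup>2 / (1 + z)" if "\<bar>z\<bar> \<le> 1/2" for z :: real
  proof -
    have "z\<^sup>2 / (1 + z) \<le> z\<^sup>2 / (1 / 2)" using that by (intro divide_left_mono) auto
    then have "z\<^sup>2 / (1 + z) \<le> 2 * z\<^sup>2" by simp
    then show ?thesis using zero_le_power2[of z] by linarith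
  qed
  show ?thesis
  proof (cases "0 \<le> x")
    case True
    have *: "\<bar>z\<bar> \<le> 1/2" if "0 \<le> z" "z \<le> x" for z using that assms by auto
    have "?f 0 \<le> ?f x"
      by (rule DERIV_nonneg_imp_nondecreasing[OF True]) (use df f' * in blast)
    moreover have "?g 0 \<le> ?g x"
      by (rule DERIV_nonneg_imp_nondecreasing[OF True]) (use dg g' * in blast)
    ultimately show ?thesis using True by simp
  next
    case False
    then have le: "x \<le> 0" by simp
    have *: "\<bar>z\<bar> \<le> 1/2" if "x \<le> z" "z \<le> 0" for z using that assms by auto
    have "?f x \<le> ?f 0"
      by (rule DERIV_nonneg_imp_nondecreasing[OF le]) (use df f' * in blast)
    moreover have "?g x \<le> ?g 0"
      by (rule DERIV_nonneg_imp_nondecreasing[OF le]) (use dg g' * in blast)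
    ultimately show ?thesis using le by (simp add: power3_eq_cube)
  qed
qed

text \<open>
  Multiplied by this weight, a solution of \<open>u (j + 1) = u j * (1 + x j)\<close> becomes constant. The product
  stops before \<open>j\<close>, so that the weight is known at the left end of the \<open>j\<close>-th interval.
\<close>

definition euler_weight :: "(nat \<Rightarrow> real) \<Rightarrow> nat \<Rightarrow> real" where
  "euler_weight x j = inverse (\<Prod>i<j. 1 + x i)"

lemma euler_weight_bound:
  assumes x: "\<And>i. i < j \<Longrightarrow> \<bar>x i\<bar> \<le> 1/2" and K: "\<bar>\<Sum>i<j. x i\<bar> \<le> K" and b: "(\<Sum>i<j. (x i)\<^sup>2) \<le> b"
  shows "0 < euler_weight x j" "euler_weight x j \<le> exp (K + 2 * b)"
proof -
  have p: "0 < 1 + x i" if "i < j" for i using x[OF that] by auto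
  then show "0 < euler_weight x j" unfolding euler_weight_def by (auto intro!: prod_pos)
  have "euler_weight x j = exp (- (\<Sum>i<j. ln (1 + x i)))"
    unfolding euler_weight_def using p by (simp add: exp_minus exp_sum)
  moreover have "- (\<Sum>i<j. ln (1 + x i)) \<le> K + 2 * b"
  proof -
    have "x i - 2 * (x i)\<^sup>2 \<le> ln (1 + x i)" if "i < j" for i
      using abs_ln_one_plus_x_minus_x_bound[OF x[OF that]] by (simp add: abs_le_iff)
    then have "(\<Sum>i<j. x i - 2 * (x i)\<^sup>2) \<le> (\<Sum>i<j. ln (1 + x i))" by (intro sum_mono) auto
    then show ?thesis using K b by (simp add: sum_subtractf sum_distrib_left[symmetric])
  qed
  ultimately show "euler_weight x j \<le> exp (K + 2 * b)" by simp
qed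

text \<open>
  Expanding the logarithm to second order leaves a remainder of at most \<open>max \<bar>x\<bar> * \<Sum> x\<^sup>2\<close>.
\<close>

lemma euler_weight_limit:
  assumes a: "(\<lambda>N. \<Sum>j<n N. x N j) \<longlonglongrightarrow> a"
    and b: "(\<lambda>N. \<Sum>j<n N. (x N j)\<^sup>2) \<longlonglongrightarrow> b"
    and small: "\<And>\<epsilon>. 0 < \<epsilon> \<Longrightarrow> \<forall>\<^sub>F N in sequentially. \<forall>j<n N. \<bar>x N j\<bar> \<le> \<epsilon>"
  shows "(\<lambda>N. euler_weight (x N) (n N)) \<longlonglongrightarrow> exp (- (a - b / 2))"
proof -
  let ?R = "\<lambda>N. \<Sum>j<n N. ln (1 + x N j) - x N j + (x N j)\<^sup>2 / 2"
  have b1: "\<forall>\<^sub>F N in sequentially. (\<Sum>j<n N. (x N j)\<^sup>2) < b + 1"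
    using order_tendstoD(2)[OF b, of "b + 1"] by simp
  have R: "?R \<longlonglongrightarrow> 0"
  proof (rule tendstoI)
    fix e :: real assume e: "0 < e"
    define \<epsilon> where "\<epsilon> = min (1/2) (e / (\<bar>b\<bar> + 2))"
    have \<epsilon>: "0 < \<epsilon>" "\<epsilon> \<le> 1/2" "\<epsilon> \<le> e / (\<bar>b\<bar> + 2)"
      using e unfolding \<epsilon>_def by (intro min.cobounded1 min.cobounded2 | simp)+
    have \<epsilon>e: "\<epsilon> * (\<bar>b\<bar> + 2) \<le> e"
      using \<epsilon>(3) by (simp add: pos_le_divide_eq)
    show "\<forall>\<^sub>F N in sequentially. dist (?R N) 0 < e"
      using b1 small[OF \<epsilon>(1)]
    proof eventually_elim
      case (elim N)
      have "\<bar>?R N\<bar> \<le> (\<Sum>j<n N. \<bar>ln (1 + x N j) - x N j + (x N j)\<^sup>2 / 2\<bar>)" by (rule sum_abs)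
      also have "\<dots> \<le> (\<Sum>j<n N. \<epsilon> * (x N j)\<^sup>2)"
      proof (intro sum_mono)
        fix j assume "j \<in> {..<n N}"
        then have j: "\<bar>x N j\<bar> \<le> \<epsilon>" using elim by auto
        have "\<bar>ln (1 + x N j) - x N j + (x N j)\<^sup>2 / 2\<bar> \<le> \<bar>x N j\<bar> ^ 3"
          using j \<epsilon> by (intro ln_one_plus_second_order) auto
        also have "\<dots> \<le> \<epsilon> * (x N j)\<^sup>2"
          using mult_right_mono[OF j, of "(x N j)\<^sup>2"] by (simp add: power3_eq_cube power2_eq_square)
        finally show "\<bar>ln (1 + x N j) - x N j + (x N j)\<^sup>2 / 2\<bar> \<le> \<epsilon> * (x N j)\<^sup>2" .
      qed
      also have "\<dots> = \<epsilon> * (\<Sum>j<n N. (x N j)\<^sup>2)" by (simp add: sum_distrib_left)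
      also have "\<dots> < \<epsilon> * (\<bar>b\<bar> + 2)" using elim \<epsilon> by (intro mult_strict_left_mono) auto
      finally show ?case using \<epsilon>e by simp
    qed
  qed
  have lim: "(\<lambda>N. exp (- (?R N + (\<Sum>j<n N. x N j) - (\<Sum>j<n N. (x N j)\<^sup>2) / 2))) \<longlonglongrightarrow> exp (- (0 + a - b / 2))"
    by (intro tendsto_intros R a b) simp
  have "(\<lambda>N. euler_weight (x N) (n N)) \<longlonglongrightarrow> exp (- (0 + a - b / 2))"
  proof (rule Lim_transform_eventually[OF lim])
    show "\<forall>\<^sub>F N in sequentially. exp (- (?R N + (\<Sum>j<n N. x N j) - (\<Sum>j<n N. (x N j)\<^sup>2) / 2)) = euler_weight (x N) (n N)"
      using small[of "1/2", simplified]
    proof eventually_elim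
      case (elim N)
      have p: "0 < 1 + x N i" if "i < n N" for i using elim that by force
      have "?R N + (\<Sum>j<n N. x N j) - (\<Sum>j<n N. (x N j)\<^sup>2) / 2 = (\<Sum>j<n N. ln (1 + x N j))"
        by (simp add: sum.distrib sum_subtractf sum_divide_distrib)
      then show ?case
        unfolding euler_weight_def using p by (simp add: exp_minus exp_sum)
    qed
  qed
  then show ?thesis by simp
qed

text \<open>
  Variation of constants: \<open>u j\<close> times the weight changes per step by the residual \<open>S + E\<close> times the next
  weight. Replacing the next weight by the current one, so that \<open>S\<close> is weighted by a quantity known
  before the step, costs by the Cauchy-Schwarz inequality at most a multiple of
  \<open>sqrt (\<Sum> S\<^sup>2) * sqrt (\<Sum> x\<^sup>2)\<close>. The residual is split because \<open>S\<close> comes from a stochastic integral: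
  its weighted sum is small through cancellation, not term by term as for \<open>E\<close>.
\<close>

lemma euler_product_limit:
  fixes x u S E :: "nat \<Rightarrow> nat \<Rightarrow> real" and n :: "nat \<Rightarrow> nat"
  assumes u0: "\<And>N. u N 0 = y0" and u1: "\<And>N. u N (n N) = y1"
    and step: "\<And>N j. j < n N \<Longrightarrow> u N (Suc j) = u N j * (1 + x N j) + S N j + E N j"
    and a: "(\<lambda>N. \<Sum>j<n N. x N j) \<longlonglongrightarrow> a"
    and b: "(\<lambda>N. \<Sum>j<n N. (x N j)\<^sup>2) \<longlonglongrightarrow> b"
    and small: "\<And>\<epsilon>. 0 < \<epsilon> \<Longrightarrow> \<forall>\<^sub>F N in sequentially. \<forall>j<n N. \<bar>x N j\<bar> \<le> \<epsilon>"
    and K: "\<And>N j. j \<le> n N \<Longrightarrow> \<bar>\<Sum>i<j. x N i\<bar> \<le> K"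
    and S2: "(\<lambda>N. \<Sum>j<n N. (S N j)\<^sup>2) \<longlonglongrightarrow> 0"
    and ZS: "(\<lambda>N. \<Sum>j<n N. euler_weight (x N) j * S N j) \<longlonglongrightarrow> 0"
    and E: "(\<lambda>N. \<Sum>j<n N. \<bar>E N j\<bar>) \<longlonglongrightarrow> 0"
  shows "y1 = y0 * exp (a - b / 2)"
proof -
  define C where "C = exp (K + 2 * (b + 1))"
  define T where "T N = \<bar>\<Sum>j<n N. euler_weight (x N) j * S N j\<bar>
    + 2 * C * (sqrt (\<Sum>j<n N. (S N j)\<^sup>2) * sqrt (\<Sum>j<n N. (x N j)\<^sup>2) + (\<Sum>j<n N. \<bar>E N j\<bar>))" for N
  have C: "0 < C" by (simp add: C_def)
  have T: "T \<longlonglongrightarrow> 0"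
    unfolding T_def by (rule tendsto_eq_intros ZS S2 b E refl | simp)+
  have b1: "\<forall>\<^sub>F N in sequentially. (\<Sum>j<n N. (x N j)\<^sup>2) < b + 1"
    using order_tendstoD(2)[OF b, of "b + 1"] by simp
  have "\<forall>\<^sub>F N in sequentially. norm (y1 * euler_weight (x N) (n N) - y0) \<le> T N"
    using b1 small[of "1/2", simplified]
  proof eventually_elim
    case (elim N)
    let ?Z = "euler_weight (x N)"
    have xb: "\<bar>x N i\<bar> \<le> 1/2" if "i < n N" for i using elim that by auto
    have bb: "(\<Sum>i<j. (x N i)\<^sup>2) \<le> b + 1" if "j \<le> n N" for j
    proof -
      have "(\<Sum>i<j. (x N i)\<^sup>2) \<le> (\<Sum>i<n N. (x N i)\<^sup>2)" using that by (intro sum_mono2) auto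
      then show ?thesis using elim by simp
    qed
    have Z: "0 < ?Z j" "?Z j \<le> C" if "j \<le> n N" for j
      using euler_weight_bound[of j "x N" K "b + 1"] xb K[OF that] bb[OF that] that by (auto simp: C_def)
    have pos: "1 / 2 \<le> 1 + x N j" if "j < n N" for j using xb[OF that] by (auto simp: abs_le_iff)
    have Zs: "?Z (Suc j) = ?Z j / (1 + x N j)" for j
      by (simp add: euler_weight_def field_simps)
    have d: "u N (Suc j) * ?Z (Suc j) - u N j * ?Z j
        = ?Z j * S N j - ?Z j * S N j * (x N j / (1 + x N j)) + ?Z j * E N j / (1 + x N j)" if "j < n N" for j
    proof -
      define p where "p = 1 + x N j"
      have p: "p \<noteq> 0" "x N j = p - 1" using pos[OF that] by (auto simp: p_def)
      have "u N (Suc j) = u N j * p + S N j + E N j" using step[OF that] by (simp add: p_def)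
      then show ?thesis using p(1) unfolding Zs p_def[symmetric] p(2) by (simp add: field_simps)
    qed
    have "y1 * ?Z (n N) - y0 = (\<Sum>j<n N. u N (Suc j) * ?Z (Suc j) - u N j * ?Z j)"
      using u0 u1 by (subst sum_lessThan_telescope) (simp add: euler_weight_def)
    also have "\<dots> = (\<Sum>j<n N. ?Z j * S N j) - (\<Sum>j<n N. ?Z j * S N j * (x N j / (1 + x N j))) + (\<Sum>j<n N. ?Z j * E N j / (1 + x N j))"
      by (simp add: d sum.distrib sum_subtractf)
    finally have eq: "y1 * ?Z (n N) - y0 = \<dots>" .
    have q: "\<bar>1 / (1 + x N j)\<bar> \<le> 2" if "j < n N" for j
      using pos[OF that] by (simp add: field_simps)
    have "\<bar>\<Sum>j<n N. ?Z j * S N j * (x N j / (1 + x N j))\<bar> \<le> (\<Sum>j<n N. \<bar>?Z j * S N j * (x N j / (1 + x N j))\<bar>)"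
      by (rule sum_abs)
    also have "\<dots> \<le> (\<Sum>j<n N. 2 * C * (\<bar>S N j\<bar> * \<bar>x N j\<bar>))"
    proof (intro sum_mono)
      fix j assume "j \<in> {..<n N}"
      then have j: "j < n N" by simp
      have "\<bar>?Z j\<bar> * \<bar>1 / (1 + x N j)\<bar> \<le> C * 2" using Z[of j] q[OF j] j by (intro mult_mono) auto
      from mult_right_mono[OF this, of "\<bar>S N j\<bar> * \<bar>x N j\<bar>"]
      show "\<bar>?Z j * S N j * (x N j / (1 + x N j))\<bar> \<le> 2 * C * (\<bar>S N j\<bar> * \<bar>x N j\<bar>)"
        by (simp add: abs_mult mult_ac)
    qed
    also have "\<dots> = 2 * C * (\<Sum>j<n N. \<bar>S N j\<bar> * \<bar>x N j\<bar>)" by (simp add: sum_distrib_left)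
    also have "\<dots> \<le> 2 * C * (sqrt (\<Sum>j<n N. (S N j)\<^sup>2) * sqrt (\<Sum>j<n N. (x N j)\<^sup>2))"
      using C L2_set_mult_ineq[of "S N" "x N" "{..<n N}"] by (simp add: L2_set_def)
    finally have 1: "\<bar>\<Sum>j<n N. ?Z j * S N j * (x N j / (1 + x N j))\<bar>
        \<le> 2 * C * (sqrt (\<Sum>j<n N. (S N j)\<^sup>2) * sqrt (\<Sum>j<n N. (x N j)\<^sup>2))" .
    have "\<bar>\<Sum>j<n N. ?Z j * E N j / (1 + x N j)\<bar> \<le> (\<Sum>j<n N. \<bar>?Z j * E N j / (1 + x N j)\<bar>)"
      by (rule sum_abs)
    also have "\<dots> \<le> (\<Sum>j<n N. 2 * C * \<bar>E N j\<bar>)"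
    proof (intro sum_mono)
      fix j assume "j \<in> {..<n N}"
      then have j: "j < n N" by simp
      have "\<bar>?Z j\<bar> * \<bar>1 / (1 + x N j)\<bar> \<le> C * 2" using Z[of j] q[OF j] j by (intro mult_mono) auto
      from mult_right_mono[OF this, of "\<bar>E N j\<bar>"]
      show "\<bar>?Z j * E N j / (1 + x N j)\<bar> \<le> 2 * C * \<bar>E N j\<bar>"
        by (simp add: abs_mult mult_ac)
    qed
    also have "\<dots> = 2 * C * (\<Sum>j<n N. \<bar>E N j\<bar>)" by (simp add: sum_distrib_left)
    finally have 2: "\<bar>\<Sum>j<n N. ?Z j * E N j / (1 + x N j)\<bar> \<le> 2 * C * (\<Sum>j<n N. \<bar>E N j\<bar>)" .
    show ?case
      using 1 2 unfolding eq T_def real_norm_def distrib_left by linarith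
  qed
  from Lim_null_comparison[OF this T]
  have "(\<lambda>N. y1 * euler_weight (x N) (n N) - y0) \<longlonglongrightarrow> 0" .
  moreover have "(\<lambda>N. y1 * euler_weight (x N) (n N) - y0) \<longlonglongrightarrow> y1 * exp (- (a - b / 2)) - y0"
    by (intro tendsto_intros euler_weight_limit[OF a b small])
  ultimately have "y1 * exp (- (a - b / 2)) - y0 = 0" using LIMSEQ_unique by blast
  then show ?thesis by (simp add: exp_minus field_simps)
qed

abbreviation grid :: "real \<Rightarrow> real \<Rightarrow> nat \<Rightarrow> nat \<Rightarrow> real" where
  "grid t0 t1 n j \<equiv> t0 + real j * (t1 - t0) / real n"

lemma grid_bounds:
  assumes "t0 < t1" "0 < n" "j \<le> n"
  shows "t0 \<le> grid t0 t1 n j" "grid t0 t1 n j \<le> t1"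
proof -
  have "real j * (t1 - t0) \<le> real n * (t1 - t0)" using assms by (intro mult_right_mono) auto
  then show "grid t0 t1 n j \<le> t1" using assms by (simp add: field_simps)
qed (use assms in auto)

lemma grid_step: "grid t0 t1 n (Suc j) - grid t0 t1 n j = (t1 - t0) / real n"
  by (simp add: distrib_right add_divide_distrib)

lemma grid_step_mono:
  assumes "t0 \<le> t1"
  shows "grid t0 t1 n j \<le> grid t0 t1 n (Suc j)"
proof -
  have "0 \<le> (t1 - t0) / real n" using assms by simp
  then show ?thesis using grid_step[where ?t0.0=t0 and ?t1.0=t1 and n=n and j=j] by linarith
qed

lemma grid_oscillation:
  fixes y :: "real \<Rightarrow> real" and n :: "nat \<Rightarrow> nat"
  assumes t: "t0 < t1" and n: "\<And>N. 0 < n N" and lim: "filterlim n at_top sequentially"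
    and y: "continuous_on {t0..t1} y" and e: "0 < e"
  shows "\<forall>\<^sub>F N in sequentially. \<forall>j<n N. \<forall>x. grid t0 t1 (n N) j \<le> x \<and> x \<le> grid t0 t1 (n N) (Suc j) \<longrightarrow>
     \<bar>y x - y (grid t0 t1 (n N) j)\<bar> \<le> e"
proof -
  have "uniformly_continuous_on {t0..t1} y"
    using y by (intro compact_uniformly_continuous) auto
  then obtain d where d: "0 < d" "\<And>x x'. x \<in> {t0..t1} \<Longrightarrow> x' \<in> {t0..t1} \<Longrightarrow> dist x' x < d \<Longrightarrow> dist (y x') (y x) < e"
    using e unfolding uniformly_continuous_on_def by metis
  have "(\<lambda>N. (t1 - t0) / real (n N)) \<longlonglongrightarrow> 0"
    by (intro real_tendsto_divide_at_top[OF tendsto_const] filterlim_compose[OF filterlim_real_sequentially lim])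
  then have "\<forall>\<^sub>F N in sequentially. (t1 - t0) / real (n N) < d"
    using d(1) by (rule order_tendstoD)
  then show ?thesis
  proof eventually_elim
    case (elim N)
    show ?case
    proof (intro allI impI)
      fix j x assume j: "j < n N" and x: "grid t0 t1 (n N) j \<le> x \<and> x \<le> grid t0 t1 (n N) (Suc j)"
      have "x \<in> {t0..t1}" "grid t0 t1 (n N) j \<in> {t0..t1}"
        using grid_bounds[OF t n[of N], of j] grid_bounds[OF t n[of N], of "Suc j"] j x by auto
      moreover have "dist x (grid t0 t1 (n N) j) < d"
        using x elim grid_step[where ?t0.0=t0 and ?t1.0=t1 and n="n N" and j=j] by (simp add: dist_real_def)
      ultimately show "\<bar>y x - y (grid t0 t1 (n N) j)\<bar> \<le> e"
        using d(2) by (fastforce simp: dist_real_def)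
    qed
  qed
qed

text \<open>
  Since \<open>w\<close> has quadratic variation \<open>t1 - t0\<close>, only the term \<open>\<nu>\<^sup>2 (\<Delta>w)\<^sup>2\<close> of the squared increments
  survives in the limit.
\<close>

lemma linear_increments:
  fixes w :: "real \<Rightarrow> real" and n :: "nat \<Rightarrow> nat" and \<mu> \<nu> t0 t1 :: real
  defines "x \<equiv> \<lambda>N j. \<mu> * ((t1 - t0) / real (n N)) + \<nu> * (w (grid t0 t1 (n N) (Suc j)) - w (grid t0 t1 (n N) j))"
  assumes t: "t0 < t1" and n: "\<And>N. 0 < n N" and lim: "filterlim n at_top sequentially"
    and w: "continuous_on {t0..t1} w"
    and QV: "(\<lambda>N. \<Sum>j<n N. (w (grid t0 t1 (n N) (Suc j)) - w (grid t0 t1 (n N) j))\<^sup>2) \<longlonglongrightarrow> t1 - t0"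
  shows "(\<lambda>N. \<Sum>j<n N. x N j) \<longlonglongrightarrow> \<mu> * (t1 - t0) + \<nu> * (w t1 - w t0)"
    and "(\<lambda>N. \<Sum>j<n N. (x N j)\<^sup>2) \<longlonglongrightarrow> \<nu>\<^sup>2 * (t1 - t0)"
    and "\<And>\<epsilon>. 0 < \<epsilon> \<Longrightarrow> \<forall>\<^sub>F N in sequentially. \<forall>j<n N. \<bar>x N j\<bar> \<le> \<epsilon>"
    and "\<exists>K. \<forall>N. \<forall>j\<le>n N. \<bar>\<Sum>i<j. x N i\<bar> \<le> K"
proof -
  let ?h = "t1 - t0"
  have sum: "(\<Sum>i<j. x N i) = \<mu> * (real j * ?h / real (n N)) + \<nu> * (w (grid t0 t1 (n N) j) - w t0)" for N j
  proof -
    have "(\<Sum>i<j. w (grid t0 t1 (n N) (Suc i)) - w (grid t0 t1 (n N) i)) = w (grid t0 t1 (n N) j) - w t0"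
      using sum_lessThan_telescope[of "\<lambda>i. w (grid t0 t1 (n N) i)" j] by simp
    then show ?thesis unfolding x_def sum.distrib sum_distrib_left[symmetric] by simp
  qed
  have "(\<Sum>j<n N. x N j) = \<mu> * ?h + \<nu> * (w t1 - w t0)" for N
    using n[of N] by (simp add: sum)
  then show "(\<lambda>N. \<Sum>j<n N. x N j) \<longlonglongrightarrow> \<mu> * ?h + \<nu> * (w t1 - w t0)" by simp
  have hn: "(\<lambda>N. ?h / real (n N)) \<longlonglongrightarrow> 0"
    by (intro real_tendsto_divide_at_top[OF tendsto_const] filterlim_compose[OF filterlim_real_sequentially lim])
  have sq: "(\<Sum>j<n N. (x N j)\<^sup>2) = \<mu>\<^sup>2 * ?h * (?h / real (n N)) + 2 * \<mu> * \<nu> * (w t1 - w t0) * (?h / real (n N))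
      + \<nu>\<^sup>2 * (\<Sum>j<n N. (w (grid t0 t1 (n N) (Suc j)) - w (grid t0 t1 (n N) j))\<^sup>2)" for N
  proof -
    let ?dw = "\<lambda>j. w (grid t0 t1 (n N) (Suc j)) - w (grid t0 t1 (n N) j)"
    let ?k = "?h / real (n N)"
    have tel: "(\<Sum>j<n N. ?dw j) = w t1 - w t0"
      using sum_lessThan_telescope[of "\<lambda>i. w (grid t0 t1 (n N) i)" "n N"] n[of N] by simp
    have "(x N j)\<^sup>2 = \<mu>\<^sup>2 * ?k\<^sup>2 + 2 * \<mu> * \<nu> * ?k * ?dw j + \<nu>\<^sup>2 * (?dw j)\<^sup>2" for j
      unfolding x_def power2_sum by (simp only: power_mult_distrib mult_ac)
    then have "(\<Sum>j<n N. (x N j)\<^sup>2) = (\<Sum>j<n N. \<mu>\<^sup>2 * ?k\<^sup>2) + (\<Sum>j<n N. 2 * \<mu> * \<nu> * ?k * ?dw j) + (\<Sum>j<n N. \<nu>\<^sup>2 * (?dw j)\<^sup>2)"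
      by (simp only: sum.distrib)
    also have "(\<Sum>j<n N. 2 * \<mu> * \<nu> * ?k * ?dw j) = 2 * \<mu> * \<nu> * (w t1 - w t0) * ?k"
      unfolding sum_distrib_left[symmetric] tel by (simp only: mult_ac)
    also have "(\<Sum>j<n N. \<mu>\<^sup>2 * ?k\<^sup>2) = \<mu>\<^sup>2 * ?h * ?k"
      using n[of N] by (simp add: power2_eq_square)
    also have "(\<Sum>j<n N. \<nu>\<^sup>2 * (?dw j)\<^sup>2) = \<nu>\<^sup>2 * (\<Sum>j<n N. (?dw j)\<^sup>2)"
      by (simp only: sum_distrib_left)
    finally show ?thesis .
  qed
  have "(\<lambda>N. \<Sum>j<n N. (x N j)\<^sup>2) \<longlonglongrightarrow> \<mu>\<^sup>2 * ?h * 0 + 2 * \<mu> * \<nu> * (w t1 - w t0) * 0 + \<nu>\<^sup>2 * ?h"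
    unfolding sq by (intro tendsto_intros hn QV)
  then show "(\<lambda>N. \<Sum>j<n N. (x N j)\<^sup>2) \<longlonglongrightarrow> \<nu>\<^sup>2 * ?h" by simp
  show "\<forall>\<^sub>F N in sequentially. \<forall>j<n N. \<bar>x N j\<bar> \<le> \<epsilon>" if \<epsilon>: "0 < \<epsilon>" for \<epsilon>
  proof -
    define e where "e = \<epsilon> / 2 / (\<bar>\<nu>\<bar> + 1)"
    have e: "0 < e" using \<epsilon> by (simp add: e_def)
    have "(\<lambda>N. \<bar>\<mu>\<bar> * (?h / real (n N))) \<longlonglongrightarrow> \<bar>\<mu>\<bar> * 0" by (intro tendsto_intros hn)
    then have "\<forall>\<^sub>F N in sequentially. \<bar>\<mu>\<bar> * (?h / real (n N)) < \<epsilon> / 2"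
      using \<epsilon> by (intro order_tendstoD) auto
    with grid_oscillation[OF t n lim w e] show ?thesis
    proof eventually_elim
      case (elim N)
      show ?case
      proof (intro allI impI)
        fix j assume j: "j < n N"
        have "grid t0 t1 (n N) j \<le> grid t0 t1 (n N) (Suc j)"
          by (rule grid_step_mono) (use t in simp)
        then have "\<bar>w (grid t0 t1 (n N) (Suc j)) - w (grid t0 t1 (n N) j)\<bar> \<le> e"
          using elim(1) j by blast
        then have "\<bar>\<nu>\<bar> * \<bar>w (grid t0 t1 (n N) (Suc j)) - w (grid t0 t1 (n N) j)\<bar> \<le> \<bar>\<nu>\<bar> * e"
          by (intro mult_left_mono) auto
        also have "\<dots> \<le> (\<bar>\<nu>\<bar> + 1) * e" using e by (intro mult_right_mono) auto
        also have "\<dots> = \<epsilon> / 2"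
        proof -
          have "\<bar>\<nu>\<bar> + 1 \<noteq> 0" by linarith
          then show ?thesis unfolding e_def by (metis nonzero_mult_div_cancel_left times_divide_eq_right)
        qed
        finally have 1: "\<bar>\<nu> * (w (grid t0 t1 (n N) (Suc j)) - w (grid t0 t1 (n N) j))\<bar> \<le> \<epsilon> / 2"
          by (simp only: abs_mult)
        have "\<bar>\<mu> * (?h / real (n N))\<bar> \<le> \<epsilon> / 2"
          using elim(2) t by (simp add: abs_mult)
        with 1 show "\<bar>x N j\<bar> \<le> \<epsilon>" unfolding x_def by linarith
      qed
    qed
  qed
  have "compact (w ` {t0..t1})" using w by (intro compact_continuous_image) auto
  then have "bounded (w ` {t0..t1})" by (rule compact_imp_bounded)
  then obtain B where "\<forall>v\<in>w ` {t0..t1}. norm v \<le> B"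
    unfolding bounded_iff ..
  then have B: "\<bar>w u\<bar> \<le> B" if "u \<in> {t0..t1}" for u
    using that by simp
  show "\<exists>K. \<forall>N. \<forall>j\<le>n N. \<bar>\<Sum>i<j. x N i\<bar> \<le> K"
  proof (intro exI allI impI)
    fix N j assume j: "j \<le> n N"
    note gb = grid_bounds[OF t n j]
    have "\<bar>\<mu> * (real j * ?h / real (n N))\<bar> \<le> \<bar>\<mu>\<bar> * ?h"
    proof -
      have "0 \<le> real j * ?h / real (n N)" using t by simp
      then show ?thesis unfolding abs_mult using gb by (intro mult_left_mono) auto
    qed
    moreover have "\<bar>\<nu> * (w (grid t0 t1 (n N) j) - w t0)\<bar> \<le> \<bar>\<nu>\<bar> * (2 * B)"
      unfolding abs_mult using B[of "grid t0 t1 (n N) j"] B[of t0] gb t by (intro mult_left_mono) auto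
    ultimately show "\<bar>\<Sum>i<j. x N i\<bar> \<le> \<bar>\<mu>\<bar> * ?h + \<bar>\<nu>\<bar> * (2 * B)"
      unfolding sum by linarith
  qed
qed

text \<open>
  The deterministic part of solving \<open>dy = y (\<mu> dt + \<nu> dw)\<close>. The integral \<open>I\<close> enters only through
  approximations \<open>J N\<close> at the points of the \<open>N\<close>-th grid; the error \<open>e N / n N\<close> per point is small enough
  to be summed over the grid.
\<close>

lemma linear_equation_path:
  fixes y w I :: "real \<Rightarrow> real" and J :: "nat \<Rightarrow> real \<Rightarrow> real" and n :: "nat \<Rightarrow> nat" and \<mu> \<nu> t0 t1 :: real
  defines "g \<equiv> \<lambda>N j. grid t0 t1 (n N) j"
  defines "x \<equiv> \<lambda>N j. \<mu> * ((t1 - t0) / real (n N)) + \<nu> * (w (g N (Suc j)) - w (g N j))"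
  defines "S \<equiv> \<lambda>N j. J N (g N (Suc j)) - J N (g N j) - \<nu> * y (g N j) * (w (g N (Suc j)) - w (g N j))"
  assumes t: "t0 < t1" and n: "\<And>N. 0 < n N" and lim: "filterlim n at_top sequentially"
    and y: "continuous_on {t0..t1} y" and w: "continuous_on {t0..t1} w"
    and eq: "\<And>a b. t0 \<le> a \<Longrightarrow> a \<le> b \<Longrightarrow> b \<le> t1 \<Longrightarrow> y b - y a = \<mu> * integral {a..b} y + (I b - I a)"
    and QV: "(\<lambda>N. \<Sum>j<n N. (w (g N (Suc j)) - w (g N j))\<^sup>2) \<longlonglongrightarrow> t1 - t0"
    and J: "\<forall>\<^sub>F N in sequentially. \<forall>j\<le>n N. \<bar>J N (g N j) - I (g N j)\<bar> \<le> e N / real (n N)" and e: "e \<longlonglongrightarrow> 0"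
    and S2: "(\<lambda>N. \<Sum>j<n N. (S N j)\<^sup>2) \<longlonglongrightarrow> 0"
    and ZS: "(\<lambda>N. \<Sum>j<n N. euler_weight (x N) j * S N j) \<longlonglongrightarrow> 0"
  shows "y t1 = y t0 * exp ((\<mu> - \<nu>\<^sup>2 / 2) * (t1 - t0) + \<nu> * (w t1 - w t0))"
proof -
  let ?h = "t1 - t0"
  note li = linear_increments[OF t n lim w QV[unfolded g_def]]
  have a: "(\<lambda>N. \<Sum>j<n N. x N j) \<longlonglongrightarrow> \<mu> * ?h + \<nu> * (w t1 - w t0)"
    unfolding x_def g_def by (rule li(1))
  have b: "(\<lambda>N. \<Sum>j<n N. (x N j)\<^sup>2) \<longlonglongrightarrow> \<nu>\<^sup>2 * ?h"
    unfolding x_def g_def by (rule li(2))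
  have small: "\<forall>\<^sub>F N in sequentially. \<forall>j<n N. \<bar>x N j\<bar> \<le> \<epsilon>" if "0 < \<epsilon>" for \<epsilon>
    unfolding x_def g_def by (rule li(3)[OF that])
  have "\<exists>K. \<forall>N. \<forall>j\<le>n N. \<bar>\<Sum>i<j. x N i\<bar> \<le> K"
    unfolding x_def g_def by (rule li(4))
  then obtain K where K: "\<And>N j. j \<le> n N \<Longrightarrow> \<bar>\<Sum>i<j. x N i\<bar> \<le> K" by blast
  define E where "E N j = \<mu> * (integral {g N j..g N (Suc j)} y - ?h / real (n N) * y (g N j))
      + ((I (g N (Suc j)) - I (g N j)) - (J N (g N (Suc j)) - J N (g N j)))" for N j
  have gb: "t0 \<le> g N j" "g N j \<le> t1" if "j \<le> n N" for N j
    using grid_bounds[OF t n that] by (simp_all add: g_def)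
  have gs: "g N (Suc j) - g N j = ?h / real (n N)" for N j
    unfolding g_def by (rule grid_step)
  have gm: "g N j \<le> g N (Suc j)" for N j
    unfolding g_def by (rule grid_step_mono) (use t in simp)
  have E: "(\<lambda>N. \<Sum>j<n N. \<bar>E N j\<bar>) \<longlonglongrightarrow> 0"
  proof (rule tendstoI)
    fix \<epsilon> :: real assume \<epsilon>: "0 < \<epsilon>"
    define o' where "o' = \<epsilon> / (2 * (\<bar>\<mu>\<bar> * ?h + 1))"
    have pos: "0 < \<bar>\<mu>\<bar> * ?h + 1" using t by (intro add_nonneg_pos) auto
    have o': "0 < o'" using \<epsilon> pos by (simp add: o'_def)
    have "\<bar>\<mu>\<bar> * ?h * o' \<le> (\<bar>\<mu>\<bar> * ?h + 1) * o'" using o' by (intro mult_right_mono) auto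
    also have "\<dots> = \<epsilon> / 2"
      using nonzero_mult_div_cancel_left[of "\<bar>\<mu>\<bar> * ?h + 1" "\<epsilon> / 2"] pos by (simp add: o'_def)
    finally have o2: "\<bar>\<mu>\<bar> * ?h * o' \<le> \<epsilon> / 2" .
    have osc: "\<forall>\<^sub>F N in sequentially. \<forall>j<n N. \<forall>u. g N j \<le> u \<and> u \<le> g N (Suc j) \<longrightarrow> \<bar>y u - y (g N j)\<bar> \<le> o'"
      unfolding g_def by (rule grid_oscillation[OF t n lim y o'])
    have "\<forall>\<^sub>F N in sequentially. e N < \<epsilon> / 4" using e \<epsilon> by (intro order_tendstoD) auto
    with osc J
    show "\<forall>\<^sub>F N in sequentially. dist (\<Sum>j<n N. \<bar>E N j\<bar>) 0 < \<epsilon>"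
    proof eventually_elim
      case (elim N)
      have "\<bar>E N j\<bar> \<le> \<bar>\<mu>\<bar> * (o' * (?h / real (n N))) + 2 * (e N / real (n N))" if j: "j < n N" for j
      proof -
        have sub: "{g N j..g N (Suc j)} \<subseteq> {t0..t1}" using gb[of j N] gb[of "Suc j" N] j by auto
        have yc: "continuous_on {g N j..g N (Suc j)} y" using continuous_on_subset[OF y sub] .
        have "integral {g N j..g N (Suc j)} (\<lambda>u. y u - y (g N j)) = integral {g N j..g N (Suc j)} y - ?h / real (n N) * y (g N j)"
          using yc gm[of N j] gs[of N j]
          by (subst Henstock_Kurzweil_Integration.integral_diff) (auto intro: integrable_continuous_real)
        moreover have "norm (integral {g N j..g N (Suc j)} (\<lambda>u. y u - y (g N j))) \<le> o' * (g N (Suc j) - g N j)"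
          using elim(1) j by (intro integral_bound gm continuous_intros yc) auto
        ultimately have "\<bar>integral {g N j..g N (Suc j)} y - ?h / real (n N) * y (g N j)\<bar> \<le> o' * (?h / real (n N))"
          unfolding gs by simp
        then have 1: "\<bar>\<mu> * (integral {g N j..g N (Suc j)} y - ?h / real (n N) * y (g N j))\<bar> \<le> \<bar>\<mu>\<bar> * (o' * (?h / real (n N)))"
          unfolding abs_mult by (intro mult_left_mono) auto
        have 2: "\<bar>J N (g N j) - I (g N j)\<bar> \<le> e N / real (n N)" "\<bar>J N (g N (Suc j)) - I (g N (Suc j))\<bar> \<le> e N / real (n N)"
          using elim(2) j by auto
        have "\<bar>A + ((i2 - i1) - (a2 - a1))\<bar> \<le> c + 2 * q"
          if "\<bar>A\<bar> \<le> c" "\<bar>a1 - i1\<bar> \<le> q" "\<bar>a2 - i2\<bar> \<le> q" for A c a1 a2 i1 i2 q :: real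
          using that by linarith
        from this[OF 1 2] show ?thesis unfolding E_def .
      qed
      then have "(\<Sum>j<n N. \<bar>E N j\<bar>) \<le> (\<Sum>j<n N. \<bar>\<mu>\<bar> * (o' * (?h / real (n N))) + 2 * (e N / real (n N)))"
        by (intro sum_mono) auto
      also have "\<dots> = \<bar>\<mu>\<bar> * ?h * o' + 2 * e N" using n[of N] by (simp add: field_simps)
      also have "\<dots> < \<epsilon>" using o2 elim(3) by linarith
      finally show ?case by (simp add: sum_nonneg)
    qed
  qed
  have step: "y (g N (Suc j)) = y (g N j) * (1 + x N j) + S N j + E N j" if j: "j < n N" for N j
  proof -
    have "y (g N (Suc j)) - y (g N j) = \<mu> * integral {g N j..g N (Suc j)} y + (I (g N (Suc j)) - I (g N j))"
      using gb[of j N] gb[of "Suc j" N] j gm by (intro eq) auto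
    then show ?thesis unfolding x_def S_def E_def by (simp add: algebra_simps)
  qed
  have "y t1 = y t0 * exp ((\<mu> * ?h + \<nu> * (w t1 - w t0)) - \<nu>\<^sup>2 * ?h / 2)"
    by (rule euler_product_limit[where n=n and x=x and u="\<lambda>N j. y (g N j)" and S=S and E=E and K=K])
      (use a b small K step S2 ZS E n in \<open>auto simp: g_def\<close>)
  then show ?thesis by (simp add: algebra_simps)
qed

section \<open>Refining a partition by the times of a simple process\<close>

lemma finite_set_as_partition:
  fixes R :: "real set"
  assumes "finite R" "t0 \<in> R" "t1 \<in> R" "R \<subseteq> {t0..t1}"
  obtains m :: nat and r where "r 0 = t0" "r m = t1" "r ` {..m} = R" "\<And>i l. i < l \<Longrightarrow> l \<le> m \<Longrightarrow> r i < r l"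
proof -
  let ?L = "sorted_list_of_set R"
  define m where "m = card R - 1"
  have card: "0 < card R" using assms card_gt_0_iff by blast
  then have len: "length ?L = Suc m" by (simp add: m_def)
  have set: "set ?L = R" using assms(1) by simp
  have sm: "?L ! i < ?L ! l" if "i < l" "l \<le> m" for i l
    using sorted_wrt_nth_less[of "(<)" ?L, OF strict_sorted_list_of_set that(1)] that(2) len by simp
  have img: "(!) ?L ` {..m} = R"
    using set len nth_image[of "Suc m" ?L] by (simp add: lessThan_Suc_atMost[symmetric] atLeast0LessThan)
  have mono: "?L ! i \<le> ?L ! l" if "i \<le> l" "l \<le> m" for i l
    using sm[of i l] that by (cases "i = l") auto
  obtain i0 i1 where i: "i0 \<le> m" "?L ! i0 = t0" "i1 \<le> m" "?L ! i1 = t1"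
    using img assms(2,3) by (metis (no_types, lifting) atMost_iff imageE)
  have "?L ! 0 \<in> R" "?L ! m \<in> R" using img by auto
  then have "?L ! 0 = t0" "?L ! m = t1"
    using mono[of 0 i0] mono[of i1 m] i assms(4) by (auto intro!: antisym)
  then show thesis using that[of "(!) ?L" m] img sm by blast
qed

lemma partition_telescope:
  fixes f :: "real \<Rightarrow> real" and r :: "nat \<Rightarrow> real"
  assumes r: "\<And>i l. i < l \<Longrightarrow> l \<le> m \<Longrightarrow> r i < r l"
    and ab: "a \<in> r ` {..m}" "b \<in> r ` {..m}" "a \<le> b"
  shows "(\<Sum>l\<in>{l. l < m \<and> a \<le> r l \<and> r l < b}. f (r (Suc l)) - f (r l)) = f b - f a"
proof -
  obtain i j where ij: "i \<le> m" "a = r i" "j \<le> m" "b = r j" using ab by auto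
  have le: "r k \<le> r l \<longleftrightarrow> k \<le> l" if "k \<le> m" "l \<le> m" for k l
    using r[of k l] r[of l k] that by (cases k l rule: linorder_cases) auto
  have "i \<le> j" using le[of i j] ij ab by simp
  moreover have "{l. l < m \<and> a \<le> r l \<and> r l < b} = {i..<j}"
    using ij le[of i] le[of j] by (auto simp: not_le[symmetric])
  ultimately show ?thesis using ij sum_Suc_diff'[of i j "\<lambda>l. f (r l)"] by simp
qed

text \<open>
  The right-continuous version of \<^const>\<open>simple_process\<close>. On a cell of a partition that contains the
  times \<open>p i\<close> both agree, and this one is evaluated at the left end of the cell and is therefore
  measurable with respect to the past of the cell.
\<close>

definition step_value :: "nat \<Rightarrow> (nat \<Rightarrow> real) \<Rightarrow> (nat \<Rightarrow> 'a \<Rightarrow> real) \<Rightarrow> real \<Rightarrow> 'a \<Rightarrow> real" where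
  "step_value k p c x \<omega> = (\<Sum>i<k. c i \<omega> * of_bool (p i \<le> x \<and> x < p (Suc i)))"

lemma step_value_eq:
  assumes p: "\<And>i j. i \<le> j \<Longrightarrow> j \<le> k \<Longrightarrow> p i \<le> p j" and j: "j < k" "p j \<le> x" "x < p (Suc j)"
  shows "step_value k p c x \<omega> = c j \<omega>"
proof -
  have "p i \<le> x \<and> x < p (Suc i) \<longleftrightarrow> i = j" if "i < k" for i
    using p[of "Suc i" j] p[of "Suc j" i] j that by (cases i j rule: linorder_cases) auto
  then have "step_value k p c x \<omega> = (\<Sum>i<k. if i = j then c i \<omega> else 0)"
    unfolding step_value_def by (intro sum.cong) auto
  then show ?thesis using j by simp
qed

text \<open>
  All times \<open>p i\<close>, moved into \<open>[t0, t1]\<close>, are partition points, so each increment of \<open>W\<close> in the simple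
  integral telescopes over the cells.
\<close>

lemma simple_integral_increment:
  assumes r: "\<And>i l. i < l \<Longrightarrow> l \<le> m \<Longrightarrow> r i < r l" and r0: "r 0 = t0" and rm: "r m = t1"
    and p: "\<And>i. i < k \<Longrightarrow> p i \<le> p (Suc i)"
    and clamp: "\<And>i. i \<le> k \<Longrightarrow> max t0 (min (p i) t1) \<in> r ` {..m}"
    and a: "a \<in> r ` {..m}" and b: "b \<in> r ` {..m}" and ab: "a \<le> b"
  shows "simple_integral W k p c b \<omega> - simple_integral W k p c a \<omega>
    = (\<Sum>l\<in>{l. l < m \<and> a \<le> r l \<and> r l < b}. step_value k p c (r l) \<omega> * (W (r (Suc l)) \<omega> - W (r l) \<omega>))"
proof -
  define q where "q x = max a (min x b)" for x
  have rl: "t0 \<le> r l" "r l \<le> t1" if "l \<le> m" for l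
    using r[of 0 l] r[of l m] r0 rm that by (cases "l = 0"; cases "l = m"; force)+
  have abt: "t0 \<le> a" "b \<le> t1" using a b rl by auto
  have qR: "q (p i) \<in> r ` {..m}" if "i \<le> k" for i
  proof (cases "a \<le> p i \<and> p i \<le> b")
    case True
    then have "q (p i) = max t0 (min (p i) t1)" using abt ab by (auto simp: q_def)
    then show ?thesis using clamp[OF that] by simp
  next
    case False
    then have "q (p i) = a \<or> q (p i) = b" using ab by (auto simp: q_def)
    then show ?thesis using a b by auto
  qed
  have qW: "W (min x b) \<omega> - W (min x a) \<omega> = W (q x) \<omega> - W a \<omega>" for x
    using ab by (auto simp: q_def min_def max_def)
  let ?B = "{l. l < m \<and> a \<le> r l \<and> r l < b}"
  have "(\<Sum>l\<in>?B. step_value k p c (r l) \<omega> * (W (r (Suc l)) \<omega> - W (r l) \<omega>))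
      = (\<Sum>l\<in>?B. \<Sum>i<k. c i \<omega> * (of_bool (p i \<le> r l \<and> r l < p (Suc i)) * (W (r (Suc l)) \<omega> - W (r l) \<omega>)))"
    unfolding step_value_def by (simp only: sum_distrib_right mult.assoc)
  also have "\<dots> = (\<Sum>i<k. c i \<omega> * (\<Sum>l\<in>?B. of_bool (p i \<le> r l \<and> r l < p (Suc i)) * (W (r (Suc l)) \<omega> - W (r l) \<omega>)))"
    by (subst sum.swap) (simp only: sum_distrib_left)
  also have "\<dots> = (\<Sum>i<k. c i \<omega> * (W (q (p (Suc i))) \<omega> - W (q (p i)) \<omega>))"
  proof (intro sum.cong refl arg_cong2[of _ _ _ _ "(*)"])
    fix i assume "i \<in> {..<k}"
    then have i: "i < k" by simp
    have "(\<Sum>l\<in>?B. of_bool (p i \<le> r l \<and> r l < p (Suc i)) * (W (r (Suc l)) \<omega> - W (r l) \<omega>))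
       = (\<Sum>l\<in>{l. l < m \<and> q (p i) \<le> r l \<and> r l < q (p (Suc i))}. W (r (Suc l)) \<omega> - W (r l) \<omega>)"
    proof (rule sum.mono_neutral_cong_right)
      show "{l. l < m \<and> q (p i) \<le> r l \<and> r l < q (p (Suc i))} \<subseteq> ?B"
        using ab by (auto simp: q_def min_def max_def split: if_splits)
    qed (use p[OF i] ab in \<open>auto simp: q_def min_def max_def split: if_splits\<close>)
    also have "\<dots> = W (q (p (Suc i))) \<omega> - W (q (p i)) \<omega>"
      by (rule partition_telescope[where r=r and m=m and a="q (p i)" and b="q (p (Suc i))" and f="\<lambda>x. W x \<omega>"])
        (use r qR[of i] qR[of "Suc i"] i p[OF i] in \<open>auto simp: q_def\<close>)
    finally show "(\<Sum>l\<in>?B. of_bool (p i \<le> r l \<and> r l < p (Suc i)) * (W (r (Suc l)) \<omega> - W (r l) \<omega>))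
       = W (q (p (Suc i))) \<omega> - W (q (p i)) \<omega>" .
  qed
  also have "\<dots> = simple_integral W k p c b \<omega> - simple_integral W k p c a \<omega>"
    unfolding simple_integral_def sum_subtractf[symmetric]
  proof (intro sum.cong refl)
    fix i
    show "c i \<omega> * (W (q (p (Suc i))) \<omega> - W (q (p i)) \<omega>) =
       c i \<omega> * (W (min (p (Suc i)) b) \<omega> - W (min (p i) b) \<omega>) - c i \<omega> * (W (min (p (Suc i)) a) \<omega> - W (min (p i) a) \<omega>)"
      unfolding right_diff_distrib[symmetric] using qW[of "p i"] qW[of "p (Suc i)"] by simp
  qed
  finally show ?thesis by simp
qed

lemma simple_process_on_cell:
  assumes r: "\<And>i l. i < l \<Longrightarrow> l \<le> m \<Longrightarrow> r i < r l" and r0: "r 0 = t0" and rm: "r m = t1"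
    and clamp: "\<And>i. i \<le> k \<Longrightarrow> max t0 (min (p i) t1) \<in> r ` {..m}"
    and l: "l < m" and x: "r l < x" "x < r (Suc l)"
  shows "simple_process k p c x \<omega> = step_value k p c (r l) \<omega>"
proof -
  have rl: "t0 \<le> r l" "r (Suc l) \<le> t1"
    using r[of 0 l] r[of "Suc l" m] r0 rm l by (cases "l = 0"; cases "Suc l = m"; force)+
  have iff: "p i < x \<longleftrightarrow> p i \<le> r l" if i: "i \<le> k" for i
  proof
    assume "p i < x"
    obtain j where j: "j \<le> m" "max t0 (min (p i) t1) = r j" using clamp[OF i] by auto
    have "r j < r (Suc l)" using \<open>p i < x\<close> rl x j(2)[symmetric] by auto
    then have "j \<le> l" using r[of "Suc l" j] j(1) by (cases "j = Suc l") force+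
    then have "r j \<le> r l" using r[of j l] l by (cases "j = l") auto
    then show "p i \<le> r l" using j(2)[symmetric] \<open>p i < x\<close> rl x by auto
  qed (use x in auto)
  have "indicator {p i<..p (Suc i)} x = (of_bool (p i \<le> r l \<and> r l < p (Suc i)) :: real)" if "i < k" for i
    using iff[of i] iff[of "Suc i"] that by (auto simp: indicator_def not_le[symmetric])
  then show ?thesis unfolding simple_process_def step_value_def by (intro sum.cong) auto
qed

section \<open>Brownian increments\<close>

locale brownian =
  fixes M :: "'a measure" and F :: "real \<Rightarrow> 'a measure" and W :: "real \<Rightarrow> 'a \<Rightarrow> real"
  assumes bm: "brownian_motion M F W"
begin

sublocale prob_space M
  using bm by (simp add: brownian_motion_def)

lemma space_F [simp]: "space (F t) = space M"
  using bm by (auto simp: brownian_motion_def filtration_def)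

lemma sets_F_subset: "sets (F t) \<subseteq> sets M"
  using bm by (auto simp: brownian_motion_def subalgebra_def)

lemma sets_F_mono: "s \<le> t \<Longrightarrow> sets (F s) \<subseteq> sets (F t)"
  using bm by (simp add: brownian_motion_def filtration_def)

lemma measurable_F_mono: "f \<in> measurable (F s) N \<Longrightarrow> s \<le> t \<Longrightarrow> f \<in> measurable (F t) N"
  using sets_F_mono[of s t] by (auto simp: measurable_def)

lemma measurable_from_F: "f \<in> measurable (F s) N \<Longrightarrow> f \<in> measurable M N"
  using sets_F_subset[of s] by (auto simp: measurable_def)

lemma W_adapted: "0 \<le> t \<Longrightarrow> W t \<in> borel_measurable (F t)"
  using bm by (auto simp: brownian_motion_def)

lemma W_adapted': "0 \<le> s \<Longrightarrow> s \<le> t \<Longrightarrow> W s \<in> borel_measurable (F t)"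
  using W_adapted measurable_F_mono by blast

lemma W_measurable: "0 \<le> t \<Longrightarrow> W t \<in> borel_measurable M"
  using W_adapted measurable_from_F by blast

lemma increment_distributed:
  assumes "0 \<le> s" "s < t"
  shows "distributed M lborel (\<lambda>\<omega>. W t \<omega> - W s \<omega>) (\<lambda>x. ennreal (normal_density 0 (sqrt (t - s)) x))"
  using bm assms by (simp add: brownian_motion_def)

lemma increment_indep:
  assumes st: "0 \<le> s" "s < t" and f: "f \<in> measurable (F s) N"
    and g: "g \<in> measurable borel N'"
  shows "indep_var N f N' (\<lambda>\<omega>. g (W t \<omega> - W s \<omega>))"
proof -
  let ?D = "\<lambda>\<omega>. W t \<omega> - W s \<omega>"
  have D: "?D \<in> borel_measurable M"
    using W_measurable st by auto
  have ind: "indep_set (sets (F s)) (sets (vimage_algebra (space M) ?D borel))"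
    using bm st by (simp add: brownian_motion_def)
  have "sigma_sets (space M) {f -` A \<inter> space M |A. A \<in> sets N} \<subseteq> sets (F s)"
  proof -
    have "{f -` A \<inter> space M |A. A \<in> sets N} \<subseteq> sets (F s)"
      using measurable_sets[OF f] by auto
    from sets.sigma_sets_subset[OF this] show ?thesis by simp
  qed
  moreover have "sigma_sets (space M) {(\<lambda>\<omega>. g (?D \<omega>)) -` A \<inter> space M |A. A \<in> sets N'}
      \<subseteq> sets (vimage_algebra (space M) ?D borel)"
  proof -
    have "(\<lambda>\<omega>. g (?D \<omega>)) \<in> measurable (vimage_algebra (space M) ?D borel) N'"
      by (rule measurable_compose[OF measurable_vimage_algebra1 g]) auto
    then have "{(\<lambda>\<omega>. g (?D \<omega>)) -` A \<inter> space M |A. A \<in> sets N'}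
        \<subseteq> sets (vimage_algebra (space M) ?D borel)"
      by (auto dest: measurable_sets)
    from sets.sigma_sets_subset[OF this] show ?thesis by simp
  qed
  ultimately have "indep_set (sigma_sets (space M) {f -` A \<inter> space M |A. A \<in> sets N})
     (sigma_sets (space M) {(\<lambda>\<omega>. g (?D \<omega>)) -` A \<inter> space M |A. A \<in> sets N'})"
    using ind unfolding indep_sets2_eq by blast
  then show ?thesis
    unfolding indep_var_eq
    using measurable_from_F[OF f] measurable_compose[OF D g] by auto
qed

lemma increment_moment:
  assumes st: "0 \<le> s" "s < t"
  shows "has_bochner_integral M (\<lambda>\<omega>. (W t \<omega> - W s \<omega>) ^ (2 * k)) (fact (2 * k) / ((2 / (t - s)) ^ k * fact k))"
    and "has_bochner_integral M (\<lambda>\<omega>. (W t \<omega> - W s \<omega>) ^ (2 * k + 1)) 0"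
proof -
  have pos: "0 < sqrt (t - s)" using st by simp
  note D = increment_distributed[OF st]
  { fix n c assume "has_bochner_integral lborel (\<lambda>x. normal_density 0 (sqrt (t - s)) x * (x - 0) ^ n) c"
    then have "has_bochner_integral M (\<lambda>\<omega>. (W t \<omega> - W s \<omega>) ^ n) c"
      using distributed_integrable[OF D, of "\<lambda>x. x ^ n"] distributed_integral[OF D, of "\<lambda>x. x ^ n"]
      by (simp add: has_bochner_integral_iff normal_density_nonneg) }
  note * = this
  show "has_bochner_integral M (\<lambda>\<omega>. (W t \<omega> - W s \<omega>) ^ (2 * k)) (fact (2 * k) / ((2 / (t - s)) ^ k * fact k))"
    using *[OF normal_moment_even[OF pos, of 0 k]] st by simp
  show "has_bochner_integral M (\<lambda>\<omega>. (W t \<omega> - W s \<omega>) ^ (2 * k + 1)) 0"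
    using *[OF normal_moment_odd[OF pos, of 0 k]] by simp
qed

text \<open>
  The increment is independent of the past and Gaussian, so conditionally on the past the exponential
  integrates to one.
\<close>

lemma exponential_martingale_step:
  assumes st: "0 \<le> s" "s < t"
    and U: "U \<in> borel_measurable (F s)" and S: "S \<in> borel_measurable (F s)"
  shows "(\<integral>\<^sup>+\<omega>. U \<omega> * ennreal (exp (S \<omega> * (W t \<omega> - W s \<omega>) - (S \<omega>)\<^sup>2 * (t - s) / 2)) \<partial>M) = (\<integral>\<^sup>+\<omega>. U \<omega> \<partial>M)"
proof -
  let ?D = "\<lambda>\<omega>. W t \<omega> - W s \<omega>" and ?h = "t - s"
  let ?P = "borel \<Otimes>\<^sub>M borel :: (ennreal \<times> real) measure"
  have h: "0 < ?h" using st by simp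
  have D[measurable]: "?D \<in> borel_measurable M"
    using W_measurable st by auto
  have US[measurable]: "(\<lambda>\<omega>. (U \<omega>, S \<omega>)) \<in> measurable (F s) ?P"
    using U S by measurable
  have US'[measurable]: "(\<lambda>\<omega>. (U \<omega>, S \<omega>)) \<in> measurable M ?P"
    using measurable_from_F US by blast
  have D': "(\<lambda>\<omega>. (0::ennreal, ?D \<omega>)) \<in> measurable M ?P"
    by measurable
  have ind: "indep_var ?P (\<lambda>\<omega>. (U \<omega>, S \<omega>)) ?P (\<lambda>\<omega>. (0, ?D \<omega>))"
    by (rule increment_indep[OF st US, of "\<lambda>x. (0, x)"]) measurable
  have eq: "distr M ?P (\<lambda>\<omega>. (U \<omega>, S \<omega>)) \<Otimes>\<^sub>M distr M ?P (\<lambda>\<omega>. (0, ?D \<omega>))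
      = distr M (?P \<Otimes>\<^sub>M ?P) (\<lambda>\<omega>. ((U \<omega>, S \<omega>), (0, ?D \<omega>)))"
    using ind unfolding indep_var_distribution_eq by simp
  interpret D: prob_space "distr M ?P (\<lambda>\<omega>. (0, ?D \<omega>))" by (rule prob_space_distr) (rule D')
  have nd: "distr M borel ?D = density lborel (normal_density 0 (sqrt ?h))"
    using increment_distributed[OF st] unfolding distributed_def
    by (simp cong: distr_cong)
  have one: "(\<integral>\<^sup>+\<omega>. ennreal (exp (b * ?D \<omega> - b\<^sup>2 * ?h / 2)) \<partial>M) = 1" for b :: real
  proof -
    have "(\<integral>\<^sup>+\<omega>. ennreal (exp (b * ?D \<omega> - b\<^sup>2 * ?h / 2)) \<partial>M)
        = (\<integral>\<^sup>+x. ennreal (exp (b * x - b\<^sup>2 * ?h / 2)) \<partial>distr M borel ?D)"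
      by (subst nn_integral_distr) auto
    also have "(\<integral>\<^sup>+x. ennreal (exp (b * x - b\<^sup>2 * ?h / 2)) \<partial>distr M borel ?D)
        = (\<integral>\<^sup>+x. ennreal (normal_density (b * ?h) (sqrt ?h) x) \<partial>lborel)"
      unfolding nd
    proof (subst nn_integral_density, simp, simp, intro nn_integral_cong)
      fix x :: real
      have "- x\<^sup>2 / (2 * ?h) + (b * x - b\<^sup>2 * ?h / 2) = - (x - b * ?h)\<^sup>2 / (2 * ?h)"
        using h by (simp add: field_simps power2_eq_square)
      then have "normal_density 0 (sqrt ?h) x * exp (b * x - b\<^sup>2 * ?h / 2) = normal_density (b * ?h) (sqrt ?h) x"
        using h by (simp add: normal_density_def mult_exp_exp)
      then show "ennreal (normal_density 0 (sqrt ?h) x) * ennreal (exp (b * x - b\<^sup>2 * ?h / 2)) = ennreal (normal_density (b * ?h) (sqrt ?h) x)"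
        by (simp add: ennreal_mult'[symmetric] normal_density_nonneg)
    qed
    also have "\<dots> = emeasure (density lborel (normal_density (b * ?h) (sqrt ?h))) (space (density lborel (normal_density (b * ?h) (sqrt ?h))))"
      by (simp add: emeasure_density)
    also have "\<dots> = 1"
      using prob_space.emeasure_space_1[OF prob_space_normal_density[of "sqrt ?h" "b * ?h"]] h by simp
    finally show ?thesis .
  qed
  have "(\<integral>\<^sup>+\<omega>. U \<omega> * ennreal (exp (S \<omega> * ?D \<omega> - (S \<omega>)\<^sup>2 * ?h / 2)) \<partial>M)
      = (\<integral>\<^sup>+z. fst (fst z) * ennreal (exp (snd (fst z) * snd (snd z) - (snd (fst z))\<^sup>2 * ?h / 2))
            \<partial>distr M (?P \<Otimes>\<^sub>M ?P) (\<lambda>\<omega>. ((U \<omega>, S \<omega>), (0, ?D \<omega>))))"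
    by (subst nn_integral_distr) (auto intro!: measurable_Pair US' D')
  also have "\<dots> = (\<integral>\<^sup>+u. (\<integral>\<^sup>+x. fst u * ennreal (exp (snd u * snd x - (snd u)\<^sup>2 * ?h / 2)) \<partial>distr M ?P (\<lambda>\<omega>. (0, ?D \<omega>)))
        \<partial>distr M ?P (\<lambda>\<omega>. (U \<omega>, S \<omega>)))"
    unfolding eq[symmetric] by (subst D.nn_integral_fst[symmetric]) auto
  also have "\<dots> = (\<integral>\<^sup>+u. (\<integral>\<^sup>+\<omega>. fst u * ennreal (exp (snd u * ?D \<omega> - (snd u)\<^sup>2 * ?h / 2)) \<partial>M)
        \<partial>distr M ?P (\<lambda>\<omega>. (U \<omega>, S \<omega>)))"
    by (subst nn_integral_distr[OF D']) auto
  also have "\<dots> = (\<integral>\<^sup>+u. fst u \<partial>distr M ?P (\<lambda>\<omega>. (U \<omega>, S \<omega>)))"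
    by (intro nn_integral_cong) (simp add: nn_integral_cmult one)
  also have "\<dots> = (\<integral>\<^sup>+\<omega>. U \<omega> \<partial>M)"
    by (subst nn_integral_distr) auto
  finally show ?thesis .
qed

section \<open>Discrete stochastic integrals in probability\<close>

text \<open>
  A non-degenerate martingale difference that is independent of the past. Besides Brownian increments
  this covers their centred squares, so that one estimate serves both for stochastic integrals and for
  the quadratic variation.
\<close>

definition innovation :: "real \<Rightarrow> real \<Rightarrow> ('a \<Rightarrow> real) \<Rightarrow> real \<Rightarrow> bool" where
  "innovation s t d v \<longleftrightarrow> 0 < v \<and> d \<in> borel_measurable (F t) \<and>
     (\<forall>g\<in>borel_measurable (F s). indep_var borel g borel d) \<and>
     integrable M (\<lambda>\<omega>. (d \<omega>)\<^sup>2) \<and> expectation d = 0 \<and> expectation (\<lambda>\<omega>. (d \<omega>)\<^sup>2) = v"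

lemma innovation_increment:
  assumes "0 \<le> s" "s < t"
  shows "innovation s t (\<lambda>\<omega>. W t \<omega> - W s \<omega>) (t - s)"
proof -
  have "has_bochner_integral M (\<lambda>\<omega>. (W t \<omega> - W s \<omega>)\<^sup>2) (t - s)"
    using increment_moment(1)[OF assms, of 1] by (simp add: diff_divide_distrib)
  moreover have "has_bochner_integral M (\<lambda>\<omega>. W t \<omega> - W s \<omega>) 0"
    using increment_moment(2)[OF assms, of 0] by simp
  ultimately show ?thesis
    unfolding innovation_def
    using assms increment_indep[OF assms, of _ borel "\<lambda>x. x"]
    by (auto simp: has_bochner_integral_iff intro!: borel_measurable_diff W_adapted W_adapted')
qed

text \<open>
  The variance is the fourth moment \<open>3 h\<^sup>2\<close> of a centred Gaussian of variance \<open>h\<close> minus \<open>h\<^sup>2\<close>.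
\<close>

lemma innovation_square:
  assumes "0 \<le> s" "s < t"
  shows "innovation s t (\<lambda>\<omega>. (W t \<omega> - W s \<omega>)\<^sup>2 - (t - s)) (2 * (t - s)\<^sup>2)"
proof -
  let ?D = "\<lambda>\<omega>. W t \<omega> - W s \<omega>" and ?h = "t - s"
  have m2: "has_bochner_integral M (\<lambda>\<omega>. (?D \<omega>)\<^sup>2) ?h"
    using increment_moment(1)[OF assms, of 1] by (simp add: diff_divide_distrib)
  have "has_bochner_integral M (\<lambda>\<omega>. (?D \<omega>) ^ 4) (3 * ?h\<^sup>2)"
  proof -
    have "fact 4 / ((2 / ?h)\<^sup>2 * fact 2) = 3 * ?h\<^sup>2"
      using assms by (simp add: fact_numeral power_divide)
    then show ?thesis using increment_moment(1)[OF assms, of 2] by simp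
  qed
  then have "has_bochner_integral M (\<lambda>\<omega>. (?D \<omega>) ^ 4 - 2 * ?h * (?D \<omega>)\<^sup>2 + ?h\<^sup>2) (3 * ?h\<^sup>2 - 2 * ?h * ?h + ?h\<^sup>2)"
    by (intro has_bochner_integral_add has_bochner_integral_diff has_bochner_integral_mult_right m2)
      (auto simp: has_bochner_integral_iff prob_space)
  moreover have "x ^ 4 - 2 * h * x\<^sup>2 + h\<^sup>2 = (x\<^sup>2 - h)\<^sup>2" for x h :: real
    by algebra
  ultimately have m4: "has_bochner_integral M (\<lambda>\<omega>. ((?D \<omega>)\<^sup>2 - ?h)\<^sup>2) (3 * ?h\<^sup>2 - 2 * ?h * ?h + ?h\<^sup>2)"
    by (simp only:)
  have "3 * ?h\<^sup>2 - 2 * ?h * ?h + ?h\<^sup>2 = 2 * ?h\<^sup>2" by algebra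
  note m4 = m4[unfolded this]
  have m1: "has_bochner_integral M (\<lambda>\<omega>. (?D \<omega>)\<^sup>2 - ?h) 0"
    using has_bochner_integral_diff[OF m2, of "\<lambda>_. ?h" ?h]
    by (simp add: has_bochner_integral_iff prob_space)
  have "?D \<in> borel_measurable (F t)"
    using assms by (auto intro!: borel_measurable_diff W_adapted W_adapted')
  then show ?thesis
    unfolding innovation_def
    using assms m4 m1 increment_indep[OF assms, of _ borel "\<lambda>x. x\<^sup>2 - ?h"]
    by (auto simp: has_bochner_integral_iff)
qed

text \<open>
  Products of different summands have mean zero, because the later innovation is independent of all
  other factors.
\<close>

lemma martingale_transform_L2:
  assumes d: "\<And>l. l < m \<Longrightarrow> innovation (r l) (r (Suc l)) (d l) (v l)"
    and r: "\<And>i l. i \<le> l \<Longrightarrow> l \<le> m \<Longrightarrow> r i \<le> r l"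
    and c: "\<And>l. l < m \<Longrightarrow> c l \<in> borel_measurable (F (r l))"
    and K: "\<And>l \<omega>. l < m \<Longrightarrow> \<bar>c l \<omega>\<bar> \<le> K l"
    and B: "B \<subseteq> {..<m}"
  shows "has_bochner_integral M (\<lambda>\<omega>. (\<Sum>l\<in>B. c l \<omega> * d l \<omega>)\<^sup>2) (\<Sum>l\<in>B. v l * expectation (\<lambda>\<omega>. (c l \<omega>)\<^sup>2))"
proof -
  have fin: "finite B" using B finite_subset by blast
  have dF: "d l \<in> borel_measurable (F (r (Suc l)))" if "l < m" for l
    using d[OF that] by (simp add: innovation_def)
  have dM[measurable]: "d l \<in> borel_measurable M" if "l < m" for l
    using dF[OF that] measurable_from_F by blast
  have cM[measurable]: "c l \<in> borel_measurable M" if "l < m" for l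
    using c[OF that] measurable_from_F by blast
  have d2: "integrable M (\<lambda>\<omega>. (d l \<omega>)\<^sup>2)" if "l < m" for l
    using d[OF that] by (simp add: innovation_def)
  have d1: "integrable M (d l)" if "l < m" for l
    using square_integrable_imp_integrable[OF dM[OF that] d2[OF that]] .
  have diag: "has_bochner_integral M (\<lambda>\<omega>. (c l \<omega> * d l \<omega>) * (c l \<omega> * d l \<omega>)) (v l * expectation (\<lambda>\<omega>. (c l \<omega>)\<^sup>2))"
    if l: "l < m" for l
  proof -
    have ind: "indep_var borel (\<lambda>\<omega>. (c l \<omega>)\<^sup>2) borel (\<lambda>\<omega>. (d l \<omega>)\<^sup>2)"
      using indep_var_compose[of borel "c l" borel "d l" "\<lambda>x. x\<^sup>2" borel "\<lambda>x. x\<^sup>2" borel] d[OF l] c[OF l]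
      by (simp add: innovation_def o_def)
    have ic: "integrable M (\<lambda>\<omega>. (c l \<omega>)\<^sup>2)"
      by (rule integrable_const_bound[where B="(K l)\<^sup>2"])
        (use K[OF l] cM[OF l] in \<open>auto intro!: AE_I2 abs_le_square_iff[THEN iffD1] intro: order_trans[OF _ abs_ge_self]\<close>)
    have "integrable M (\<lambda>\<omega>. (c l \<omega>)\<^sup>2 * (d l \<omega>)\<^sup>2)"
      "expectation (\<lambda>\<omega>. (c l \<omega>)\<^sup>2 * (d l \<omega>)\<^sup>2) = expectation (\<lambda>\<omega>. (c l \<omega>)\<^sup>2) * v l"
      using indep_var_integrable[OF ind ic d2[OF l]] indep_var_lebesgue_integral[OF ind ic d2[OF l]] d[OF l]
      by (auto simp: innovation_def)
    then show ?thesis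
      by (simp add: has_bochner_integral_iff power2_eq_square mult_ac)
  qed
  have cd: "integrable M (\<lambda>\<omega>. c i \<omega> * d i \<omega>)" "integrable M (\<lambda>\<omega>. (c i \<omega> * d i \<omega>)\<^sup>2)" if "i < m" for i
  proof -
    show 2: "integrable M (\<lambda>\<omega>. (c i \<omega> * d i \<omega>)\<^sup>2)"
      using diag[OF that] by (simp add: power2_eq_square has_bochner_integral_iff)
    show "integrable M (\<lambda>\<omega>. c i \<omega> * d i \<omega>)"
      using square_integrable_imp_integrable[OF _ 2] that by simp
  qed
  have cross: "has_bochner_integral M (\<lambda>\<omega>. (c i \<omega> * d i \<omega>) * (c j \<omega> * d j \<omega>)) 0" if ij: "i < j" "j < m" for i j
  proof -
    have i: "i < m" using ij by simp
    let ?g = "\<lambda>\<omega>. (c i \<omega> * d i \<omega>) * c j \<omega>"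
    have "?g \<in> borel_measurable (F (r j))"
      using measurable_F_mono[OF c[OF i] r[of i j]] measurable_F_mono[OF dF[OF i] r[of "Suc i" j]] c[OF ij(2)] ij
      by (intro borel_measurable_times) auto
    then have ind: "indep_var borel ?g borel (d j)"
      using d[OF ij(2)] by (simp add: innovation_def)
    have ig: "integrable M ?g"
    proof (rule Bochner_Integration.integrable_bound[of _ "\<lambda>\<omega>. K j * (c i \<omega> * d i \<omega>)"])
      show "AE \<omega> in M. norm (?g \<omega>) \<le> norm (K j * (c i \<omega> * d i \<omega>))"
      proof (rule AE_I2)
        fix \<omega>
        have "\<bar>c j \<omega>\<bar> \<le> \<bar>K j\<bar>" using K[OF ij(2), of \<omega>] by linarith
        from mult_right_mono[OF this, of "\<bar>c i \<omega> * d i \<omega>\<bar>"]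
        show "norm (?g \<omega>) \<le> norm (K j * (c i \<omega> * d i \<omega>))" by (simp add: abs_mult mult_ac)
      qed
    qed (use cd(1)[OF i] i ij in auto)
    have "integrable M (\<lambda>\<omega>. ?g \<omega> * d j \<omega>)" "expectation (\<lambda>\<omega>. ?g \<omega> * d j \<omega>) = 0"
      using indep_var_integrable[OF ind ig d1[OF ij(2)]] indep_var_lebesgue_integral[OF ind ig d1[OF ij(2)]] d[OF ij(2)]
      by (auto simp: innovation_def)
    then show ?thesis by (simp add: has_bochner_integral_iff mult_ac)
  qed
  have "has_bochner_integral M (\<lambda>\<omega>. \<Sum>i\<in>B. \<Sum>j\<in>B. (c i \<omega> * d i \<omega>) * (c j \<omega> * d j \<omega>))
     (\<Sum>i\<in>B. \<Sum>j\<in>B. if i = j then v i * expectation (\<lambda>\<omega>. (c i \<omega>)\<^sup>2) else 0)"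
  proof (intro has_bochner_integral_sum)
    fix i j assume "i \<in> B" "j \<in> B"
    then have "i < m" "j < m" using B by auto
    then show "has_bochner_integral M (\<lambda>\<omega>. (c i \<omega> * d i \<omega>) * (c j \<omega> * d j \<omega>))
        (if i = j then v i * expectation (\<lambda>\<omega>. (c i \<omega>)\<^sup>2) else 0)"
      using diag[of i] cross[of i j] cross[of j i]
      by (cases i j rule: linorder_cases) (auto simp: mult_ac)
  qed
  then show ?thesis
    using fin by (simp add: power2_eq_square sum_product)
qed

text \<open>
  A transform is small in probability if its quadratic variation is. The coefficients are set to zero
  once the quadratic variation including the current cell exceeds \<open>\<epsilon>\<close>; this quantity is already known at
  the left end of the cell, so the truncated coefficients are still predictable, and they are bounded
  because each \<open>v l\<close> is positive. On the event that the total quadratic variation is at most \<open>\<epsilon>\<close> nothing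
  has been changed. The sum over blocks \<open>B j\<close> covers both a single transform and the sum of squares of its
  partial sums over consecutive cells.
\<close>

lemma truncated_martingale_transform:
  assumes d: "\<And>l. l < m \<Longrightarrow> innovation (r l) (r (Suc l)) (d l) (v l)"
    and r: "\<And>i l. i \<le> l \<Longrightarrow> l \<le> m \<Longrightarrow> r i \<le> r l"
    and c: "\<And>l. l < m \<Longrightarrow> c l \<in> borel_measurable (F (r l))"
    and J: "finite J" and B: "\<And>j. j \<in> J \<Longrightarrow> B j \<subseteq> {..<m}" and disj: "disjoint_family_on B J"
    and \<epsilon>: "0 < \<epsilon>"
  shows "expectation (\<lambda>\<omega>. min 1 (\<Sum>j\<in>J. (\<Sum>l\<in>B j. c l \<omega> * d l \<omega>)\<^sup>2))
     \<le> prob {\<omega> \<in> space M. \<epsilon> < (\<Sum>l<m. (c l \<omega>)\<^sup>2 * v l)} + \<epsilon>"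
proof -
  define Q where "Q k \<omega> = (\<Sum>l<k. (c l \<omega>)\<^sup>2 * v l)" for k \<omega>
  define ct where "ct l \<omega> = (if Q (Suc l) \<omega> \<le> \<epsilon> then c l \<omega> else 0)" for l \<omega>
  have v: "0 < v l" if "l < m" for l using d[OF that] by (simp add: innovation_def)
  have QF: "Q k \<in> borel_measurable (F (r l))" if "l < m" "k \<le> Suc l" for k l
    unfolding Q_def
  proof (intro borel_measurable_sum borel_measurable_times borel_measurable_power borel_measurable_const)
    fix i assume "i \<in> {..<k}"
    then show "c i \<in> borel_measurable (F (r l))"
      using measurable_F_mono[OF c[of i] r[of i l]] that by auto
  qed
  have cM: "c l \<in> borel_measurable M" if "l < m" for l
    using c[OF that] measurable_from_F by blast
  have dM: "d l \<in> borel_measurable M" if "l < m" for l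
    using d[OF that] measurable_from_F by (auto simp: innovation_def)
  have ctF: "ct l \<in> borel_measurable (F (r l))" if "l < m" for l
    unfolding ct_def using QF[OF that order_refl] c[OF that] by measurable
  have ctM: "ct l \<in> borel_measurable M" if "l < m" for l
    using ctF[OF that] measurable_from_F by blast
  have QM: "Q m \<in> borel_measurable M"
    unfolding Q_def by (intro borel_measurable_sum borel_measurable_times borel_measurable_power borel_measurable_const cM) auto
  have Qt: "(\<Sum>l<k. (ct l \<omega>)\<^sup>2 * v l) \<le> min \<epsilon> (Q k \<omega>)" if "k \<le> m" for k \<omega>
    using that
  proof (induction k)
    case 0 then show ?case using \<epsilon> by (simp add: Q_def)
  next
    case (Suc k)
    have "0 \<le> (c k \<omega>)\<^sup>2 * v k" using v[of k] Suc.prems by simp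
    then have "Q k \<omega> \<le> Q (Suc k) \<omega>" by (simp add: Q_def)
    then show ?case using Suc by (auto simp: ct_def) (auto simp: Q_def)
  qed
  have bd: "\<bar>ct l \<omega>\<bar> \<le> sqrt (\<epsilon> / v l)" if l: "l < m" for l \<omega>
  proof -
    have "(ct l \<omega>)\<^sup>2 * v l \<le> (\<Sum>l<m. (ct l \<omega>)\<^sup>2 * v l)"
      by (rule member_le_sum[of l "{..<m}" "\<lambda>l. (ct l \<omega>)\<^sup>2 * v l"])
        (use l less_imp_le[OF v] in auto)
    then have "(ct l \<omega>)\<^sup>2 \<le> \<epsilon> / v l" using Qt[of m \<omega>] v[OF l] by (simp add: pos_le_divide_eq)
    then show ?thesis by (simp add: real_le_rsqrt)
  qed
  have L2: "has_bochner_integral M (\<lambda>\<omega>. (\<Sum>l\<in>B j. ct l \<omega> * d l \<omega>)\<^sup>2) (\<Sum>l\<in>B j. v l * expectation (\<lambda>\<omega>. (ct l \<omega>)\<^sup>2))"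
    if "j \<in> J" for j
    by (rule martingale_transform_L2[where m=m and r=r and K="\<lambda>l. sqrt (\<epsilon> / v l)"]) (use d r ctF bd B[OF that] in auto)
  let ?S = "\<lambda>\<omega>. \<Sum>j\<in>J. (\<Sum>l\<in>B j. ct l \<omega> * d l \<omega>)\<^sup>2"
  let ?E = "{\<omega> \<in> space M. \<epsilon> < Q m \<omega>}"
  have S: "has_bochner_integral M ?S (\<Sum>j\<in>J. \<Sum>l\<in>B j. v l * expectation (\<lambda>\<omega>. (ct l \<omega>)\<^sup>2))"
    by (intro has_bochner_integral_sum L2) auto
  have E: "?E \<in> events" using QM by measurable
  have iE: "integrable M (indicator ?E :: 'a \<Rightarrow> real)"
    using E by (intro integrable_real_indicator) (auto simp: emeasure_eq_measure)
  have pt: "min 1 (\<Sum>j\<in>J. (\<Sum>l\<in>B j. c l \<omega> * d l \<omega>)\<^sup>2) \<le> indicator ?E \<omega> + ?S \<omega>" if "\<omega> \<in> space M" for \<omega>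
  proof (cases "\<epsilon> < Q m \<omega>")
    case True
    have "0 \<le> ?S \<omega>" by (intro sum_nonneg) simp
    then show ?thesis using True that by simp
  next
    case False
    have "Q (Suc l) \<omega> \<le> Q m \<omega>" if "l < m" for l
      unfolding Q_def by (intro sum_mono2) (use that less_imp_le[OF v] in auto)
    then have "ct l \<omega> = c l \<omega>" if "l < m" for l using False that by (fastforce simp: ct_def)
    then have "(\<Sum>j\<in>J. (\<Sum>l\<in>B j. c l \<omega> * d l \<omega>)\<^sup>2) = ?S \<omega>"
      using B by (intro sum.cong refl arg_cong[of _ _ "\<lambda>x. x\<^sup>2"]) (metis lessThan_iff subsetD)
    then show ?thesis using False by (simp add: indicator_def)
  qed
  have ict: "integrable M (\<lambda>\<omega>. (ct l \<omega>)\<^sup>2)" if l: "l < m" for l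
  proof (rule integrable_const_bound[where B="(sqrt (\<epsilon> / v l))\<^sup>2"])
    show "AE \<omega> in M. norm ((ct l \<omega>)\<^sup>2) \<le> (sqrt (\<epsilon> / v l))\<^sup>2"
      using bd[OF l] by (intro AE_I2) (metis abs_ge_zero norm_power power_mono real_norm_def)
  qed (use ctM[OF l] in auto)
  have m: "(\<lambda>\<omega>. min 1 (\<Sum>j\<in>J. (\<Sum>l\<in>B j. c l \<omega> * d l \<omega>)\<^sup>2)) \<in> borel_measurable M"
    using B by (intro borel_measurable_min borel_measurable_sum borel_measurable_times
        borel_measurable_power borel_measurable_const cM dM) auto
  have "expectation (\<lambda>\<omega>. min 1 (\<Sum>j\<in>J. (\<Sum>l\<in>B j. c l \<omega> * d l \<omega>)\<^sup>2)) \<le> expectation (\<lambda>\<omega>. indicator ?E \<omega> + ?S \<omega>)"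
  proof (rule integral_mono)
    show "integrable M (\<lambda>\<omega>. min 1 (\<Sum>j\<in>J. (\<Sum>l\<in>B j. c l \<omega> * d l \<omega>)\<^sup>2))"
    proof (rule integrable_const_bound[OF AE_I2 m])
      fix \<omega>
      have "0 \<le> (\<Sum>j\<in>J. (\<Sum>l\<in>B j. c l \<omega> * d l \<omega>)\<^sup>2)" by (intro sum_nonneg) simp
      then show "norm (min 1 (\<Sum>j\<in>J. (\<Sum>l\<in>B j. c l \<omega> * d l \<omega>)\<^sup>2)) \<le> 1" by simp
    qed
    show "integrable M (\<lambda>\<omega>. indicator ?E \<omega> + ?S \<omega>)"
      using S iE by (intro Bochner_Integration.integrable_add) (auto simp: has_bochner_integral_iff)
  qed (rule pt)
  also have "\<dots> = prob ?E + (\<Sum>j\<in>J. \<Sum>l\<in>B j. v l * expectation (\<lambda>\<omega>. (ct l \<omega>)\<^sup>2))"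
    using S E iE by (subst Bochner_Integration.integral_add) (auto simp: has_bochner_integral_iff)
  also have "(\<Sum>j\<in>J. \<Sum>l\<in>B j. v l * expectation (\<lambda>\<omega>. (ct l \<omega>)\<^sup>2)) = (\<Sum>l\<in>(\<Union>j\<in>J. B j). v l * expectation (\<lambda>\<omega>. (ct l \<omega>)\<^sup>2))"
    by (rule sum.UNION_disjoint[symmetric])
      (use J B disj in \<open>auto simp: disjoint_family_on_def intro: finite_subset[OF _ finite_lessThan]\<close>)
  also have "\<dots> \<le> (\<Sum>l<m. v l * expectation (\<lambda>\<omega>. (ct l \<omega>)\<^sup>2))"
    using B v by (intro sum_mono2) (auto intro!: mult_nonneg_nonneg less_imp_le[OF v] integral_nonneg)
  also have "\<dots> = expectation (\<lambda>\<omega>. \<Sum>l<m. (ct l \<omega>)\<^sup>2 * v l)"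
    using ict by (subst Bochner_Integration.integral_sum) (auto simp: mult.commute)
  also have "\<dots> \<le> expectation (\<lambda>\<omega>. \<epsilon>)"
    using ict Qt[of m] by (intro integral_mono) auto
  finally show ?thesis by (simp add: prob_space Q_def)
qed

text \<open>
  If the bounds \<open>Q N\<close> tend to zero almost everywhere, then \<open>min 1 (U N)\<close> tends to zero in mean.
\<close>

lemma ae_null_subsequence:
  fixes U Q :: "nat \<Rightarrow> 'a \<Rightarrow> real"
  assumes U[measurable]: "\<And>N. U N \<in> borel_measurable M" and U0: "\<And>N \<omega>. 0 \<le> U N \<omega>"
    and Q[measurable]: "\<And>N. Q N \<in> borel_measurable M"
    and bound: "\<And>N \<epsilon>. 0 < \<epsilon> \<Longrightarrow> expectation (\<lambda>\<omega>. min 1 (U N \<omega>)) \<le> prob {\<omega> \<in> space M. \<epsilon> < Q N \<omega>} + \<epsilon>"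
    and lim: "AE \<omega> in M. (\<lambda>N. Q N \<omega>) \<longlonglongrightarrow> 0"
  shows "\<exists>\<phi>. strict_mono \<phi> \<and> (AE \<omega> in M. (\<lambda>N. U (\<phi> N) \<omega>) \<longlonglongrightarrow> 0)"
proof -
  have int: "integrable M (\<lambda>\<omega>. min 1 (U N \<omega>))" for N
    by (rule integrable_const_bound[where B=1]) (use U0 in auto)
  have P: "(\<lambda>N. prob {\<omega> \<in> space M. \<epsilon> < Q N \<omega>}) \<longlonglongrightarrow> 0" if \<epsilon>: "0 < \<epsilon>" for \<epsilon>
  proof -
    have "(\<lambda>N. \<integral>\<omega>. indicat_real {\<omega> \<in> space M. \<epsilon> < Q N \<omega>} \<omega> \<partial>M) \<longlonglongrightarrow> (\<integral>\<omega>. 0 \<partial>M)"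
    proof (rule integral_dominated_convergence[where w="\<lambda>_. 1"])
      show "AE \<omega> in M. (\<lambda>N. indicat_real {\<omega> \<in> space M. \<epsilon> < Q N \<omega>} \<omega>) \<longlonglongrightarrow> 0"
        using lim
      proof eventually_elim
        case (elim \<omega>)
        have "\<forall>\<^sub>F N in sequentially. Q N \<omega> < \<epsilon>" using elim \<epsilon> by (rule order_tendstoD)
        then have "\<forall>\<^sub>F N in sequentially. indicat_real {\<omega> \<in> space M. \<epsilon> < Q N \<omega>} \<omega> = 0"
          by eventually_elim (auto simp: indicator_def)
        then show ?case by (rule tendsto_eventually)
      qed
    qed auto
    then show ?thesis by simp
  qed
  have "(\<lambda>N. expectation (\<lambda>\<omega>. norm (min 1 (U N \<omega>)))) \<longlonglongrightarrow> 0"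
  proof (rule tendstoI)
    fix e :: real assume e: "0 < e"
    have "\<forall>\<^sub>F N in sequentially. prob {\<omega> \<in> space M. e / 2 < Q N \<omega>} < e / 2"
      using P[of "e / 2"] e by (intro order_tendstoD) auto
    then show "\<forall>\<^sub>F N in sequentially. dist (expectation (\<lambda>\<omega>. norm (min 1 (U N \<omega>)))) 0 < e"
    proof eventually_elim
      case (elim N)
      have "expectation (\<lambda>\<omega>. min 1 (U N \<omega>)) < e"
        using bound[of "e / 2" N] e elim by simp
      moreover have "norm (min 1 (U N \<omega>)) = min 1 (U N \<omega>)" for \<omega> using U0[of N \<omega>] by simp
      ultimately show ?case by (simp add: integral_nonneg U0)
    qed
  qed
  from tendsto_L1_AE_subseq[OF int this]
  obtain \<phi> where \<phi>: "strict_mono \<phi>" "AE \<omega> in M. (\<lambda>N. min 1 (U (\<phi> N) \<omega>)) \<longlonglongrightarrow> 0" by blast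
  have "AE \<omega> in M. (\<lambda>N. U (\<phi> N) \<omega>) \<longlonglongrightarrow> 0"
    using \<phi>(2)
  proof eventually_elim
    case (elim \<omega>)
    have "\<forall>\<^sub>F N in sequentially. min 1 (U (\<phi> N) \<omega>) < 1" using elim by (rule order_tendstoD) simp
    then have "\<forall>\<^sub>F N in sequentially. min 1 (U (\<phi> N) \<omega>) = U (\<phi> N) \<omega>"
      by eventually_elim (auto simp: min_def split: if_splits)
    with elim show ?case by (rule Lim_transform_eventually)
  qed
  with \<phi>(1) show ?thesis by blast
qed

section \<open>Quadratic variation and approximation of the Ito integral\<close>

text \<open>
  The centred squares of the increments are innovations of variance \<open>2 (h / n)\<^sup>2\<close>, and there are \<open>n\<close> of
  them.
\<close>

lemma quadratic_variation:
  assumes t: "0 \<le> t0" "t0 < t1"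
  shows "\<exists>\<phi>. strict_mono \<phi> \<and> (AE \<omega> in M.
    (\<lambda>N. \<Sum>j<Suc (\<phi> N). (W (grid t0 t1 (Suc (\<phi> N)) (Suc j)) \<omega> - W (grid t0 t1 (Suc (\<phi> N)) j) \<omega>)\<^sup>2) \<longlonglongrightarrow> t1 - t0)"
proof -
  let ?h = "t1 - t0"
  define V where "V N \<omega> = (\<Sum>j<Suc N. (W (grid t0 t1 (Suc N) (Suc j)) \<omega> - W (grid t0 t1 (Suc N) j) \<omega>)\<^sup>2)" for N \<omega>
  have gpos: "0 \<le> grid t0 t1 (Suc N) j" for N j using t by simp
  have VM: "V N \<in> borel_measurable M" for N
    unfolding V_def by (intro borel_measurable_sum borel_measurable_power borel_measurable_diff W_measurable gpos)
  have bound: "expectation (\<lambda>\<omega>. min 1 ((V N \<omega> - ?h)\<^sup>2)) \<le> prob {\<omega> \<in> space M. \<epsilon> < 2 * ?h\<^sup>2 / real (Suc N)} + \<epsilon>"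
    if \<epsilon>: "0 < \<epsilon>" for N \<epsilon>
  proof -
    let ?k = "?h / real (Suc N)"
    let ?d = "\<lambda>j \<omega>. (W (grid t0 t1 (Suc N) (Suc j)) \<omega> - W (grid t0 t1 (Suc N) j) \<omega>)\<^sup>2 - ?k"
    have k: "0 < ?k" using t by simp
    have inn: "innovation (grid t0 t1 (Suc N) j) (grid t0 t1 (Suc N) (Suc j)) (?d j) (2 * ?k\<^sup>2)" for j
    proof -
      have st: "grid t0 t1 (Suc N) (Suc j) - grid t0 t1 (Suc N) j = ?k" by (rule grid_step)
      then have "grid t0 t1 (Suc N) j < grid t0 t1 (Suc N) (Suc j)" using k by linarith
      from innovation_square[OF gpos this] show ?thesis unfolding st .
    qed
    have mono: "grid t0 t1 (Suc N) i \<le> grid t0 t1 (Suc N) l" if "i \<le> l" for i l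
      using that t by (intro add_left_mono divide_right_mono mult_right_mono) auto
    have "expectation (\<lambda>\<omega>. min 1 (\<Sum>i\<in>{0::nat}. (\<Sum>j\<in>{..<Suc N}. 1 * ?d j \<omega>)\<^sup>2))
        \<le> prob {\<omega> \<in> space M. \<epsilon> < (\<Sum>l<Suc N. 1\<^sup>2 * (2 * ?k\<^sup>2))} + \<epsilon>"
      by (rule truncated_martingale_transform[where r="grid t0 t1 (Suc N)" and m="Suc N" and d="?d" and v="\<lambda>_. 2 * ?k\<^sup>2"
            and c="\<lambda>_ _. 1" and J="{0::nat}" and B="\<lambda>_. {..<Suc N}", OF inn mono _ _ _ _ \<epsilon>])
        (auto simp: disjoint_family_on_def)
    moreover have "(\<Sum>j\<in>{..<Suc N}. 1 * ?d j \<omega>) = V N \<omega> - ?h" for \<omega>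
      unfolding V_def mult_1 sum_subtractf by simp
    moreover have "(\<Sum>l<Suc N. 1\<^sup>2 * (2 * ?k\<^sup>2)) = 2 * ?h\<^sup>2 / real (Suc N)"
      by (simp add: power2_eq_square field_simps del: of_nat_Suc)
    ultimately show ?thesis by simp
  qed
  have "\<exists>\<phi>. strict_mono \<phi> \<and> (AE \<omega> in M. (\<lambda>N. (V (\<phi> N) \<omega> - ?h)\<^sup>2) \<longlonglongrightarrow> 0)"
  proof (rule ae_null_subsequence[where U="\<lambda>N \<omega>. (V N \<omega> - ?h)\<^sup>2" and Q="\<lambda>N _. 2 * ?h\<^sup>2 / real (Suc N)", OF _ _ _ bound])
    have "(\<lambda>N. 2 * ?h\<^sup>2 / real (Suc N)) \<longlonglongrightarrow> 0"
      by (intro real_tendsto_divide_at_top[OF tendsto_const] filterlim_compose[OF filterlim_real_sequentially filterlim_Suc])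
    then show "AE \<omega> in M. (\<lambda>N. 2 * ?h\<^sup>2 / real (Suc N)) \<longlonglongrightarrow> 0" by simp
  qed (use VM in auto)
  then obtain \<phi> where \<phi>: "strict_mono \<phi>" "AE \<omega> in M. (\<lambda>N. (V (\<phi> N) \<omega> - ?h)\<^sup>2) \<longlonglongrightarrow> 0" by blast
  have "AE \<omega> in M. (\<lambda>N. V (\<phi> N) \<omega>) \<longlonglongrightarrow> ?h"
    using \<phi>(2)
  proof eventually_elim
    case (elim \<omega>)
    have "(\<lambda>N. sqrt ((V (\<phi> N) \<omega> - ?h)\<^sup>2)) \<longlonglongrightarrow> sqrt 0" by (intro tendsto_intros elim)
    then have "(\<lambda>N. V (\<phi> N) \<omega> - ?h) \<longlonglongrightarrow> 0" by (simp add: tendsto_rabs_zero_iff)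
    then show ?case by (simp add: LIM_zero_iff)
  qed
  with \<phi>(1) show ?thesis unfolding V_def by blast
qed

lemma simple_data_nonneg:
  assumes sd: "simple_data F k p c" and "i \<le> k"
  shows "0 \<le> p i"
  using assms(2)
proof (induction i)
  case 0
  then show ?case using sd by (simp add: simple_data_def)
next
  case (Suc i)
  then have "p i \<le> p (Suc i)" using sd by (simp add: simple_data_def)
  then show ?case using Suc by simp
qed

lemma simple_integral_measurable:
  assumes sd: "simple_data F k p c" and t: "0 \<le> t"
  shows "simple_integral W k p c t \<in> borel_measurable M"
proof -
  have p0: "0 \<le> p i" if "i \<le> k" for i by (rule simple_data_nonneg[OF sd that])
  show ?thesis
    unfolding simple_integral_def[abs_def]
  proof (intro borel_measurable_sum borel_measurable_times borel_measurable_diff)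
    fix i assume "i \<in> {..<k}"
    then have i: "i < k" by simp
    show "c i \<in> borel_measurable M" using measurable_from_F[of "c i" "p i" borel] sd i by (simp add: simple_data_def)
    show "W (min (p (Suc i)) t) \<in> borel_measurable M" "W (min (p i) t) \<in> borel_measurable M"
      using W_measurable[of "min (p (Suc i)) t"] W_measurable[of "min (p i) t"] p0[of i] p0[of "Suc i"] i t by auto
  qed
qed

text \<open>
  Finitely many limits in probability can be met simultaneously with probability at least
  \<open>1 - (1/2) ^ N\<close>, and the Borel-Cantelli lemma makes the bounds hold almost surely for all large \<open>N\<close>.
\<close>

lemma ito_approximation:
  fixes G :: "nat \<Rightarrow> real set" and e :: "nat \<Rightarrow> real"
  assumes ito: "is_ito_integral M F W H I" and T: "0 \<le> T"
    and G: "\<And>N. finite (G N)" "\<And>N. G N \<subseteq> {0..}" and e: "\<And>N. 0 < e N"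
  shows "\<exists>k p c. (\<forall>N. simple_data F (k N) (p N) (c N)) \<and>
    (AE \<omega> in M. \<forall>\<^sub>F N in sequentially.
       (\<integral>\<^sup>+s\<in>{0..T}. ennreal ((simple_process (k N) (p N) (c N) s \<omega> - H s \<omega>)\<^sup>2) \<partial>lborel) \<le> ennreal (e N) \<and>
       (\<forall>t\<in>G N. \<bar>simple_integral W (k N) (p N) (c N) t \<omega> - I t \<omega>\<bar> \<le> e N))"
proof -
  obtain k p c where sd: "\<And>a. simple_data F (k a) (p a) (c a)"
    and nul: "\<And>t. 0 \<le> t \<Longrightarrow> null_in_probability M (\<lambda>a \<omega>.
             \<integral>\<^sup>+s\<in>{0..t}. ennreal ((simple_process (k a) (p a) (c a) s \<omega> - H s \<omega>)\<^sup>2) \<partial>lborel)"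
    and nuI: "\<And>t. 0 \<le> t \<Longrightarrow> null_in_probability M (\<lambda>a \<omega>.
             ennreal \<bar>simple_integral W (k a) (p a) (c a) t \<omega> - I t \<omega>\<bar>)"
    using ito unfolding is_ito_integral_def by blast
  define E where "E a \<omega> = (\<integral>\<^sup>+s\<in>{0..T}. ennreal ((simple_process (k a) (p a) (c a) s \<omega> - H s \<omega>)\<^sup>2) \<partial>lborel)" for a \<omega>
  define D where "D t a \<omega> = ennreal \<bar>simple_integral W (k a) (p a) (c a) t \<omega> - I t \<omega>\<bar>" for t a \<omega>
  have EM: "E a \<in> borel_measurable M" for a
    using nul[OF T] by (simp add: null_in_probability_def E_def[abs_def])
  have DM: "D t a \<in> borel_measurable M" if "0 \<le> t" for t a
    using nuI[OF that] by (simp add: null_in_probability_def D_def[abs_def])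
  define A where "A N a = {\<omega> \<in> space M. ennreal (e N) < E a \<omega>} \<union> (\<Union>t\<in>G N. {\<omega> \<in> space M. ennreal (e N) < D t a \<omega>})" for N a
  have AE': "{\<omega> \<in> space M. ennreal (e N) < E a \<omega>} \<in> events" for N a using EM by measurable
  have AD': "{\<omega> \<in> space M. ennreal (e N) < D t a \<omega>} \<in> events" if "t \<in> G N" for N a t
    using DM[of t a] that G(2)[of N] by (intro borel_measurable_less) auto
  have AM: "A N a \<in> events" for N a
    unfolding A_def using AE' AD' G(1)[of N] by (intro sets.Un sets.finite_UN) auto
  have "\<exists>a. prob (A N a) < (1/2) ^ N" for N
  proof -
    let ?E = "\<lambda>a. {\<omega> \<in> space M. ennreal (e N) < E a \<omega>}" and ?D = "\<lambda>t a. {\<omega> \<in> space M. ennreal (e N) < D t a \<omega>}"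
    have le: "prob (A N a) \<le> prob (?E a) + (\<Sum>t\<in>G N. prob (?D t a))" for a
    proof -
      have "prob (A N a) \<le> prob (?E a) + prob (\<Union>t\<in>G N. ?D t a)"
        unfolding A_def using AE' AD' G(1)[of N] by (intro measure_Un_le sets.finite_UN) auto
      also have "prob (\<Union>t\<in>G N. ?D t a) \<le> (\<Sum>t\<in>G N. prob (?D t a))"
        using AD' G(1)[of N] by (intro measure_UNION_le) auto
      finally show ?thesis by simp
    qed
    have "(\<lambda>a. prob (?E a)) \<longlonglongrightarrow> 0"
      using nul[OF T] e[of N] unfolding null_in_probability_def E_def by simp
    moreover have "(\<lambda>a. prob (?D t a)) \<longlonglongrightarrow> 0" if "t \<in> G N" for t
      using nuI[of t] G(2)[of N] that e[of N] unfolding null_in_probability_def D_def by auto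
    ultimately have "(\<lambda>a. prob (?E a) + (\<Sum>t\<in>G N. prob (?D t a)))
        \<longlonglongrightarrow> 0 + (\<Sum>t\<in>G N. 0)"
      by (intro tendsto_add tendsto_sum) auto
    then have "\<forall>\<^sub>F a in sequentially. prob (?E a) + (\<Sum>t\<in>G N. prob (?D t a)) < (1/2) ^ N"
      by (rule order_tendstoD) simp
    then obtain a where "prob (?E a) + (\<Sum>t\<in>G N. prob (?D t a)) < (1/2) ^ N"
      using eventually_happens'[OF sequentially_bot] by blast
    then show ?thesis using le[of a] by (intro exI[of _ a]) simp
  qed
  then obtain a where a: "\<And>N. prob (A N (a N)) < (1/2) ^ N" by metis
  have "AE \<omega> in M. \<forall>\<^sub>F N in sequentially. \<omega> \<in> space M - A N (a N)"
  proof (rule borel_cantelli_AE1)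
    show "summable (\<lambda>N. prob (A N (a N)))"
      by (rule summable_comparison_test'[of "\<lambda>N. (1/2) ^ N"]) (use a in \<open>auto intro: less_imp_le\<close>)
  qed (use AM in \<open>auto simp: emeasure_eq_measure\<close>)
  then have "AE \<omega> in M. \<forall>\<^sub>F N in sequentially. E (a N) \<omega> \<le> ennreal (e N) \<and>
      (\<forall>t\<in>G N. \<bar>simple_integral W (k (a N)) (p (a N)) (c (a N)) t \<omega> - I t \<omega>\<bar> \<le> e N)"
  proof eventually_elim
    case (elim \<omega>)
    then show ?case
    proof eventually_elim
      case (elim N)
      have "\<bar>simple_integral W (k (a N)) (p (a N)) (c (a N)) t \<omega> - I t \<omega>\<bar> \<le> e N" if "t \<in> G N" for t
      proof -
        have "D t (a N) \<omega> \<le> ennreal (e N)" using elim that by (auto simp: A_def not_less)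
        then show ?thesis using e[of N] unfolding D_def by (subst (asm) ennreal_le_iff) auto
      qed
      moreover have "E (a N) \<omega> \<le> ennreal (e N)" using elim by (auto simp: A_def not_less)
      ultimately show ?case by blast
    qed
  qed
  then show ?thesis
    unfolding E_def using sd by (intro exI[of _ "\<lambda>N. k (a N)"] exI[of _ "\<lambda>N. p (a N)"] exI[of _ "\<lambda>N. c (a N)"]) auto
qed

section \<open>Explicit solution of the linear stochastic equation\<close>

lemma step_value_adapted:
  assumes "\<And>i. i < k \<Longrightarrow> c i \<in> borel_measurable (F (p i))"
  shows "step_value k p c x \<in> borel_measurable (F x)"
proof -
  have "(\<lambda>\<omega>. c i \<omega> * of_bool (p i \<le> x \<and> x < p (Suc i))) \<in> borel_measurable (F x)" if "i < k" for i
  proof (cases "p i \<le> x")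
    case True
    then show ?thesis using measurable_F_mono[OF assms[OF that] True] by measurable
  qed simp
  then show ?thesis unfolding step_value_def by (intro borel_measurable_sum) auto
qed

text \<open>
  The residual \<open>S j\<close> is the increment of a simple integral over a grid interval minus its Euler
  approximation with the frozen value \<open>g j\<close>. On the common refinement of the grid and the times of the
  simple process it is a discrete stochastic integral, and \<open>Q1\<close>, \<open>Q2\<close> are the quadratic variations of the
  residuals without and with the weights \<open>z j\<close>. The last two clauses bound them along a path: \<open>Q1\<close> by the
  distance \<open>\<eta>\<close> of the simple process to its limit \<open>H\<close> and the oscillation \<open>e\<close> of \<open>H\<close> over the grid
  intervals, and \<open>Q2\<close> by \<open>Q1\<close>. The integrand \<open>H\<close> is required to agree with the continuous function \<open>y\<close> only
  before \<open>t1\<close>, because the coefficients of the scheme jump at the grid times.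
\<close>

lemma euler_residual_bounds:
  fixes n :: nat and t0 t1 :: real
  defines "h \<equiv> t1 - t0"
  defines "s \<equiv> \<lambda>j::nat. t0 + real j * h / real n"
  defines "S \<equiv> \<lambda>k p c g j \<omega>. simple_integral W k p c (s (Suc j)) \<omega> - simple_integral W k p c (s j) \<omega>
      - g j \<omega> * (W (s (Suc j)) \<omega> - W (s j) \<omega>)"
  assumes t: "0 \<le> t0" "t0 < t1" and n: "0 < n" and sd: "simple_data F k p c"
    and g: "\<And>j. j < n \<Longrightarrow> g j \<in> borel_measurable (F (s j))"
    and z: "\<And>j. j < n \<Longrightarrow> z j \<in> borel_measurable (F (s j))"
  shows "\<exists>Q1 Q2. Q1 \<in> borel_measurable M \<and> Q2 \<in> borel_measurable M \<and>
    (\<forall>\<omega>. 0 \<le> Q1 \<omega> \<and> 0 \<le> Q2 \<omega>) \<and>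
    (\<forall>\<epsilon>>0. expectation (\<lambda>\<omega>. min 1 (\<Sum>j<n. (S k p c g j \<omega>)\<^sup>2)) \<le> prob {\<omega> \<in> space M. \<epsilon> < Q1 \<omega>} + \<epsilon>) \<and>
    (\<forall>\<epsilon>>0. expectation (\<lambda>\<omega>. min 1 ((\<Sum>j<n. z j \<omega> * S k p c g j \<omega>)\<^sup>2)) \<le> prob {\<omega> \<in> space M. \<epsilon> < Q2 \<omega>} + \<epsilon>) \<and>
    (\<forall>\<omega> y H e \<eta>. continuous_on {t0..t1} y \<longrightarrow> (\<forall>x. t0 \<le> x \<and> x < t1 \<longrightarrow> H x = y x) \<longrightarrow> 0 \<le> e \<longrightarrow> 0 \<le> \<eta> \<longrightarrow>
       (\<forall>j<n. \<forall>x. s j \<le> x \<and> x \<le> s (Suc j) \<longrightarrow> \<bar>y x - g j \<omega>\<bar> \<le> e) \<longrightarrow>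
       (\<integral>\<^sup>+x\<in>{0..t1}. ennreal ((simple_process k p c x \<omega> - H x)\<^sup>2) \<partial>lborel) \<le> ennreal \<eta> \<longrightarrow>
       Q1 \<omega> \<le> 2 * \<eta> + 2 * e\<^sup>2 * h) \<and>
    (\<forall>\<omega> C. (\<forall>j<n. \<bar>z j \<omega>\<bar> \<le> C) \<longrightarrow> Q2 \<omega> \<le> C\<^sup>2 * Q1 \<omega>)"
proof -
  have h: "0 < h" using t by (simp add: h_def)
  have smono: "s i \<le> s j" if "i \<le> j" for i j
    using that h n by (simp add: s_def divide_right_mono mult_right_mono)
  have s0: "s 0 = t0" and sn: "s n = t1" using n by (simp_all add: s_def h_def)
  have p_le: "p i \<le> p (Suc i)" if "i < k" for i using sd that by (simp add: simple_data_def)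
  have cF: "c i \<in> borel_measurable (F (p i))" if "i < k" for i using sd that by (simp add: simple_data_def)
  \<comment> \<open>The common refinement: the grid points together with the times of the simple process, moved into
    \<open>[t0, t1]\<close>.\<close>
  define R where "R = s ` {..n} \<union> (\<lambda>i. max t0 (min (p i) t1)) ` {..k}"
  have Rs: "s j \<in> R" if "j \<le> n" for j using that by (auto simp: R_def)
  have fR: "finite R" "t0 \<in> R" "t1 \<in> R" "R \<subseteq> {t0..t1}"
    using Rs[of 0] Rs[of n] s0 sn smono[of 0] smono[of _ n] t by (auto simp: R_def)
  obtain m :: nat and r where r0: "r 0 = t0" and rm: "r m = t1" and rR: "r ` {..m} = R"
    and r: "\<And>i l. i < l \<Longrightarrow> l \<le> m \<Longrightarrow> r i < r l"
    by (rule finite_set_as_partition[OF fR], rule that)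
  have clamp: "max t0 (min (p i) t1) \<in> r ` {..m}" if "i \<le> k" for i
    using that rR by (auto simp: R_def)
  note increment = simple_integral_increment[where r=r and m=m and p=p and k=k and ?t0.0=t0 and ?t1.0=t1, OF r r0 rm p_le clamp]
  have on_cell: "simple_process k p c x \<omega> = step_value k p c (r l) \<omega>"
    if "l < m" "r l < x" "x < r (Suc l)" for l x \<omega>
    by (rule simple_process_on_cell[where r=r and m=m and p=p and k=k and ?t0.0=t0 and ?t1.0=t1, OF r r0 rm clamp])
      (use that in auto)
  have rle: "r i \<le> r l" if "i \<le> l" "l \<le> m" for i l using r[of i l] that by (cases "i = l") (auto intro: less_imp_le)
  have rpos: "0 \<le> r l" if "l \<le> m" for l using rle[of 0 l] r0 t that by simp
  define D where "D l \<omega> = step_value k p c (r l) \<omega> - step_value n s g (r l) \<omega>" for l \<omega>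
  define zl where "zl l \<omega> = step_value n s z (r l) \<omega>" for l \<omega>
  define d where "d l \<omega> = W (r (Suc l)) \<omega> - W (r l) \<omega>" for l \<omega>
  define v where "v l = r (Suc l) - r l" for l
  define B where "B j = {l. l < m \<and> s j \<le> r l \<and> r l < s (Suc j)}" for j
  have v: "0 < v l" if "l < m" for l using r[of l "Suc l"] that by (simp add: v_def)
  have inn: "innovation (r l) (r (Suc l)) (d l) (v l)" if "l < m" for l
    using innovation_increment[of "r l" "r (Suc l)"] rpos[of l] r[of l "Suc l"] that
    by (simp add: d_def[abs_def] v_def)
  have DF: "D l \<in> borel_measurable (F (r l))" if "l < m" for l
    unfolding D_def by (intro borel_measurable_diff step_value_adapted cF g)
  have zF: "zl l \<in> borel_measurable (F (r l))" if "l < m" for l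
    unfolding zl_def by (intro step_value_adapted z)
  have blk: "\<exists>j<n. l \<in> B j" if "l < m" for l
  proof -
    have lt: "r l < s n" using r[of l m] that rm sn by simp
    define j where "j = (LEAST j. r l < s (Suc j))"
    have ex: "r l < s (Suc (n - 1))" using lt n by simp
    have j1: "r l < s (Suc j)" unfolding j_def by (rule LeastI[of "\<lambda>j. r l < s (Suc j)", OF ex])
    have j2: "j \<le> n - 1" unfolding j_def by (rule Least_le[of "\<lambda>j. r l < s (Suc j)", OF ex])
    have "s j \<le> r l"
    proof (cases j)
      case 0 then show ?thesis using s0 rle[of 0 l] r0 that by simp
    next
      case (Suc i)
      then show ?thesis using not_less_Least[of i "\<lambda>j. r l < s (Suc j)"] by (simp add: j_def)
    qed
    then show ?thesis using j1 j2 n that by (intro exI[of _ j]) (auto simp: B_def)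
  qed
  have val: "step_value n s f (r l) \<omega> = f j \<omega>" if "l \<in> B j" "j < n" for l j and f :: "nat \<Rightarrow> 'a \<Rightarrow> real" and \<omega>
    using that by (intro step_value_eq smono) (auto simp: B_def)
  have Bsub: "B j \<subseteq> {..<m}" for j by (auto simp: B_def)
  have disj: "disjoint_family_on B {..<n}"
  proof (unfold disjoint_family_on_def, intro ballI impI)
    fix i j assume "i \<in> {..<n}" "j \<in> {..<n}" "i \<noteq> j"
    then show "B i \<inter> B j = {}"
      using smono[of "Suc i" j] smono[of "Suc j" i] by (cases i j rule: linorder_cases) (auto simp: B_def)
  qed
  have S_eq: "S k p c g j \<omega> = (\<Sum>l\<in>B j. D l \<omega> * d l \<omega>)" if j: "j < n" for j \<omega>
  proof -
    have "simple_integral W k p c (s (Suc j)) \<omega> - simple_integral W k p c (s j) \<omega>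
        = (\<Sum>l\<in>B j. step_value k p c (r l) \<omega> * d l \<omega>)"
      unfolding B_def d_def
      by (rule increment) (use Rs[of j] Rs[of "Suc j"] rR j smono[of j "Suc j"] in auto)
    moreover have "g j \<omega> * (W (s (Suc j)) \<omega> - W (s j) \<omega>) = (\<Sum>l\<in>B j. step_value n s g (r l) \<omega> * d l \<omega>)"
    proof -
      have "(\<Sum>l\<in>B j. step_value n s g (r l) \<omega> * d l \<omega>) = g j \<omega> * (\<Sum>l\<in>B j. d l \<omega>)"
        using val[OF _ j] by (simp add: sum_distrib_left)
      also have "(\<Sum>l\<in>B j. d l \<omega>) = W (s (Suc j)) \<omega> - W (s j) \<omega>"
        unfolding B_def d_def
        by (rule partition_telescope[where r=r and m=m and a="s j" and b="s (Suc j)" and f="\<lambda>x. W x \<omega>"])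
          (use r Rs[of j] Rs[of "Suc j"] rR j smono[of j "Suc j"] in auto)
      finally show ?thesis by simp
    qed
    ultimately show ?thesis by (simp add: S_def D_def left_diff_distrib sum_subtractf)
  qed
  have UB: "(\<Union>j<n. B j) = {..<m}"
  proof
    show "(\<Union>j<n. B j) \<subseteq> {..<m}" using Bsub by blast
    show "{..<m} \<subseteq> (\<Union>j<n. B j)" using blk by blast
  qed
  have T_eq: "(\<Sum>j<n. z j \<omega> * S k p c g j \<omega>) = (\<Sum>l<m. (zl l \<omega> * D l \<omega>) * d l \<omega>)" for \<omega>
  proof -
    have "(\<Sum>l<m. (zl l \<omega> * D l \<omega>) * d l \<omega>) = (\<Sum>j<n. \<Sum>l\<in>B j. (zl l \<omega> * D l \<omega>) * d l \<omega>)"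
      unfolding UB[symmetric]
      by (rule sum.UNION_disjoint) (use disj finite_subset[OF Bsub finite_lessThan] in \<open>auto simp: disjoint_family_on_def\<close>)
    also have "\<dots> = (\<Sum>j<n. z j \<omega> * (\<Sum>l\<in>B j. D l \<omega> * d l \<omega>))"
      unfolding zl_def using val by (intro sum.cong) (auto simp: sum_distrib_left mult_ac)
    finally show ?thesis using S_eq by simp
  qed
  define Q1 where "Q1 \<omega> = (\<Sum>l<m. (D l \<omega>)\<^sup>2 * v l)" for \<omega>
  define Q2 where "Q2 \<omega> = (\<Sum>l<m. (zl l \<omega> * D l \<omega>)\<^sup>2 * v l)" for \<omega>
  have DM: "D l \<in> borel_measurable M" "zl l \<in> borel_measurable M" if "l < m" for l
    using DF[OF that] zF[OF that] measurable_from_F by blast+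
  have QM: "Q1 \<in> borel_measurable M" "Q2 \<in> borel_measurable M"
    unfolding Q1_def Q2_def using DM
    by (auto intro!: borel_measurable_sum borel_measurable_times borel_measurable_power borel_measurable_const)
  have Q0: "0 \<le> Q1 \<omega>" "0 \<le> Q2 \<omega>" for \<omega>
    unfolding Q1_def Q2_def using less_imp_le[OF v] by (auto intro!: sum_nonneg)
  have b1: "expectation (\<lambda>\<omega>. min 1 (\<Sum>j<n. (S k p c g j \<omega>)\<^sup>2)) \<le> prob {\<omega> \<in> space M. \<epsilon> < Q1 \<omega>} + \<epsilon>" if "0 < \<epsilon>" for \<epsilon>
  proof -
    have "expectation (\<lambda>\<omega>. min 1 (\<Sum>j\<in>{..<n}. (\<Sum>l\<in>B j. D l \<omega> * d l \<omega>)\<^sup>2)) \<le> prob {\<omega> \<in> space M. \<epsilon> < (\<Sum>l<m. (D l \<omega>)\<^sup>2 * v l)} + \<epsilon>"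
      by (rule truncated_martingale_transform[where r=r and d=d and v=v and c=D and m=m and J="{..<n}" and B=B, OF inn rle DF _ Bsub disj that]) auto
    then show ?thesis using S_eq by (simp add: Q1_def)
  qed
  have b2: "expectation (\<lambda>\<omega>. min 1 ((\<Sum>j<n. z j \<omega> * S k p c g j \<omega>)\<^sup>2)) \<le> prob {\<omega> \<in> space M. \<epsilon> < Q2 \<omega>} + \<epsilon>" if "0 < \<epsilon>" for \<epsilon>
  proof -
    have "expectation (\<lambda>\<omega>. min 1 (\<Sum>j\<in>{0::nat}. (\<Sum>l\<in>{..<m}. (zl l \<omega> * D l \<omega>) * d l \<omega>)\<^sup>2))
        \<le> prob {\<omega> \<in> space M. \<epsilon> < (\<Sum>l<m. (zl l \<omega> * D l \<omega>)\<^sup>2 * v l)} + \<epsilon>"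
      by (rule truncated_martingale_transform[where r=r and d=d and v=v and c="\<lambda>l \<omega>. zl l \<omega> * D l \<omega>" and m=m and J="{0::nat}" and B="\<lambda>_. {..<m}",
            OF inn rle _ _ _ _ that])
        (use DF zF in \<open>auto simp: disjoint_family_on_def intro!: borel_measurable_times\<close>)
    then show ?thesis by (simp add: T_eq Q2_def)
  qed
  have b4: "Q2 \<omega> \<le> C\<^sup>2 * Q1 \<omega>" if C: "\<forall>j<n. \<bar>z j \<omega>\<bar> \<le> C" for \<omega> C
  proof -
    have "(zl l \<omega> * D l \<omega>)\<^sup>2 * v l \<le> C\<^sup>2 * ((D l \<omega>)\<^sup>2 * v l)" if l: "l < m" for l
    proof -
      obtain j where j: "j < n" "l \<in> B j" using blk[OF l] by blast
      then have "\<bar>zl l \<omega>\<bar> \<le> C" using val[OF j(2,1), of z \<omega>] C by (simp add: zl_def)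
      then have "(zl l \<omega>)\<^sup>2 \<le> C\<^sup>2" by (metis abs_ge_zero power2_abs power_mono)
      from mult_right_mono[OF this, of "(D l \<omega>)\<^sup>2 * v l"] show ?thesis
        using v[OF l] by (simp add: power_mult_distrib mult_ac)
    qed
    then show ?thesis unfolding Q1_def Q2_def sum_distrib_left by (intro sum_mono) auto
  qed
  have b3: "Q1 \<omega> \<le> 2 * \<eta> + 2 * e\<^sup>2 * h"
    if y: "continuous_on {t0..t1} y" and H: "\<forall>x. t0 \<le> x \<and> x < t1 \<longrightarrow> H x = y x" and e: "0 \<le> e" and \<eta>: "0 \<le> \<eta>"
      and osc: "\<forall>j<n. \<forall>x. s j \<le> x \<and> x \<le> s (Suc j) \<longrightarrow> \<bar>y x - g j \<omega>\<bar> \<le> e"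
      and int: "(\<integral>\<^sup>+x\<in>{0..t1}. ennreal ((simple_process k p c x \<omega> - H x)\<^sup>2) \<partial>lborel) \<le> ennreal \<eta>"
    for \<omega> y H e \<eta>
  proof -
    let ?f = "\<lambda>x. ennreal ((simple_process k p c x \<omega> - H x)\<^sup>2)"
    let ?c = "\<lambda>l. {r l<..<r (Suc l)}"
    have cell: "r l \<ge> t0" "r (Suc l) \<le> t1" if "l < m" for l
      using rle[of 0 l] rle[of "Suc l" m] that r0 rm by auto
    have fm: "(\<lambda>x. ?f x * indicator (?c l) x) \<in> borel_measurable lborel" if l: "l < m" for l
    proof -
      have "(\<lambda>x. indicator (?c l) x *\<^sub>R (step_value k p c (r l) \<omega> - y x)) \<in> borel_measurable borel"
        by (rule borel_measurable_continuous_on_indicator)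
          (use cell[OF l] in \<open>auto intro!: continuous_intros continuous_on_subset[OF y]\<close>)
      then have "(\<lambda>x. ennreal ((indicator (?c l) x *\<^sub>R (step_value k p c (r l) \<omega> - y x))\<^sup>2)) \<in> borel_measurable lborel"
        by measurable
      also have "(\<lambda>x. ennreal ((indicator (?c l) x *\<^sub>R (step_value k p c (r l) \<omega> - y x))\<^sup>2)) = (\<lambda>x. ?f x * indicator (?c l) x)"
        using on_cell[OF l] cell[OF l] H
        by (auto simp: indicator_def fun_eq_iff)
      finally show ?thesis .
    qed
    \<comment> \<open>On a cell \<open>D = (P - H) + (H - g)\<close>, where \<open>P\<close> is the simple process.\<close>
    have one: "ennreal ((D l \<omega>)\<^sup>2 * v l) \<le> 2 * (\<integral>\<^sup>+x. ?f x * indicator (?c l) x \<partial>lborel) + ennreal (2 * e\<^sup>2 * v l)" if l: "l < m" for l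
    proof -
      obtain j where j: "j < n" "l \<in> B j" using blk[OF l] by blast
      obtain i where i: "i \<le> m" "s (Suc j) = r i" using Rs[of "Suc j"] j(1) rR by (metis Suc_leI atMost_iff imageE)
      have "r l < r i" using j(2) i unfolding B_def by simp
      then have "l < i" using rle[of i l] l by (cases "i \<le> l") auto
      then have up: "r (Suc l) \<le> s (Suc j)" using i rle[of "Suc l" i] by simp
      have len: "emeasure lborel (?c l) = ennreal (v l)" using v[OF l] by (simp add: v_def)
      have "ennreal ((D l \<omega>)\<^sup>2 * v l) = (\<integral>\<^sup>+x. ennreal ((D l \<omega>)\<^sup>2) * indicator (?c l) x \<partial>lborel)"
        by (subst nn_integral_cmult_indicator) (use len v[OF l] in \<open>auto simp: ennreal_mult\<close>)
      also have "\<dots> \<le> (\<integral>\<^sup>+x. 2 * (?f x * indicator (?c l) x) + ennreal (2 * e\<^sup>2) * indicator (?c l) x \<partial>lborel)"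
      proof (rule nn_integral_mono)
        fix x
        show "ennreal ((D l \<omega>)\<^sup>2) * indicator (?c l) x \<le> 2 * (?f x * indicator (?c l) x) + ennreal (2 * e\<^sup>2) * indicator (?c l) x"
        proof (cases "x \<in> ?c l")
          case True
          then have x: "r l < x" "x < r (Suc l)" by auto
          let ?P = "simple_process k p c x \<omega>"
          have D: "D l \<omega> = (?P - H x) + (y x - g j \<omega>)"
            using on_cell[OF l x] val[OF j(2,1), of g \<omega>] H cell[OF l] x by (simp add: D_def)
          have "\<bar>y x - g j \<omega>\<bar> \<le> e" using osc j x up unfolding B_def by auto
          then have osc': "(y x - g j \<omega>)\<^sup>2 \<le> e\<^sup>2" by (metis abs_ge_zero power2_abs power_mono)
          have "(a + b)\<^sup>2 \<le> 2 * a\<^sup>2 + 2 * b\<^sup>2" for a b :: real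
            using zero_le_power2[of "a - b"] by (simp add: power2_sum power2_diff)
          from this[of "?P - H x" "y x - g j \<omega>"] osc'
          have "(D l \<omega>)\<^sup>2 \<le> 2 * (?P - H x)\<^sup>2 + 2 * e\<^sup>2"
            unfolding D by linarith
          then have "ennreal ((D l \<omega>)\<^sup>2) \<le> ennreal (2 * (?P - H x)\<^sup>2 + 2 * e\<^sup>2)" by (rule ennreal_leI)
          also have "\<dots> = 2 * ?f x + ennreal (2 * e\<^sup>2)"
            by (subst ennreal_plus) (auto simp: ennreal_mult)
          finally show ?thesis using True by simp
        qed simp
      qed
      also have "\<dots> = 2 * (\<integral>\<^sup>+x. ?f x * indicator (?c l) x \<partial>lborel) + ennreal (2 * e\<^sup>2) * ennreal (v l)"
        using fm[OF l] len by (subst nn_integral_add) (auto simp: nn_integral_cmult nn_integral_cmult_indicator)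
      also have "ennreal (2 * e\<^sup>2) * ennreal (v l) = ennreal (2 * e\<^sup>2 * v l)"
        using v[OF l] by (subst ennreal_mult) auto
      finally show ?thesis .
    qed
    have v0: "0 \<le> v l" if "l < m" for l using v[OF that] by simp
    have "(\<Sum>l<m. \<integral>\<^sup>+x. ?f x * indicator (?c l) x \<partial>lborel) = (\<integral>\<^sup>+x. (\<Sum>l<m. ?f x * indicator (?c l) x) \<partial>lborel)"
      using fm by (subst nn_integral_sum) auto
    also have "\<dots> \<le> (\<integral>\<^sup>+x. ?f x * indicator {0..t1} x \<partial>lborel)"
    proof (rule nn_integral_mono)
      fix x
      show "(\<Sum>l<m. ?f x * indicator (?c l) x) \<le> ?f x * indicator {0..t1} x"
      proof (cases "\<exists>l<m. x \<in> ?c l")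
        case True
        then obtain l where l: "l < m" "x \<in> ?c l" by blast
        have "x \<notin> ?c i" if "i < m" "i \<noteq> l" for i
          using l rle[of "Suc i" l] rle[of "Suc l" i] that by (cases i l rule: linorder_cases) auto
        then have "(\<Sum>l<m. ?f x * indicator (?c l) x) = (\<Sum>i<m. if i = l then ?f x else 0)"
          using l by (intro sum.cong) auto
        also have "\<dots> = ?f x" using l by simp
        also have "\<dots> = ?f x * indicator {0..t1} x" using l cell[OF l(1)] t by simp
        finally show ?thesis by (rule eq_refl)
      next
        case False
        then have "(\<Sum>l<m. ?f x * indicator (?c l) x) = 0" by (intro sum.neutral) auto
        then show ?thesis by (simp only: zero_le)
      qed
    qed
    also have "\<dots> \<le> ennreal \<eta>" using int .
    finally have small: "(\<Sum>l<m. \<integral>\<^sup>+x. ?f x * indicator (?c l) x \<partial>lborel) \<le> ennreal \<eta>" .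
    have len: "(\<Sum>l<m. 2 * e\<^sup>2 * v l) = 2 * e\<^sup>2 * h"
      unfolding sum_distrib_left[symmetric] v_def using sum_lessThan_telescope[of r m] r0 rm by (simp add: h_def)
    have "ennreal (Q1 \<omega>) = (\<Sum>l<m. ennreal ((D l \<omega>)\<^sup>2 * v l))"
      unfolding Q1_def by (subst sum_ennreal) (auto intro!: mult_nonneg_nonneg v0)
    also have "\<dots> \<le> (\<Sum>l<m. 2 * (\<integral>\<^sup>+x. ?f x * indicator (?c l) x \<partial>lborel) + ennreal (2 * e\<^sup>2 * v l))"
      by (intro sum_mono one) auto
    also have "\<dots> = 2 * (\<Sum>l<m. \<integral>\<^sup>+x. ?f x * indicator (?c l) x \<partial>lborel) + ennreal (\<Sum>l<m. 2 * e\<^sup>2 * v l)"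
      by (subst sum_ennreal[symmetric]) (auto simp: sum.distrib sum_distrib_left intro!: mult_nonneg_nonneg v0)
    also have "\<dots> \<le> 2 * ennreal \<eta> + ennreal (2 * e\<^sup>2 * h)"
      unfolding len by (intro add_mono mult_left_mono small) auto
    also have "\<dots> = ennreal (2 * \<eta> + 2 * e\<^sup>2 * h)"
      using \<eta> h by (subst ennreal_plus) (auto simp: ennreal_mult)
    finally show ?thesis using \<eta> h by (subst (asm) ennreal_le_iff) auto
  qed
  show ?thesis
    using QM Q0 b1 b2 b3 b4 by blast
qed

text \<open>
  The coefficients are known at time \<open>t0\<close> but may be unbounded, so all limits are taken in probability
  and then, along subsequences, for almost every path, where \<open>linear_equation_path\<close> applies.
\<close>

lemma linear_sde_explicit:
  fixes \<mu> \<nu> :: "'a \<Rightarrow> real" and Y H I :: "real \<Rightarrow> 'a \<Rightarrow> real"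
  assumes ts: "0 \<le> t0" "t0 < t1" and ito: "is_ito_integral M F W H I"
    and mu: "\<mu> \<in> borel_measurable (F t0)" and nu: "\<nu> \<in> borel_measurable (F t0)"
    and Y: "\<And>t. t0 \<le> t \<Longrightarrow> t \<le> t1 \<Longrightarrow> Y t \<in> borel_measurable (F t)"
    and cont: "AE \<omega> in M. continuous_on {t0..t1} (\<lambda>t. Y t \<omega>)"
    and H: "AE \<omega> in M. \<forall>t. t0 \<le> t \<and> t < t1 \<longrightarrow> H t \<omega> = \<nu> \<omega> * Y t \<omega>"
    and eq: "AE \<omega> in M. \<forall>a b. t0 \<le> a \<and> a \<le> b \<and> b \<le> t1 \<longrightarrow>
       Y b \<omega> - Y a \<omega> = \<mu> \<omega> * integral {a..b} (\<lambda>s. Y s \<omega>) + (I b \<omega> - I a \<omega>)"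
  shows "AE \<omega> in M. Y t1 \<omega> = Y t0 \<omega> * exp ((\<mu> \<omega> - (\<nu> \<omega>)\<^sup>2 / 2) * (t1 - t0) + \<nu> \<omega> * (W t1 \<omega> - W t0 \<omega>))"
proof -
  let ?h = "t1 - t0"
  \<comment> \<open>The grids are chosen so fine that the quadratic variation converges along them almost surely.
    Adding one keeps the number of grid intervals positive.\<close>
  obtain \<phi>0 where \<phi>0: "strict_mono \<phi>0" "AE \<omega> in M.
    (\<lambda>N. \<Sum>j<Suc (\<phi>0 N). (W (grid t0 t1 (Suc (\<phi>0 N)) (Suc j)) \<omega> - W (grid t0 t1 (Suc (\<phi>0 N)) j) \<omega>)\<^sup>2) \<longlonglongrightarrow> ?h"
    using quadratic_variation[OF ts] by blast
  define n where "n N = Suc (\<phi>0 N)" for N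
  have n: "0 < n N" for N by (simp add: n_def)
  have nlim: "filterlim n at_top sequentially"
    unfolding n_def by (intro filterlim_compose[OF filterlim_Suc] filterlim_subseq \<phi>0)
  define g where "g N j = grid t0 t1 (n N) j" for N j
  have g0: "t0 \<le> g N j" "0 \<le> g N j" for N j unfolding g_def using ts by auto
  have gb: "g N j \<le> t1" if "j \<le> n N" for N j unfolding g_def by (rule grid_bounds[OF ts(2) n that])
  have gm: "g N i \<le> g N j" if "i \<le> j" for N i j
    unfolding g_def using that ts by (intro add_left_mono divide_right_mono mult_right_mono) auto
  define e where "e N = 1 / real (Suc N)" for N
  have e: "0 < e N" for N by (simp add: e_def)
  have elim: "e \<longlonglongrightarrow> 0"
    unfolding e_def by (rule LIMSEQ_Suc[OF lim_1_over_n])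
  have "\<exists>k p c. (\<forall>N. simple_data F (k N) (p N) (c N)) \<and>
    (AE \<omega> in M. \<forall>\<^sub>F N in sequentially.
       (\<integral>\<^sup>+s\<in>{0..t1}. ennreal ((simple_process (k N) (p N) (c N) s \<omega> - H s \<omega>)\<^sup>2) \<partial>lborel) \<le> ennreal (e N / real (n N)) \<and>
       (\<forall>t\<in>g N ` {..n N}. \<bar>simple_integral W (k N) (p N) (c N) t \<omega> - I t \<omega>\<bar> \<le> e N / real (n N)))"
    (is "\<exists>k p c. _ \<and> (AE \<omega> in M. \<forall>\<^sub>F N in sequentially. ?close k p c \<omega> N)")
    by (rule ito_approximation[OF ito]) (use ts e n g0 in auto)
  then obtain k p c where sd: "\<And>N. simple_data F (k N) (p N) (c N)"
    and approx: "AE \<omega> in M. \<forall>\<^sub>F N in sequentially. ?close k p c \<omega> N"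
    by blast
  define J where "J N t \<omega> = simple_integral W (k N) (p N) (c N) t \<omega>" for N t \<omega>
  define x where "x N j \<omega> = \<mu> \<omega> * (?h / real (n N)) + \<nu> \<omega> * (W (g N (Suc j)) \<omega> - W (g N j) \<omega>)" for N j \<omega>
  define f where "f N j \<omega> = \<nu> \<omega> * Y (g N j) \<omega>" for N j \<omega>
  define z where "z N j \<omega> = euler_weight (\<lambda>i. x N i \<omega>) j" for N j \<omega>
  define S where "S N j \<omega> = J N (g N (Suc j)) \<omega> - J N (g N j) \<omega> - f N j \<omega> * (W (g N (Suc j)) \<omega> - W (g N j) \<omega>)" for N j \<omega>
  have fF: "f N j \<in> borel_measurable (F (g N j))" if "j < n N" for N j
    unfolding f_def using measurable_F_mono[OF nu g0(1)] Y[OF g0(1) gb] that by (intro borel_measurable_times) auto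
  have zF: "z N j \<in> borel_measurable (F (g N j))" for N j
  proof -
    have "x N i \<in> borel_measurable (F (g N j))" if "i < j" for i
      unfolding x_def using that
      by (intro borel_measurable_add borel_measurable_times borel_measurable_diff borel_measurable_const
          measurable_F_mono[OF mu g0(1)] measurable_F_mono[OF nu g0(1)] W_adapted' g0 gm) auto
    then show ?thesis
      unfolding z_def euler_weight_def
      by (intro borel_measurable_inverse borel_measurable_prod borel_measurable_add borel_measurable_const) auto
  qed
  have SM: "S N j \<in> borel_measurable M" if "j < n N" for N j
    unfolding S_def J_def
    by (intro borel_measurable_diff borel_measurable_times simple_integral_measurable sd g0 W_measurable
        measurable_from_F[OF fF[OF that]])
  have zM: "z N j \<in> borel_measurable M" for N j
    using zF measurable_from_F by blast
  define P where "P N Q1 Q2 \<longleftrightarrow> Q1 \<in> borel_measurable M \<and> Q2 \<in> borel_measurable M \<and>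
    (\<forall>\<omega>. 0 \<le> Q1 \<omega> \<and> 0 \<le> Q2 \<omega>) \<and>
    (\<forall>\<epsilon>>0. expectation (\<lambda>\<omega>. min 1 (\<Sum>j<n N. (S N j \<omega>)\<^sup>2)) \<le> prob {\<omega> \<in> space M. \<epsilon> < Q1 \<omega>} + \<epsilon>) \<and>
    (\<forall>\<epsilon>>0. expectation (\<lambda>\<omega>. min 1 ((\<Sum>j<n N. z N j \<omega> * S N j \<omega>)\<^sup>2)) \<le> prob {\<omega> \<in> space M. \<epsilon> < Q2 \<omega>} + \<epsilon>) \<and>
    (\<forall>\<omega> y H e \<eta>. continuous_on {t0..t1} y \<longrightarrow> (\<forall>x. t0 \<le> x \<and> x < t1 \<longrightarrow> H x = y x) \<longrightarrow> 0 \<le> e \<longrightarrow> 0 \<le> \<eta> \<longrightarrow>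
       (\<forall>j<n N. \<forall>x. g N j \<le> x \<and> x \<le> g N (Suc j) \<longrightarrow> \<bar>y x - f N j \<omega>\<bar> \<le> e) \<longrightarrow>
       (\<integral>\<^sup>+x\<in>{0..t1}. ennreal ((simple_process (k N) (p N) (c N) x \<omega> - H x)\<^sup>2) \<partial>lborel) \<le> ennreal \<eta> \<longrightarrow>
       Q1 \<omega> \<le> 2 * \<eta> + 2 * e\<^sup>2 * ?h) \<and>
    (\<forall>\<omega> C. (\<forall>j<n N. \<bar>z N j \<omega>\<bar> \<le> C) \<longrightarrow> Q2 \<omega> \<le> C\<^sup>2 * Q1 \<omega>)" for N Q1 Q2
  have "\<exists>Q1 Q2. P N Q1 Q2" for N
    unfolding P_def S_def J_def g_def
    by (rule euler_residual_bounds[OF ts n sd]) (use fF zF in \<open>auto simp: g_def\<close>)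
  then obtain Q1 Q2 where PQ: "\<And>N. P N (Q1 N) (Q2 N)" by metis
  have QM: "Q1 N \<in> borel_measurable M" "Q2 N \<in> borel_measurable M" and Q0: "0 \<le> Q1 N \<omega>" "0 \<le> Q2 N \<omega>" for N \<omega>
    using PQ[of N] unfolding P_def by blast+
  have Q1b: "Q1 N \<omega> \<le> 2 * \<eta> + 2 * d\<^sup>2 * ?h"
    if "continuous_on {t0..t1} y" "\<forall>x. t0 \<le> x \<and> x < t1 \<longrightarrow> Hp x = y x" "0 \<le> d" "0 \<le> \<eta>"
      "\<forall>j<n N. \<forall>x. g N j \<le> x \<and> x \<le> g N (Suc j) \<longrightarrow> \<bar>y x - f N j \<omega>\<bar> \<le> d"
      "(\<integral>\<^sup>+x\<in>{0..t1}. ennreal ((simple_process (k N) (p N) (c N) x \<omega> - Hp x)\<^sup>2) \<partial>lborel) \<le> ennreal \<eta>"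
    for N \<omega> y Hp d \<eta>
    using PQ[of N] that unfolding P_def by blast
  have Q2b: "Q2 N \<omega> \<le> C\<^sup>2 * Q1 N \<omega>" if "\<forall>j<n N. \<bar>z N j \<omega>\<bar> \<le> C" for N \<omega> C
    using PQ[of N] that unfolding P_def by blast
  have contW: "AE \<omega> in M. continuous_on {t0..t1} (\<lambda>t. W t \<omega>)"
  proof -
    have "AE \<omega> in M. continuous_on {0..} (\<lambda>t. W t \<omega>)" using bm by (simp add: brownian_motion_def)
    then show ?thesis by eventually_elim (rule continuous_on_subset, use ts in auto)
  qed
  have QV: "AE \<omega> in M. (\<lambda>N. \<Sum>j<n N. (W (g N (Suc j)) \<omega> - W (g N j) \<omega>)\<^sup>2) \<longlonglongrightarrow> ?h"
    using \<phi>0(2) unfolding g_def n_def .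
  have lims: "AE \<omega> in M. (\<lambda>N. Q1 N \<omega>) \<longlonglongrightarrow> 0 \<and> (\<lambda>N. Q2 N \<omega>) \<longlonglongrightarrow> 0"
    using cont contW H QV approx
  proof eventually_elim
    case (elim \<omega>)
    have H\<omega>: "\<forall>t. t0 \<le> t \<and> t < t1 \<longrightarrow> H t \<omega> = \<nu> \<omega> * Y t \<omega>" using elim(3) .
    have yc: "continuous_on {t0..t1} (\<lambda>t. \<nu> \<omega> * Y t \<omega>)" using elim(1) by (intro continuous_intros)
    have Q1: "(\<lambda>N. Q1 N \<omega>) \<longlonglongrightarrow> 0"
    proof (rule tendstoI)
      fix \<epsilon> :: real assume \<epsilon>: "0 < \<epsilon>"
      \<comment> \<open>This oscillation contributes \<open>\<epsilon> / 4\<close> to the bound on \<open>Q1\<close>.\<close>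
      define d where "d = sqrt (\<epsilon> / (8 * ?h))"
      have d: "0 < d" "2 * d\<^sup>2 * ?h = \<epsilon> / 4"
      proof -
        have "2 * (\<epsilon> / (8 * a)) * a = \<epsilon> / 4" if "0 < a" for a using that by simp
        moreover have "d\<^sup>2 = \<epsilon> / (8 * ?h)" unfolding d_def using \<epsilon> ts by (intro real_sqrt_pow2) simp
        ultimately show "2 * d\<^sup>2 * ?h = \<epsilon> / 4" using ts by (metis diff_gt_0_iff_gt)
        show "0 < d" unfolding d_def using \<epsilon> ts by simp
      qed
      have osc: "\<forall>\<^sub>F N in sequentially. \<forall>j<n N. \<forall>u. g N j \<le> u \<and> u \<le> g N (Suc j) \<longrightarrow> \<bar>\<nu> \<omega> * Y u \<omega> - \<nu> \<omega> * Y (g N j) \<omega>\<bar> \<le> d"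
        unfolding g_def by (rule grid_oscillation[OF ts(2) n nlim yc d(1)])
      have small: "\<forall>\<^sub>F N in sequentially. e N < \<epsilon> / 4" using elim \<epsilon> by (intro order_tendstoD(2)[OF \<open>e \<longlonglongrightarrow> 0\<close>]) auto
      show "\<forall>\<^sub>F N in sequentially. dist (Q1 N \<omega>) 0 < \<epsilon>"
        using osc small elim(5)
      proof eventually_elim
        case (elim N)
        have "Q1 N \<omega> \<le> 2 * (e N / real (n N)) + 2 * d\<^sup>2 * ?h"
          by (rule Q1b[OF yc H\<omega>])
            (use elim d(1) e[of N] n[of N] in \<open>auto simp: f_def\<close>)
        moreover have "e N / real (n N) \<le> e N" using e[of N] n[of N] by (simp add: field_simps)
        ultimately have "Q1 N \<omega> < \<epsilon>" using d(2) elim(2) \<epsilon> by linarith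
        then show ?case using Q0(1)[of N \<omega>] by simp
      qed
    qed
    note li = linear_increments[where \<mu>="\<mu> \<omega>" and \<nu>="\<nu> \<omega>", OF ts(2) n nlim elim(2) elim(4)[unfolded g_def]]
    have sq: "(\<lambda>N. \<Sum>j<n N. (x N j \<omega>)\<^sup>2) \<longlonglongrightarrow> (\<nu> \<omega>)\<^sup>2 * ?h" unfolding x_def g_def by (rule li(2))
    have half: "\<forall>\<^sub>F N in sequentially. \<forall>j<n N. \<bar>x N j \<omega>\<bar> \<le> 1/2" unfolding x_def g_def by (rule li(3)) simp
    have "\<exists>K. \<forall>N. \<forall>j\<le>n N. \<bar>\<Sum>i<j. x N i \<omega>\<bar> \<le> K" unfolding x_def g_def by (rule li(4))
    then obtain K where K: "\<And>N j. j \<le> n N \<Longrightarrow> \<bar>\<Sum>i<j. x N i \<omega>\<bar> \<le> K" by blast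
    define b where "b = (\<nu> \<omega>)\<^sup>2 * ?h + 1"
    define C where "C = exp (K + 2 * b)"
    have "\<forall>\<^sub>F N in sequentially. (\<Sum>j<n N. (x N j \<omega>)\<^sup>2) < b"
      using order_tendstoD(2)[OF sq, of b] by (simp add: b_def)
    with half have "\<forall>\<^sub>F N in sequentially. norm (Q2 N \<omega>) \<le> C\<^sup>2 * Q1 N \<omega>"
    proof eventually_elim
      case (elim N)
      have "\<bar>z N j \<omega>\<bar> \<le> C" if j: "j < n N" for j
      proof -
        have "(\<Sum>i<j. (x N i \<omega>)\<^sup>2) \<le> (\<Sum>i<n N. (x N i \<omega>)\<^sup>2)" using j by (intro sum_mono2) auto
        then have "(\<Sum>i<j. (x N i \<omega>)\<^sup>2) \<le> b" using elim by simp
        from euler_weight_bound[OF _ K this] elim(1) j show ?thesis by (auto simp: z_def C_def)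
      qed
      then have "Q2 N \<omega> \<le> C\<^sup>2 * Q1 N \<omega>" by (intro Q2b) auto
      then show ?case using Q0(2)[of N \<omega>] by simp
    qed
    moreover have "(\<lambda>N. C\<^sup>2 * Q1 N \<omega>) \<longlonglongrightarrow> 0" using tendsto_mult_right_zero[OF Q1] by simp
    ultimately have "(\<lambda>N. Q2 N \<omega>) \<longlonglongrightarrow> 0" by (rule Lim_null_comparison)
    with Q1 show ?case by simp
  qed
  have "\<exists>\<phi>. strict_mono \<phi> \<and> (AE \<omega> in M. (\<lambda>N. \<Sum>j<n (\<phi> N). (S (\<phi> N) j \<omega>)\<^sup>2) \<longlonglongrightarrow> 0)"
  proof (rule ae_null_subsequence[where U="\<lambda>N \<omega>. \<Sum>j<n N. (S N j \<omega>)\<^sup>2" and Q=Q1])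
    show "AE \<omega> in M. (\<lambda>N. Q1 N \<omega>) \<longlonglongrightarrow> 0" using lims by eventually_elim simp
    show "expectation (\<lambda>\<omega>. min 1 (\<Sum>j<n N. (S N j \<omega>)\<^sup>2)) \<le> prob {\<omega> \<in> space M. \<epsilon> < Q1 N \<omega>} + \<epsilon>" if "0 < \<epsilon>" for N \<epsilon>
      using PQ[of N] that unfolding P_def by blast
  qed (use SM QM in \<open>auto intro!: sum_nonneg borel_measurable_sum borel_measurable_power\<close>)
  then obtain \<phi>1 where \<phi>1: "strict_mono \<phi>1" "AE \<omega> in M. (\<lambda>N. \<Sum>j<n (\<phi>1 N). (S (\<phi>1 N) j \<omega>)\<^sup>2) \<longlonglongrightarrow> 0" by blast
  have "\<exists>\<phi>. strict_mono \<phi> \<and> (AE \<omega> in M. (\<lambda>N. (\<Sum>j<n (\<phi>1 (\<phi> N)). z (\<phi>1 (\<phi> N)) j \<omega> * S (\<phi>1 (\<phi> N)) j \<omega>)\<^sup>2) \<longlonglongrightarrow> 0)"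
  proof (rule ae_null_subsequence[where U="\<lambda>N \<omega>. (\<Sum>j<n (\<phi>1 N). z (\<phi>1 N) j \<omega> * S (\<phi>1 N) j \<omega>)\<^sup>2" and Q="\<lambda>N. Q2 (\<phi>1 N)"])
    show "AE \<omega> in M. (\<lambda>N. Q2 (\<phi>1 N) \<omega>) \<longlonglongrightarrow> 0"
      using lims
    proof eventually_elim
      case (elim \<omega>)
      then show ?case using LIMSEQ_subseq_LIMSEQ[OF conjunct2[OF elim] \<phi>1(1)] by (simp add: o_def)
    qed
    show "expectation (\<lambda>\<omega>. min 1 ((\<Sum>j<n (\<phi>1 N). z (\<phi>1 N) j \<omega> * S (\<phi>1 N) j \<omega>)\<^sup>2)) \<le> prob {\<omega> \<in> space M. \<epsilon> < Q2 (\<phi>1 N) \<omega>} + \<epsilon>"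
      if "0 < \<epsilon>" for N \<epsilon>
      using PQ[of "\<phi>1 N"] that unfolding P_def by blast
  qed (use SM QM zM in \<open>auto intro!: borel_measurable_sum borel_measurable_power borel_measurable_times\<close>)
  then obtain \<phi>2 where \<phi>2: "strict_mono \<phi>2"
    "AE \<omega> in M. (\<lambda>N. (\<Sum>j<n (\<phi>1 (\<phi>2 N)). z (\<phi>1 (\<phi>2 N)) j \<omega> * S (\<phi>1 (\<phi>2 N)) j \<omega>)\<^sup>2) \<longlonglongrightarrow> 0" by blast
  \<comment> \<open>Along this subsequence both the squares and the weighted sums of the residuals vanish almost surely.\<close>
  define \<theta> where "\<theta> N = \<phi>1 (\<phi>2 N)" for N
  have \<theta>: "strict_mono \<theta>" using strict_mono_o[OF \<phi>1(1) \<phi>2(1)] by (simp add: \<theta>_def[abs_def] o_def)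
  have \<theta>lim: "filterlim \<theta> at_top sequentially" by (rule filterlim_subseq[OF \<theta>])
  show ?thesis
    using cont contW eq QV approx \<phi>1(2) \<phi>2(2)
  proof eventually_elim
    case (elim \<omega>)
    have "filterlim (\<lambda>N. n (\<theta> N)) at_top sequentially" by (rule filterlim_compose[OF nlim \<theta>lim])
    moreover have "Y b \<omega> - Y a \<omega> = \<mu> \<omega> * integral {a..b} (\<lambda>t. Y t \<omega>) + (I b \<omega> - I a \<omega>)"
      if "t0 \<le> a" "a \<le> b" "b \<le> t1" for a b using elim(3) that by blast
    moreover have "(\<lambda>N. \<Sum>j<n (\<theta> N). (W (g (\<theta> N) (Suc j)) \<omega> - W (g (\<theta> N) j) \<omega>)\<^sup>2) \<longlonglongrightarrow> ?h"
      using LIMSEQ_subseq_LIMSEQ[OF elim(4) \<theta>] by (simp add: o_def)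
    moreover have "\<forall>\<^sub>F N in sequentially. \<forall>j\<le>n (\<theta> N). \<bar>J (\<theta> N) (g (\<theta> N) j) \<omega> - I (g (\<theta> N) j) \<omega>\<bar> \<le> e (\<theta> N) / real (n (\<theta> N))"
    proof -
      have "\<forall>\<^sub>F N in sequentially. \<forall>j\<le>n N. \<bar>J N (g N j) \<omega> - I (g N j) \<omega>\<bar> \<le> e N / real (n N)"
        using elim(5) by eventually_elim (auto simp: J_def)
      then show ?thesis using \<theta>lim unfolding filterlim_iff by blast
    qed
    moreover have "(\<lambda>N. e (\<theta> N)) \<longlonglongrightarrow> 0" using LIMSEQ_subseq_LIMSEQ[OF \<open>e \<longlonglongrightarrow> 0\<close> \<theta>] by (simp add: o_def)
    moreover have "(\<lambda>N. \<Sum>j<n (\<theta> N). (S (\<theta> N) j \<omega>)\<^sup>2) \<longlonglongrightarrow> 0"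
      using LIMSEQ_subseq_LIMSEQ[OF elim(6) \<phi>2(1)] by (simp add: o_def \<theta>_def)
    moreover have "(\<lambda>N. \<Sum>j<n (\<theta> N). z (\<theta> N) j \<omega> * S (\<theta> N) j \<omega>) \<longlonglongrightarrow> 0"
    proof -
      have "(\<lambda>N. sqrt ((\<Sum>j<n (\<theta> N). z (\<theta> N) j \<omega> * S (\<theta> N) j \<omega>)\<^sup>2)) \<longlonglongrightarrow> sqrt 0"
        using elim(7) by (intro tendsto_real_sqrt) (simp add: \<theta>_def)
      then show ?thesis by (simp add: tendsto_rabs_zero_iff)
    qed
    ultimately show ?case
      unfolding g_def S_def f_def z_def x_def
      by (intro linear_equation_path[where n="\<lambda>N. n (\<theta> N)" and J="\<lambda>N t. J (\<theta> N) t \<omega>" and I="\<lambda>t. I t \<omega>"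
            and e="\<lambda>N. e (\<theta> N)" and y="\<lambda>t. Y t \<omega>" and w="\<lambda>t. W t \<omega>", OF ts(2) n _ elim(1,2)])
  qed
qed

section \<open>The scheme at the grid times\<close>

text \<open>
  At time \<open>0\<close> every simple integral vanishes, and so does their limit.
\<close>

lemma ito_integral_zero:
  assumes "is_ito_integral M F W H I"
  shows "AE \<omega> in M. I 0 \<omega> = 0"
proof -
  have "\<exists>k p c. (\<forall>N. simple_data F (k N) (p N) (c N)) \<and>
    (AE \<omega> in M. \<forall>\<^sub>F N in sequentially.
       (\<integral>\<^sup>+s\<in>{0..0}. ennreal ((simple_process (k N) (p N) (c N) s \<omega> - H s \<omega>)\<^sup>2) \<partial>lborel) \<le> ennreal (1 / real (Suc N)) \<and>
       (\<forall>t\<in>{0}. \<bar>simple_integral W (k N) (p N) (c N) t \<omega> - I t \<omega>\<bar> \<le> 1 / real (Suc N)))"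
    (is "\<exists>k p c. _ \<and> (AE \<omega> in M. \<forall>\<^sub>F N in sequentially. ?close k p c \<omega> N)")
    by (rule ito_approximation[OF assms]) auto
  then obtain k p c where sd: "\<And>N. simple_data F (k N) (p N) (c N)"
    and ae: "AE \<omega> in M. \<forall>\<^sub>F N in sequentially. ?close k p c \<omega> N" by blast
  have zero: "simple_integral W (k N) (p N) (c N) 0 \<omega> = 0" for N \<omega>
  proof -
    have p0: "0 \<le> p N i" if "i \<le> k N" for i by (rule simple_data_nonneg[OF sd that])
    show ?thesis unfolding simple_integral_def
    proof (rule sum.neutral, rule ballI)
      fix i assume "i \<in> {..<k N}"
      then show "c N i \<omega> * (W (min (p N (Suc i)) 0) \<omega> - W (min (p N i) 0) \<omega>) = 0"
        using p0[of i] p0[of "Suc i"] by (simp add: min_absorb2)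
    qed
  qed
  show ?thesis
    using ae
  proof eventually_elim
    case (elim \<omega>)
    have "\<forall>\<^sub>F N in sequentially. \<bar>I 0 \<omega>\<bar> \<le> 1 / real (Suc N)"
      using elim by eventually_elim (simp add: zero)
    moreover have "(\<lambda>N. 1 / real (Suc N)) \<longlonglongrightarrow> 0" by (rule LIMSEQ_Suc[OF lim_1_over_n])
    ultimately have "\<bar>I 0 \<omega>\<bar> \<le> 0" by (intro tendsto_lowerbound[of _ 0]) auto
    then show ?case by simp
  qed
qed

lemma eta_on_step:
  assumes "0 < dt" "dt * real k \<le> t" "t < dt * real (Suc k)"
  shows "eta dt t = dt * real k"
proof -
  have "\<lfloor>t / dt\<rfloor> = int k"
    using assms by (intro floor_unique) (auto simp: field_simps)
  then show ?thesis by (simp add: eta_def)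
qed

text \<open>
  On each grid interval the process \<open>X - b0 \<delta>\<close> solves a linear equation, and \<open>b0 \<delta>\<close> grows from \<open>0\<close> to
  \<open>b0 dt\<close>.
\<close>

lemma exponential_euler_recursion:
  assumes dt: "0 < dt" and X: "exponential_euler_scheme M F W \<alpha> \<Sigma> b0 B1 B2 dt x0 X"
  shows "AE \<omega> in M. X 0 \<omega> = x0 \<and> (\<forall>k. X (dt * real (Suc k)) \<omega> = X (dt * real k) \<omega> *
     exp ((B1 - B2 * X (dt * real k) \<omega> powr (2 * (\<alpha> - 1)) - (\<Sigma> * X (dt * real k) \<omega> powr (\<alpha> - 1))\<^sup>2 / 2) * dt
        + \<Sigma> * X (dt * real k) \<omega> powr (\<alpha> - 1) * (W (dt * real (Suc k)) \<omega> - W (dt * real k) \<omega>)) + b0 * dt)" (is "AE \<omega> in M. _ \<and> (\<forall>k. ?P k \<omega>)")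
proof -
  define A where "A t \<omega> = (X t \<omega> - b0 * delta dt t) * (B1 - B2 * X (eta dt t) \<omega> powr (2 * (\<alpha> - 1))) + b0" for t \<omega>
  define H where "H t \<omega> = (X t \<omega> - b0 * delta dt t) * (\<Sigma> * X (eta dt t) \<omega> powr (\<alpha> - 1))" for t \<omega>
  have ito: "has_ito_differential M F W x0 X A H"
    using X unfolding exponential_euler_scheme_def A_def[abs_def] H_def[abs_def] .
  have XF: "X t \<in> borel_measurable (F t)" if "0 \<le> t" for t
    using ito that by (simp add: has_ito_differential_def)
  have Xc: "AE \<omega> in M. continuous_on {0..} (\<lambda>t. X t \<omega>)"
    using ito by (simp add: has_ito_differential_def)
  have Ai: "AE \<omega> in M. \<forall>t\<ge>0. set_integrable lborel {0..t} (\<lambda>s. A s \<omega>)"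
    using ito by (simp add: has_ito_differential_def)
  obtain I where I: "is_ito_integral M F W H I"
    and XI: "AE \<omega> in M. \<forall>t\<ge>0. X t \<omega> = x0 + (LBINT s:{0..t}. A s \<omega>) + I t \<omega>"
    using ito unfolding has_ito_differential_def by blast
  have eqX: "AE \<omega> in M. \<forall>t\<ge>0. (\<lambda>s. A s \<omega>) integrable_on {0..t} \<and> X t \<omega> = x0 + integral {0..t} (\<lambda>s. A s \<omega>) + I t \<omega>"
    using XI Ai
  proof eventually_elim
    case (elim \<omega>)
    then show ?case using set_borel_integral_eq_integral[of "{0.._}" "\<lambda>s. A s \<omega>"] by auto
  qed
  have start: "AE \<omega> in M. X 0 \<omega> = x0"
    using eqX ito_integral_zero[OF I]
  proof eventually_elim
    case (elim \<omega>)
    then have "X 0 \<omega> = x0 + integral {0..0} (\<lambda>s. A s \<omega>) + I 0 \<omega>" by blast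
    then show ?case using elim(2) by simp
  qed
  have "AE \<omega> in M. ?P k \<omega>" for k
  proof -
    define t0 where "t0 = dt * real k"
    define t1 where "t1 = dt * real (Suc k)"
    have t: "0 \<le> t0" "t0 < t1" "t1 - t0 = dt" using dt by (auto simp: t0_def t1_def algebra_simps)
    define \<mu> where "\<mu> \<omega> = B1 - B2 * X t0 \<omega> powr (2 * (\<alpha> - 1))" for \<omega>
    define \<nu> where "\<nu> \<omega> = \<Sigma> * X t0 \<omega> powr (\<alpha> - 1)" for \<omega>
    define Y where "Y t \<omega> = X t \<omega> - b0 * (t - t0)" for t \<omega>
    have eta: "eta dt s = t0" if "t0 \<le> s" "s < t1" for s
      using eta_on_step[OF dt] that by (simp add: t0_def t1_def)
    have AY: "A s \<omega> = \<mu> \<omega> * Y s \<omega> + b0" and HY: "H s \<omega> = \<nu> \<omega> * Y s \<omega>" if "t0 \<le> s" "s < t1" for s \<omega>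
      unfolding A_def H_def \<mu>_def \<nu>_def Y_def delta_def eta[OF that] by simp_all
    have X0: "X t0 \<in> borel_measurable (F t0)" using XF t by simp
    have cont: "AE \<omega> in M. continuous_on {t0..t1} (\<lambda>t. Y t \<omega>)"
      using Xc
    proof eventually_elim
      case (elim \<omega>)
      have "continuous_on {t0..t1} (\<lambda>t. X t \<omega>)" by (rule continuous_on_subset[OF elim]) (use t in auto)
      then show ?case unfolding Y_def by (intro continuous_intros)
    qed
    have "AE \<omega> in M. Y t1 \<omega> = Y t0 \<omega> * exp ((\<mu> \<omega> - (\<nu> \<omega>)\<^sup>2 / 2) * (t1 - t0) + \<nu> \<omega> * (W t1 \<omega> - W t0 \<omega>))"
    proof (rule linear_sde_explicit[OF t(1,2) I _ _ _ cont])
      show "\<mu> \<in> borel_measurable (F t0)" "\<nu> \<in> borel_measurable (F t0)"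
        unfolding \<mu>_def \<nu>_def using X0 by measurable
      show "Y t \<in> borel_measurable (F t)" if "t0 \<le> t" for t
        unfolding Y_def using XF[of t] t that by (intro borel_measurable_diff) auto
      show "AE \<omega> in M. \<forall>t'. t0 \<le> t' \<and> t' < t1 \<longrightarrow> H t' \<omega> = \<nu> \<omega> * Y t' \<omega>" using HY by simp
      show "AE \<omega> in M. \<forall>a b. t0 \<le> a \<and> a \<le> b \<and> b \<le> t1 \<longrightarrow> Y b \<omega> - Y a \<omega> = \<mu> \<omega> * integral {a..b} (\<lambda>s. Y s \<omega>) + (I b \<omega> - I a \<omega>)"
        using eqX cont
      proof eventually_elim
        case (elim \<omega>)
        show ?case
        proof (intro allI impI)
          fix a b assume ab: "t0 \<le> a \<and> a \<le> b \<and> b \<le> t1"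
          have \<mu>Yi: "(\<lambda>s. \<mu> \<omega> * Y s \<omega>) integrable_on {a..b}"
            by (rule integrable_continuous_real, rule continuous_on_mult_left, rule continuous_on_subset[OF elim(2)]) (use ab in auto)
          have b: "(\<lambda>s. A s \<omega>) integrable_on {0..b}" "X b \<omega> = x0 + integral {0..b} (\<lambda>s. A s \<omega>) + I b \<omega>"
            and a: "X a \<omega> = x0 + integral {0..a} (\<lambda>s. A s \<omega>) + I a \<omega>"
            using elim(1) ab t by auto
          have "integral {0..a} (\<lambda>s. A s \<omega>) + integral {a..b} (\<lambda>s. A s \<omega>) = integral {0..b} (\<lambda>s. A s \<omega>)"
            using ab t b(1) by (intro Henstock_Kurzweil_Integration.integral_combine) auto
          \<comment> \<open>At \<open>b = t1\<close> the coefficients are already those of the next grid interval.\<close>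
          moreover have "integral {a..b} (\<lambda>s. A s \<omega>) = integral {a..b} (\<lambda>s. \<mu> \<omega> * Y s \<omega> + b0)"
            by (rule integral_spike[of "{b}"]) (use AY ab in auto)
          moreover have "integral {a..b} (\<lambda>s. \<mu> \<omega> * Y s \<omega> + b0) = \<mu> \<omega> * integral {a..b} (\<lambda>s. Y s \<omega>) + b0 * (b - a)"
            using \<mu>Yi ab by (subst Henstock_Kurzweil_Integration.integral_add) auto
          ultimately show "Y b \<omega> - Y a \<omega> = \<mu> \<omega> * integral {a..b} (\<lambda>s. Y s \<omega>) + (I b \<omega> - I a \<omega>)"
            using a b(2) unfolding Y_def by (simp add: algebra_simps)
        qed
      qed
    qed
    then show ?thesis
    proof eventually_elim
      case (elim \<omega>)
      then show ?case unfolding t(3) by (simp add: Y_def \<mu>_def \<nu>_def t0_def[symmetric] t1_def[symmetric] t(3) del: of_nat_Suc)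
    qed
  qed
  then have "AE \<omega> in M. \<forall>k. ?P k \<omega>"
    unfolding AE_all_countable by (rule allI)
  with start show ?thesis by eventually_elim blast
qed

lemma exponential_euler_positive_recursion:
  assumes dt: "0 < dt" and x0: "0 < x0" and b0: "0 \<le> b0"
    and X: "exponential_euler_scheme M F W \<alpha> \<Sigma> b0 B1 B2 dt x0 X"
  shows "AE \<omega> in M. \<forall>k. 0 < X (dt * real k) \<omega> \<and>
     X (dt * real (Suc k)) \<omega> = X (dt * real k) \<omega> *
     exp ((B1 - (B2 + \<Sigma>\<^sup>2 / 2) * X (dt * real k) \<omega> powr (2 * (\<alpha> - 1))) * dt
        + \<Sigma> * X (dt * real k) \<omega> powr (\<alpha> - 1) * (W (dt * real (Suc k)) \<omega> - W (dt * real k) \<omega>)) + b0 * dt"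
  using exponential_euler_recursion[OF dt X]
proof eventually_elim
  case (elim \<omega>)
  have pos: "0 < X (dt * real k) \<omega>" for k
  proof (induction k)
    case 0 then show ?case using elim x0 by simp
  next
    case (Suc k)
    show ?case using elim Suc b0 dt by (simp add: add_pos_nonneg del: of_nat_Suc)
  qed
  have sq: "(\<Sigma> * X (dt * real k) \<omega> powr (\<alpha> - 1))\<^sup>2 = \<Sigma>\<^sup>2 * X (dt * real k) \<omega> powr (2 * (\<alpha> - 1))" for k
    using pos[of k] by (simp add: power_mult_distrib power2_eq_square powr_add[symmetric])
  have "B1 - B2 * u - \<Sigma>\<^sup>2 * u / 2 = B1 - (B2 + \<Sigma>\<^sup>2 / 2) * u" for u by (simp add: algebra_simps)
  then show ?case using elim pos unfolding sq by simp
qed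

section \<open>Leaving a region infinitely often\<close>

text \<open>
  Killed at its first exit from \<open>D\<close> after step \<open>K\<close>, the process \<open>exp (\<kappa> n) V\<close> is a supermartingale. The
  mean of \<open>V\<close> over the event of no exit therefore decays exponentially, while \<open>V\<close> is bounded below by
  \<open>v\<close> on \<open>D\<close>. The mean is finite at the start because the event is cut down to \<open>V (x K) \<le> R\<close>, and
  afterwards \<open>R\<close> runs through the natural numbers.
\<close>

lemma ae_exit_infinitely_often:
  fixes x :: "nat \<Rightarrow> 'a \<Rightarrow> real" and D :: "real set" and V S :: "real \<Rightarrow> real"
  assumes dt: "0 < dt" and x: "\<And>k. x k \<in> borel_measurable (F (dt * real k))"
    and D: "D \<in> sets borel" and V: "V \<in> borel_measurable borel" and S: "S \<in> borel_measurable borel"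
    and v: "0 < v" "\<And>y. y \<in> D \<Longrightarrow> v \<le> V y" and \<kappa>: "0 < \<kappa>"
    and step: "AE \<omega> in M. \<forall>k. x k \<omega> \<in> D \<longrightarrow> x (Suc k) \<omega> \<in> D \<longrightarrow>
       V (x (Suc k) \<omega>) \<le> V (x k \<omega>) * exp (- \<kappa> + S (x k \<omega>) * (W (dt * real (Suc k)) \<omega> - W (dt * real k) \<omega>) - (S (x k \<omega>))\<^sup>2 * dt / 2)"
  shows "AE \<omega> in M. \<forall>K. \<exists>k\<ge>K. x k \<omega> \<notin> D"
proof -
  define A where "A K R n = {\<omega> \<in> space M. V (x K \<omega>) \<le> real R \<and> (\<forall>j\<le>n. x (K + j) \<omega> \<in> D)}" for K R n :: nat
  have mono: "dt * real i \<le> dt * real j" if "i \<le> j" for i j using that dt by simp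
  have xF: "x i \<in> borel_measurable (F (dt * real j))" if "i \<le> j" for i j
    using measurable_F_mono[OF x mono[OF that]] .
  have AF: "A K R n \<in> sets (F (dt * real (K + n)))" for K R n
  proof -
    have [measurable]: "D \<in> sets borel" "V \<in> borel_measurable borel" using D V by auto
    have "Measurable.pred (F (dt * real (K + n))) (\<lambda>\<omega>. V (x K \<omega>) \<le> real R)"
      using measurable_compose[OF xF[of K "K + n"] V] by measurable
    moreover have "Measurable.pred (F (dt * real (K + n))) (\<lambda>\<omega>. x (K + j) \<omega> \<in> D)" if "j \<le> n" for j
    proof -
      have [measurable]: "x (K + j) \<in> borel_measurable (F (dt * real (K + n)))"
        by (rule xF) (use that in simp)
      show ?thesis by measurable
    qed
    ultimately have "Measurable.pred (F (dt * real (K + n))) (\<lambda>\<omega>. V (x K \<omega>) \<le> real R \<and> (\<forall>j\<in>{..n}. x (K + j) \<omega> \<in> D))"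
      by (intro pred_intros_logic pred_intros_finite) auto
    then show ?thesis by (simp add: A_def pred_def Ball_def)
  qed
  have AM: "A K R n \<in> events" for K R n using AF sets_F_subset by blast
  define a where "a K R n = (\<integral>\<^sup>+\<omega>. indicator (A K R n) \<omega> * ennreal (V (x (K + n) \<omega>)) \<partial>M)" for K R n :: nat
  have a_bound: "a K R n \<le> ennreal (exp (- \<kappa> * real n) * real R)" for K R n
  proof (induction n)
    case 0
    have "a K R 0 \<le> (\<integral>\<^sup>+\<omega>. ennreal (real R) \<partial>M)"
      unfolding a_def by (intro nn_integral_mono) (auto simp: A_def indicator_def intro!: ennreal_leI)
    then show ?case by (simp add: emeasure_space_1)
  next
    case (Suc n)
    let ?t = "dt * real (K + n)" and ?t' = "dt * real (Suc (K + n))"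
    let ?U = "\<lambda>\<omega>. indicator (A K R n) \<omega> * ennreal (V (x (K + n) \<omega>))"
    let ?X = "\<lambda>\<omega>. S (x (K + n) \<omega>)"
    have t: "0 \<le> ?t" "?t < ?t'" "?t' - ?t = dt" using dt by (auto simp: algebra_simps)
    have UF: "?U \<in> borel_measurable (F ?t)"
      using AF[of K R n] measurable_compose[OF x[of "K + n"] V] by measurable
    have XF: "?X \<in> borel_measurable (F ?t)"
      using measurable_compose[OF x[of "K + n"] S] by simp
    have "a K R (Suc n) \<le> (\<integral>\<^sup>+\<omega>. ennreal (exp (- \<kappa>)) * (?U \<omega> * ennreal (exp (?X \<omega> * (W ?t' \<omega> - W ?t \<omega>) - (?X \<omega>)\<^sup>2 * (?t' - ?t) / 2))) \<partial>M)"
      unfolding a_def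
    proof (rule nn_integral_mono_AE)
      show "AE \<omega> in M. indicator (A K R (Suc n)) \<omega> * ennreal (V (x (K + Suc n) \<omega>))
        \<le> ennreal (exp (- \<kappa>)) * (?U \<omega> * ennreal (exp (?X \<omega> * (W ?t' \<omega> - W ?t \<omega>) - (?X \<omega>)\<^sup>2 * (?t' - ?t) / 2)))"
        using step
      proof eventually_elim
        case (elim \<omega>)
        show ?case
        proof (cases "\<omega> \<in> A K R (Suc n)")
          case True
          then have in1: "\<omega> \<in> A K R n" and inD: "x (K + n) \<omega> \<in> D" "x (Suc (K + n)) \<omega> \<in> D"
            by (auto simp: A_def)
          have V0: "0 \<le> V (x (K + n) \<omega>)" using v(1) v(2)[OF inD(1)] by linarith
          have "V (x (Suc (K + n)) \<omega>) \<le> V (x (K + n) \<omega>) * exp (- \<kappa> + ?X \<omega> * (W ?t' \<omega> - W ?t \<omega>) - (?X \<omega>)\<^sup>2 * dt / 2)"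
            using elim inD by blast
          also have "\<dots> = exp (- \<kappa>) * (V (x (K + n) \<omega>) * exp (?X \<omega> * (W ?t' \<omega> - W ?t \<omega>) - (?X \<omega>)\<^sup>2 * dt / 2))"
            by (simp add: exp_add[symmetric] exp_diff exp_minus field_simps)
          finally have "ennreal (V (x (Suc (K + n)) \<omega>)) \<le> ennreal (exp (- \<kappa>) * (V (x (K + n) \<omega>) * exp (?X \<omega> * (W ?t' \<omega> - W ?t \<omega>) - (?X \<omega>)\<^sup>2 * dt / 2)))"
            by (rule ennreal_leI)
          also have "\<dots> = ennreal (exp (- \<kappa>)) * (ennreal (V (x (K + n) \<omega>)) * ennreal (exp (?X \<omega> * (W ?t' \<omega> - W ?t \<omega>) - (?X \<omega>)\<^sup>2 * dt / 2)))"
            using V0 by (simp add: ennreal_mult)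
          finally show ?thesis using True in1 unfolding t(3) by simp
        qed simp
      qed
    qed
    also have "\<dots> = ennreal (exp (- \<kappa>)) * (\<integral>\<^sup>+\<omega>. ?U \<omega> * ennreal (exp (?X \<omega> * (W ?t' \<omega> - W ?t \<omega>) - (?X \<omega>)\<^sup>2 * (?t' - ?t) / 2)) \<partial>M)"
    proof (rule nn_integral_cmult)
      have "(\<lambda>\<omega>. U \<omega> * ennreal (exp (Y \<omega> * (b \<omega> - c \<omega>) - (Y \<omega>)\<^sup>2 * h / 2))) \<in> borel_measurable M"
        if [measurable]: "U \<in> borel_measurable M" "Y \<in> borel_measurable M" "b \<in> borel_measurable M" "c \<in> borel_measurable M"
        for U :: "'a \<Rightarrow> ennreal" and Y b c :: "'a \<Rightarrow> real" and h
        by measurable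
      from this[OF measurable_from_F[OF UF] measurable_from_F[OF XF] W_measurable[of ?t'] W_measurable[of ?t]]
      show "(\<lambda>\<omega>. ?U \<omega> * ennreal (exp (?X \<omega> * (W ?t' \<omega> - W ?t \<omega>) - (?X \<omega>)\<^sup>2 * (?t' - ?t) / 2))) \<in> borel_measurable M"
        using t by simp
    qed
    also have "(\<integral>\<^sup>+\<omega>. ?U \<omega> * ennreal (exp (?X \<omega> * (W ?t' \<omega> - W ?t \<omega>) - (?X \<omega>)\<^sup>2 * (?t' - ?t) / 2)) \<partial>M) = a K R n"
      unfolding a_def by (rule exponential_martingale_step[OF t(1,2) UF XF])
    also have "ennreal (exp (- \<kappa>)) * a K R n \<le> ennreal (exp (- \<kappa>)) * ennreal (exp (- \<kappa> * real n) * real R)"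
      by (intro mult_left_mono Suc) auto
    also have "\<dots> = ennreal (exp (- \<kappa> * real (Suc n)) * real R)"
      by (simp add: ennreal_mult[symmetric] mult_exp_exp algebra_simps flip: mult.assoc)
    finally show ?case .
  qed
  have null: "prob (\<Inter>n. A K R n) = 0" for K R
  proof -
    let ?B = "\<Inter>n. A K R n"
    have BM: "?B \<in> events" using AM by blast
    have le: "v * prob ?B \<le> exp (- \<kappa> * real n) * real R" for n
    proof -
      have "ennreal v * emeasure M ?B = (\<integral>\<^sup>+\<omega>. ennreal v * indicator ?B \<omega> \<partial>M)"
        using BM by (simp add: nn_integral_cmult_indicator)
      also have "\<dots> \<le> a K R n"
        unfolding a_def
      proof (intro nn_integral_mono)
        fix \<omega>
        show "ennreal v * indicator ?B \<omega> \<le> indicator (A K R n) \<omega> * ennreal (V (x (K + n) \<omega>))"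
        proof (cases "\<omega> \<in> ?B")
          case True
          then have "\<omega> \<in> A K R n" by blast
          then have "x (K + n) \<omega> \<in> D" by (simp add: A_def)
          from ennreal_leI[OF v(2)[OF this]] show ?thesis using True \<open>\<omega> \<in> A K R n\<close> by simp
        qed simp
      qed
      also have "\<dots> \<le> ennreal (exp (- \<kappa> * real n) * real R)" by (rule a_bound)
      finally have "ennreal (v * prob ?B) \<le> ennreal (exp (- \<kappa> * real n) * real R)"
        using v(1) by (simp add: emeasure_eq_measure ennreal_mult)
      then show ?thesis by (subst (asm) ennreal_le_iff) auto
    qed
    have "(\<lambda>n. exp (- \<kappa>) ^ n * real R) \<longlonglongrightarrow> 0 * real R"
      using \<kappa> by (intro tendsto_intros LIMSEQ_realpow_zero) auto
    then have "(\<lambda>n. exp (- \<kappa> * real n) * real R) \<longlonglongrightarrow> 0"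
      by (simp add: exp_of_nat_mult[symmetric] mult.commute)
    then have "v * prob ?B \<le> 0" using le by (intro LIMSEQ_le_const) auto
    then have "prob ?B \<le> 0" using v(1) by (simp add: mult_le_0_iff)
    then show ?thesis using measure_nonneg[of M ?B] by linarith
  qed
  have "AE \<omega> in M. \<forall>K R. \<omega> \<notin> (\<Inter>n. A K R n)"
  proof (unfold AE_all_countable, intro allI)
    fix K R
    have "(\<Inter>n. A K R n) \<in> null_sets M"
      using null[of K R] AM by (intro null_setsI) (auto simp: emeasure_eq_measure)
    then show "AE \<omega> in M. \<omega> \<notin> (\<Inter>n. A K R n)" by (rule AE_not_in)
  qed
  with AE_space show ?thesis
  proof eventually_elim
    case (elim \<omega>)
    show ?case
    proof (intro allI, rule ccontr)
      fix K assume "\<not> (\<exists>k\<ge>K. x k \<omega> \<notin> D)"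
      then have inD: "x (K + j) \<omega> \<in> D" for j by simp
      obtain R :: nat where "V (x K \<omega>) \<le> real R" using real_arch_simple by blast
      then have "\<omega> \<in> (\<Inter>n. A K R n)" using elim inD by (auto simp: A_def)
      then show False using elim by blast
    qed
  qed
qed

end

lemma Limsup_ge_of_frequently:
  fixes X :: "real \<Rightarrow> real" and a :: "nat \<Rightarrow> real"
  assumes a: "a \<longlonglongrightarrow> \<xi>" and freq: "\<And>i T. \<exists>t\<ge>T. a i \<le> X t"
  shows "ereal \<xi> \<le> Limsup at_top (\<lambda>t. ereal (X t))"
proof (rule LIMSEQ_le_const2)
  show "(\<lambda>i. ereal (a i)) \<longlonglongrightarrow> ereal \<xi>" using a by simp
  have "ereal (a i) \<le> Limsup at_top (\<lambda>t. ereal (X t))" for i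
  proof (rule ccontr)
    assume "\<not> ereal (a i) \<le> Limsup at_top (\<lambda>t. ereal (X t))"
    then have "\<forall>\<^sub>F t in at_top. ereal (X t) < ereal (a i)" by (intro Limsup_lessD) simp
    then obtain T where "\<And>t. t \<ge> T \<Longrightarrow> X t < a i" by (auto simp: eventually_at_top_linorder)
    then show False using freq[of T i] by force
  qed
  then show "\<exists>N. \<forall>i\<ge>N. ereal (a i) \<le> Limsup at_top (\<lambda>t. ereal (X t))" by blast
qed

lemma Liminf_le_of_frequently:
  fixes X :: "real \<Rightarrow> real" and a :: "nat \<Rightarrow> real"
  assumes a: "a \<longlonglongrightarrow> \<xi>" and freq: "\<And>i T. \<exists>t\<ge>T. X t \<le> a i"
  shows "Liminf at_top (\<lambda>t. ereal (X t)) \<le> ereal \<xi>"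
proof (rule LIMSEQ_le_const)
  show "(\<lambda>i. ereal (a i)) \<longlonglongrightarrow> ereal \<xi>" using a by simp
  have "Liminf at_top (\<lambda>t. ereal (X t)) \<le> ereal (a i)" for i
  proof (rule ccontr)
    assume "\<not> Liminf at_top (\<lambda>t. ereal (X t)) \<le> ereal (a i)"
    then have "\<forall>\<^sub>F t in at_top. ereal (a i) < ereal (X t)" by (intro less_LiminfD) simp
    then obtain T where "\<And>t. t \<ge> T \<Longrightarrow> a i < X t" by (auto simp: eventually_at_top_linorder)
    then show False using freq[of T i] by force
  qed
  then show "\<exists>N. \<forall>i\<ge>N. Liminf at_top (\<lambda>t. ereal (X t)) \<le> ereal (a i)" by blast
qed

lemma frequently_of_grid:
  fixes X :: "real \<Rightarrow> real"
  assumes dt: "0 < dt" and P: "\<forall>K. \<exists>k\<ge>K. P (X (dt * real k))"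
  shows "\<exists>t\<ge>T. P (X t)"
proof -
  obtain K where K: "T / dt \<le> real K" using real_arch_simple by blast
  obtain k where k: "K \<le> k" "P (X (dt * real k))" using P by blast
  have "T \<le> dt * real K" using K dt by (simp add: pos_divide_le_eq mult.commute)
  also have "\<dots> \<le> dt * real k" using k(1) dt by simp
  finally show ?thesis using k(2) by blast
qed

lemma positive_zero_eq:
  assumes "0 < \<xi>" "\<And>x. 0 < x \<Longrightarrow> f x = 0 \<longleftrightarrow> x = \<xi>"
  shows "positive_zero f = \<xi>"
  unfolding positive_zero_def using assms by (intro the_equality) auto

theorem proposition3p10:
  fixes M :: "'a measure"
    and F :: "real \<Rightarrow> 'a measure"
    and W X :: "real \<Rightarrow> 'a \<Rightarrow> real"
    and \<alpha> \<Sigma> b0 B1 B2 dt x0 :: real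
  assumes W: "brownian_motion M F W"
    and alpha: "1 < \<alpha>"
    and Sigma: "0 < \<Sigma>"
    and x0: "0 < x0"
    and b0: "0 \<le> b0"
    and B1: "0 \<le> B1"
    and B2: "0 < B2"
    and nondegenerate: "0 < b0 \<or> 0 < B1"
    and growth: "2 * (\<alpha> - 1) \<le> 1 + 2 * (B2 / \<Sigma>\<^sup>2)"
    and dt: "0 < dt"
    and dt_le: "0 < B1 \<longrightarrow> dt \<le> 1 / B1"
    and X: "exponential_euler_scheme M F W \<alpha> \<Sigma> b0 B1 B2 dt x0 X"
  shows "(\<exists>!x. 0 < x \<and> phi_lower \<alpha> \<Sigma> b0 B1 B2 dt x = 0) \<and>
    (\<exists>!x. 0 < x \<and> phi_upper \<alpha> \<Sigma> b0 B1 B2 dt x = 0) \<and>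
    (AE \<omega> in M.
       Liminf at_top (\<lambda>t. ereal (X t \<omega>)) \<le> ereal (positive_zero (phi_lower \<alpha> \<Sigma> b0 B1 B2 dt)) \<and>
       ereal (positive_zero (phi_upper \<alpha> \<Sigma> b0 B1 B2 dt)) \<le> Limsup at_top (\<lambda>t. ereal (X t \<omega>)))"
proof -
  interpret brownian M F W using W by unfold_locales
  let ?fl = "phi_lower \<alpha> \<Sigma> b0 B1 B2 dt" and ?fu = "phi_upper \<alpha> \<Sigma> b0 B1 B2 dt"
  obtain \<xi>l where \<xi>l: "0 < \<xi>l" "\<And>x. 0 < x \<Longrightarrow> ?fl x = 0 \<longleftrightarrow> x = \<xi>l" "\<And>x. 0 < x \<Longrightarrow> 0 < ?fl x \<longleftrightarrow> x < \<xi>l"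
    using phi_zeros(1)[OF alpha b0 B1 B2 nondegenerate dt dt_le] by blast
  obtain \<xi>u where \<xi>u: "0 < \<xi>u" "\<And>x. 0 < x \<Longrightarrow> ?fu x = 0 \<longleftrightarrow> x = \<xi>u" "\<And>x. 0 < x \<Longrightarrow> 0 < ?fu x \<longleftrightarrow> x < \<xi>u"
    using phi_zeros(2)[OF alpha b0 B1 B2 nondegenerate dt dt_le] by blast
  have zl: "positive_zero ?fl = \<xi>l" and zu: "positive_zero ?fu = \<xi>u"
    using \<xi>l \<xi>u by (auto intro!: positive_zero_eq)
  define x where "x k = X (dt * real k)" for k
  have XF: "x k \<in> borel_measurable (F (dt * real k))" for k
    using X dt unfolding exponential_euler_scheme_def has_ito_differential_def x_def by simp
  let ?d = "\<lambda>k \<omega>. W (dt * real (Suc k)) \<omega> - W (dt * real k) \<omega>"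
  define m where "m y = (B1 - (B2 + \<Sigma>\<^sup>2 / 2) * y powr (2 * (\<alpha> - 1))) * dt" for y
  have rec: "AE \<omega> in M. \<forall>k. 0 < x k \<omega> \<and> x (Suc k) \<omega> = x k \<omega> *
     exp (m (x k \<omega>) + \<Sigma> * x k \<omega> powr (\<alpha> - 1) * (?d k \<omega>)) + b0 * dt"
    using exponential_euler_positive_recursion[OF dt x0 b0 X] unfolding x_def m_def .
  have lower: "AE \<omega> in M. \<forall>K. \<exists>k\<ge>K. x k \<omega> \<notin> {a..}" if a: "\<xi>l < a" for a
  proof -
    have a0: "0 < a" using a \<xi>l by simp
    then have "?fl a < 0" using \<xi>l(2,3)[of a] a by linarith
    from power_decay_above_lower_zero[OF alpha Sigma b0 B1 B2 dt a0 this]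
    obtain p \<kappa> where p: "0 < p" "0 < \<kappa>" and step: "\<And>y D. a \<le> y \<Longrightarrow> a \<le> y * exp (m y + \<Sigma> * y powr (\<alpha> - 1) * D) + b0 * dt \<Longrightarrow>
      (y * exp (m y + \<Sigma> * y powr (\<alpha> - 1) * D) + b0 * dt) powr p
        \<le> y powr p * exp (- \<kappa> + (p * \<Sigma> * y powr (\<alpha> - 1)) * D - (p * \<Sigma> * y powr (\<alpha> - 1))\<^sup>2 * dt / 2)"
      unfolding m_def by blast
    show ?thesis
    proof (rule ae_exit_infinitely_often[where V="\<lambda>y. y powr p" and S="\<lambda>y. p * \<Sigma> * y powr (\<alpha> - 1)", OF dt XF])
      show "0 < a powr p" using a0 by simp
      show "a powr p \<le> y powr p" if "y \<in> {a..}" for y using that a0 p by (auto intro: powr_mono2)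
      show "0 < \<kappa>" by (rule p)
      show "AE \<omega> in M. \<forall>k. x k \<omega> \<in> {a..} \<longrightarrow> x (Suc k) \<omega> \<in> {a..} \<longrightarrow> x (Suc k) \<omega> powr p
         \<le> x k \<omega> powr p * exp (- \<kappa> + p * \<Sigma> * x k \<omega> powr (\<alpha> - 1) * (?d k \<omega>) - (p * \<Sigma> * x k \<omega> powr (\<alpha> - 1))\<^sup>2 * dt / 2)"
        (is "AE \<omega> in M. \<forall>k. _ \<longrightarrow> _ \<longrightarrow> ?P k \<omega>")
        using rec
      proof eventually_elim
        case (elim \<omega>)
        show ?case
        proof (intro allI impI)
          fix k assume "x k \<omega> \<in> {a..}" "x (Suc k) \<omega> \<in> {a..}"
          with step[of "x k \<omega>" "?d k \<omega>"] elim
          show "?P k \<omega>"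
            by (metis atLeast_iff)
        qed
      qed
    qed measurable
  qed
  have upper: "AE \<omega> in M. \<forall>K. \<exists>k\<ge>K. x k \<omega> \<notin> {0<..a}" if a: "0 < a" "a < \<xi>u" for a
  proof -
    define l where "l y = exp (m y) / (exp (m y) + b0 * dt / y)" for y
    have "0 < ?fu a" using \<xi>u(3) a by blast
    from negative_power_decay_below_upper_zero[OF alpha Sigma b0 B1 B2 dt dt_le a(1) this]
    obtain p \<kappa> where p: "0 < p" "0 < \<kappa>" and step: "\<And>y D. 0 < y \<Longrightarrow> y \<le> a \<Longrightarrow>
      (y * exp (m y + \<Sigma> * y powr (\<alpha> - 1) * D) + b0 * dt) powr - p
        \<le> y powr - p * exp (- \<kappa> + (- p * l y * \<Sigma> * y powr (\<alpha> - 1)) * D - (- p * l y * \<Sigma> * y powr (\<alpha> - 1))\<^sup>2 * dt / 2)"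
      unfolding m_def l_def by blast
    show ?thesis
    proof (rule ae_exit_infinitely_often[where V="\<lambda>y. y powr - p" and S="\<lambda>y. - p * l y * \<Sigma> * y powr (\<alpha> - 1)", OF dt XF])
      show "0 < a powr - p" using a by simp
      show "a powr - p \<le> y powr - p" if "y \<in> {0<..a}" for y using that a p by (auto intro: powr_mono2')
      show "0 < \<kappa>" by (rule p)
      show "(\<lambda>y. - p * l y * \<Sigma> * y powr (\<alpha> - 1)) \<in> borel_measurable borel"
        unfolding l_def m_def by measurable
      show "AE \<omega> in M. \<forall>k. x k \<omega> \<in> {0<..a} \<longrightarrow> x (Suc k) \<omega> \<in> {0<..a} \<longrightarrow> x (Suc k) \<omega> powr - p
         \<le> x k \<omega> powr - p * exp (- \<kappa> + (- p * l (x k \<omega>) * \<Sigma> * x k \<omega> powr (\<alpha> - 1)) * (?d k \<omega>) - (- p * l (x k \<omega>) * \<Sigma> * x k \<omega> powr (\<alpha> - 1))\<^sup>2 * dt / 2)"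
        (is "AE \<omega> in M. \<forall>k. _ \<longrightarrow> _ \<longrightarrow> ?P k \<omega>")
        using rec
      proof eventually_elim
        case (elim \<omega>)
        show ?case
        proof (intro allI impI)
          fix k assume "x k \<omega> \<in> {0<..a}" "x (Suc k) \<omega> \<in> {0<..a}"
          with step[of "x k \<omega>" "?d k \<omega>"] elim
          show "?P k \<omega>"
            by (metis greaterThanAtMost_iff)
        qed
      qed
    qed measurable
  qed
  \<comment> \<open>Countably many levels on the right side of each zero suffice.\<close>
  define al where "al i = \<xi>l + 1 / real (Suc i)" for i
  define au where "au i = \<xi>u - \<xi>u * (1 / real (Suc (Suc i)))" for i
  have lim: "(\<lambda>i. 1 / real (Suc i)) \<longlonglongrightarrow> 0" by (rule LIMSEQ_Suc[OF lim_1_over_n])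
  have al: "al \<longlonglongrightarrow> \<xi>l" unfolding al_def using tendsto_add[OF tendsto_const lim] by simp
  have au: "au \<longlonglongrightarrow> \<xi>u"
    unfolding au_def using tendsto_diff[OF tendsto_const tendsto_mult[OF tendsto_const LIMSEQ_Suc[OF lim]], of \<xi>u \<xi>u] by simp
  have "AE \<omega> in M. \<forall>i K. \<exists>k\<ge>K. x k \<omega> \<notin> {al i..}"
    unfolding AE_all_countable[where P="\<lambda>i \<omega>. \<forall>K. \<exists>k\<ge>K. x k \<omega> \<notin> {al i..}"]
    by (intro allI lower) (simp add: al_def)
  moreover have "AE \<omega> in M. \<forall>i K. \<exists>k\<ge>K. x k \<omega> \<notin> {0<..au i}"
    unfolding AE_all_countable[where P="\<lambda>i \<omega>. \<forall>K. \<exists>k\<ge>K. x k \<omega> \<notin> {0<..au i}"]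
  proof (intro allI upper)
    fix i
    have "\<xi>u * (1 / real (Suc (Suc i))) < \<xi>u * 1" using \<xi>u(1) by (intro mult_strict_left_mono) auto
    then show "0 < au i" by (simp add: au_def)
    show "au i < \<xi>u" using \<xi>u(1) by (simp add: au_def)
  qed
  ultimately have "AE \<omega> in M. Liminf at_top (\<lambda>t. ereal (X t \<omega>)) \<le> ereal \<xi>l \<and> ereal \<xi>u \<le> Limsup at_top (\<lambda>t. ereal (X t \<omega>))"
    using rec
  proof eventually_elim
    case (elim \<omega>)
    have freq: "\<exists>k\<ge>K. X (dt * real k) \<omega> \<le> al i" "\<exists>k\<ge>K. au i \<le> X (dt * real k) \<omega>" for i K
    proof -
      obtain k where "K \<le> k" "x k \<omega> \<notin> {al i..}" using elim(1) by blast
      then show "\<exists>k\<ge>K. X (dt * real k) \<omega> \<le> al i" by (intro exI[of _ k]) (auto simp: x_def)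
      obtain k where "K \<le> k" "x k \<omega> \<notin> {0<..au i}" using elim(2) by blast
      moreover have "0 < x k \<omega>" using elim(3) by blast
      ultimately show "\<exists>k\<ge>K. au i \<le> X (dt * real k) \<omega>" by (intro exI[of _ k]) (auto simp: x_def)
    qed
    have "\<exists>t\<ge>T. X t \<omega> \<le> al i" for i T
      by (rule frequently_of_grid[OF dt, where P="\<lambda>y. y \<le> al i" and X="\<lambda>t. X t \<omega>"]) (intro allI freq)
    moreover have "\<exists>t\<ge>T. au i \<le> X t \<omega>" for i T
      by (rule frequently_of_grid[OF dt, where P="\<lambda>y. au i \<le> y" and X="\<lambda>t. X t \<omega>"]) (intro allI freq)
    ultimately show ?case
      by (intro conjI Liminf_le_of_frequently[OF al] Limsup_ge_of_frequently[OF au])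
  qed
  moreover have "\<exists>!y. 0 < y \<and> ?fl y = 0" "\<exists>!y. 0 < y \<and> ?fu y = 0"
    using \<xi>l(1,2) \<xi>u(1,2) by (auto intro: ex1I[of _ \<xi>l] ex1I[of _ \<xi>u])
  ultimately show ?thesis unfolding zl zu by blast
qed

end
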